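(* Let $p\ge4$, let $X\in\mathbb R^p$ have density $f(\|x-\theta\|)$, and consider estimating $\theta\in\mathbb R^p$ under the loss $\|\delta-\theta\|^2$. Let $F(u)=\int_u^\infty sf(s)ds$, let $U=\{t\ge0: f(t)>0\}$, and let $\delta_*$ be the generalized Bayes estimator with respect to the harmonic prior $\|\theta\|^{2-p}$. 1. Assume $t^{-2}F(t)/f(t)$ is nonincreasing in $t$. (a) $\delta_*$ is minimax if $E_0[\|X\|^2]E_0[\|X\|^{-2}]\le2$. (b) Assume also that $f(t)$ is nonincreasing. Then $\delta_*$ is minimax if $(p^2-4)E_0[\|X\|^2]E_0[\|X\|^{-2}]\le2p^2$. (c) Assume also (in addition to the assumption of part 1) that $F(t)/f(t)$ is nondecreasing. Then $\delta_*$ is minimax if $(p-2)E_0[\|X\|^2]E_0[\|X\|^{-2}]\le2p$. 2. Assume $0<\inf_{s\in U}F(s)/f(s)<\infty$. Then $\delta_*$ is minimax if $E_0[\|X\|^2]\le2p\inf_{s\in U}F(s)/f(s)$.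
   Context: $\|\cdot\|$ is the Euclidean norm and $E_0$ denotes expectation when $\theta=0$. Explicitly, $\delta_*(x)=\int_{\mathbb R^p}\theta f(\|x-\theta\|)\|\theta\|^{2-p}d\theta\big/\int_{\mathbb R^p}f(\|x-\theta\|)\|\theta\|^{2-p}d\theta$, which equals $\left(1-\phi_*(\|x\|)/\|x\|^2\right)x$ with $\phi_*(r)=r^2\int_0^1t^{p-1}F(rt)dt\big/\int_0^1t^{p-3}F(rt)dt$. An estimator is minimax if it minimizes $\sup_\theta E_\theta\|\delta(X)-\theta\|^2$ over all estimators $\delta$; in this setting $X$ itself is minimax with constant risk. *)

theory Defs
  imports "HOL-Probability.Probability"
begin

text \<open>
  The dimension is \<open>p = CARD('n)\<close>. A radial density is a function \<open>f :: real \<Rightarrow> real\<close> of which only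
  the values on \<open>[0, \<infinity>)\<close> matter. Quantities that may be infinite (risks, moments, the tail integral
  \<open>F\<close>) take values in \<^typ>\<open>ennreal\<close>, so that no integrability has to be presupposed and a
  divergent integral is \<open>\<infinity>\<close> rather than the value 0 that the Bochner integral would return.
\<close>

definition radial_density :: "'n::finite itself \<Rightarrow> (real \<Rightarrow> real) \<Rightarrow> bool" where
  "radial_density _ f \<longleftrightarrow>
     f \<in> borel_measurable borel \<and> (\<forall>t\<ge>0. 0 \<le> f t) \<and>
     (\<integral>\<^sup>+ x. ennreal (f (norm x)) \<partial>(lborel :: (real^'n) measure)) = 1"

definition sph_dist :: "(real \<Rightarrow> real) \<Rightarrow> real^'n::finite \<Rightarrow> (real^'n) measure" where
  "sph_dist f \<theta> = density lborel (\<lambda>x. ennreal (f (norm (x - \<theta>))))"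

text \<open>\<open>E\<^sub>\<theta>[h(X)]\<close>, for nonnegative \<open>h\<close>.\<close>
definition expect :: "(real \<Rightarrow> real) \<Rightarrow> real^'n::finite \<Rightarrow> (real^'n \<Rightarrow> real) \<Rightarrow> ennreal" where
  "expect f \<theta> h = (\<integral>\<^sup>+ x. ennreal (h x) \<partial>sph_dist f \<theta>)"

definition risk :: "(real \<Rightarrow> real) \<Rightarrow> (real^'n::finite \<Rightarrow> real^'n) \<Rightarrow> real^'n \<Rightarrow> ennreal" where
  "risk f \<delta> \<theta> = expect f \<theta> (\<lambda>x. (norm (\<delta> x - \<theta>))\<^sup>2)"

definition minimax :: "(real \<Rightarrow> real) \<Rightarrow> (real^'n::finite \<Rightarrow> real^'n) \<Rightarrow> bool" where
  "minimax f \<delta> \<longleftrightarrow>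
     \<delta> \<in> borel_measurable borel \<and>
     (\<forall>\<delta>' :: real^'n \<Rightarrow> real^'n. \<delta>' \<in> borel_measurable borel \<longrightarrow>
        (SUP \<theta>. risk f \<delta> \<theta>) \<le> (SUP \<theta>. risk f \<delta>' \<theta>))"

definition tail_int :: "(real \<Rightarrow> real) \<Rightarrow> real \<Rightarrow> ennreal" where
  "tail_int f u = (\<integral>\<^sup>+ s\<in>{u..}. ennreal (s * f s) \<partial>lborel)"

text \<open>
  \<open>F/f\<close>. By the conventions of \<^typ>\<open>ennreal\<close>, this is \<open>\<infinity>\<close> where \<open>f t = 0 < F t\<close>.
\<close>
definition tail_ratio :: "(real \<Rightarrow> real) \<Rightarrow> real \<Rightarrow> ennreal" where
  "tail_ratio f t = tail_int f t / ennreal (f t)"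

text \<open>
  The domain on which monotonicity of \<open>F/f\<close> and \<open>t\<^sup>-\<^sup>2 F/f\<close> is required: past the essential supremum
  of the support \<open>F\<close> vanishes and the ratio is \<open>0/0\<close>. The point 0, at which \<open>t\<^sup>-\<^sup>2\<close> is undefined, is
  left out.
\<close>
definition tail_dom :: "(real \<Rightarrow> real) \<Rightarrow> real set" where
  "tail_dom f = {t. 0 < t \<and> 0 < tail_int f t}"

text \<open>
  The posterior mean under the prior density \<open>\<parallel>\<theta>\<parallel>\<^bsup>2-p\<^esup>\<close>. For a radial density and \<open>p \<ge> 3\<close> both
  integrals converge for every \<open>x \<noteq> 0\<close>.
\<close>
definition harmonic_bayes :: "(real \<Rightarrow> real) \<Rightarrow> real^'n::finite \<Rightarrow> real^'n" where
  "harmonic_bayes f x =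
     (\<integral>\<theta>. (f (norm (x - \<theta>)) * norm \<theta> powi (2 - int CARD('n))) *\<^sub>R \<theta> \<partial>lborel) /\<^sub>R
     (\<integral>\<theta>. f (norm (x - \<theta>)) * norm (\<theta> :: real^'n) powi (2 - int CARD('n)) \<partial>lborel)"

end

theory Submission
  imports Defs
begin

text \<open>
  Write \<open>\<delta>\<^sub>* x = x - \<psi> \<parallel>x\<parallel> x\<close> and \<open>h t\<close> for the mean of \<open>\<psi> \<parallel>x\<parallel>\<close> over the sphere of radius \<open>t\<close> around
  \<open>\<theta>\<close>. Integration by parts on spheres bounds the cross term of the risk by the means of \<open>h\<close> over balls,
  and \<open>\<parallel>x\<parallel>\<^sup>2 (\<psi> \<parallel>x\<parallel>)\<^sup>2 \<le> (p - 2) / p E\<^sub>0[\<parallel>X\<parallel>\<^sup>2] \<psi> \<parallel>x\<parallel>\<close> bounds the quadratic term, so that the risk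
  is at most \<open>E\<^sub>0[\<parallel>X\<parallel>\<^sup>2]\<close> as soon as a one-dimensional inequality between integrals of \<open>h\<close> against \<open>f\<close> and
  \<open>F\<close> holds. In part 2 it follows from \<open>c f \<le> F\<close>. In part 1 the ratio condition makes \<open>\<psi>\<close>
  superharmonic, hence \<open>h t\<close> is nonincreasing and \<open>t\<^sup>2 h t\<close> nondecreasing, and the inequality is
  obtained from Chebyshev's correlation inequality, in (b) after writing \<open>f\<close> as a mixture of uniform
  densities. Conversely, averaging over large balls of parameters shows that no estimator has a
  supremal risk below \<open>E\<^sub>0[\<parallel>X\<parallel>\<^sup>2]\<close>.
\<close>

section \<open>Polar coordinates\<close>

text \<open>The field \<psi> \<parallel>x\<parallel> x has divergence p \<psi> + r \<psi>' = (p - 2)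
  \<psi> + \<phi>' / r, where \<phi> = r^2 \<psi>. Since \<phi> is nondecreasing, the flux through a
  sphere is at least p - 2 times the ball integral of \<psi>, and \<phi> is at most its limit at
  infinity, whence the coefficient (p - 2) / p of the quadratic term. The common factor p - 2
  cancels, and what remains for all four criteria is
  \<open>I2 * Hh \<le> 2 * real p * I * HF\<close>, where \<open>Hh\<close> and \<open>HF\<close>
  integrate t^(p-1) h against f and against F. In part 1 each criterion uses one Chebyshev
  inequality with its own weights. The factor p^2 / (p^2 - 4) in (b) is the value of E|X|^2
  E|X|^(-2) for a uniform law on a ball. The factor p / (p - 2) in (c) arises because t^(p-3) F
  integrates to 1 / (p - 2) times the integral of t^(p-1) f. The main obstacle is superharmonicity
  of \<psi>: it means that \<open>\<kappa>\<close> = - r^(p-1) \<psi>' is nondecreasing, but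
  \<open>\<kappa>\<close> contains F and f is merely measurable, so only one-sided comparison at
  each point is available. The algebra that closes this step relies on p \<ge> 4.\<close>

text \<open>
  The uniform law on the unit sphere is represented as the law of \<open>sgn z\<close> under \<open>unif_ball\<close>, and
  \<open>polar_const\<close> is the surface area of the sphere.
\<close>

definition unif_ball :: "'a::euclidean_space measure" where
  "unif_ball = uniform_measure lborel (cball 0 1)"

definition polar_const :: "'a::euclidean_space itself \<Rightarrow> real" where
  "polar_const _ = DIM('a) * measure lborel (cball (0::'a) 1)"

lemma polar_const_pos: "polar_const TYPE('a::euclidean_space) > 0"
  using content_cball_gt_0_iff[of "0::'a" 1] by (simp add: polar_const_def)

lemma emeasure_unit_cball:
  "emeasure lborel (cball (0::'a::euclidean_space) 1) = ennreal (measure lborel (cball (0::'a) 1))"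
  using emeasure_lborel_cball_finite[of "0::'a" 1] by (intro emeasure_eq_ennreal_measure) auto

lemma prob_space_unif_ball: "prob_space (unif_ball :: 'a::euclidean_space measure)"
  unfolding unif_ball_def
  using content_cball_gt_0_iff[of "0::'a" 1]
  by (intro prob_space_uniform_measure) (auto simp: emeasure_unit_cball simp del: content_cball_gt_0_iff)

lemma sets_unif_ball [simp, measurable_cong]: "sets unif_ball = sets borel"
  and space_unif_ball [simp]: "space unif_ball = UNIV"
  by (simp_all add: unif_ball_def)

lemma measurable_sgn_euclidean [measurable]: "(sgn :: 'a::euclidean_space \<Rightarrow> 'a) \<in> borel_measurable borel"
  unfolding sgn_div_norm[abs_def] by measurable

text \<open>\<open>sgn\<close> is constant along rays, so dilation by \<open>r\<close> carries the
  unit sector onto the sector of radius \<open>r\<close>, and Lebesgue measure scales by the power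
  \<open>DIM('a)\<close>.\<close>

lemma emeasure_sector:
  fixes B :: "'a::euclidean_space set"
  assumes [measurable]: "B \<in> sets borel"
  assumes r: "r > 0"
  shows "emeasure lborel {x. norm x \<le> r \<and> sgn x \<in> B} =
     ennreal (r ^ DIM('a)) * emeasure lborel {x. norm x \<le> 1 \<and> sgn x \<in> B}"
proof -
  have eq: "(\<lambda>x. 0 + r *\<^sub>R x) -` {x. norm x \<le> r \<and> sgn x \<in> B} = {x. norm x \<le> 1 \<and> sgn x \<in> B}"
    using r by (auto simp: sgn_scaleR)
  have m: "{x. norm x \<le> r \<and> sgn x \<in> B} \<in> sets borel" by measurable
  have "emeasure lborel {x. norm x \<le> r \<and> sgn x \<in> B} =
     ennreal (\<bar>r\<bar> ^ DIM('a)) * emeasure (distr lborel borel (\<lambda>x. 0 + r *\<^sub>R x)) {x. norm x \<le> r \<and> sgn x \<in> B}"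
    using m r
    by (subst lborel_affine[of r "0::'a"], simp, subst emeasure_density)
       (simp_all add: nn_integral_cmult_indicator)
  also have "\<dots> = ennreal (r ^ DIM('a)) * emeasure lborel {x. norm x \<le> 1 \<and> sgn x \<in> B}"
    using m r by (subst emeasure_distr) (simp_all add: eq[simplified] sgn_scaleR)
  finally show ?thesis .
qed

text \<open>The integrand is the exact derivative of \<open>c * s ^ k\<close>; carrying the constant
  \<open>c\<close> along lets later weighted powers be brought into this shape directly.\<close>

lemma nn_integral_power_Icc:
  assumes "r \<ge> 0" "c \<ge> 0" "k > 0"
  shows "(\<integral>\<^sup>+ s. ennreal (c * real k * s ^ (k - 1)) * indicator {0..r} s \<partial>lborel) = ennreal (c * r ^ k)"
proof -
  have "(\<integral>\<^sup>+ s. ennreal (c * real k * s ^ (k - 1)) * indicator {0..r} s \<partial>lborel) =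
    ennreal (c * r ^ k - c * 0 ^ k)"
    using assms
    by (intro nn_integral_FTC_Icc) (auto intro!: derivative_eq_intros)
  thus ?thesis using assms by (simp add: zero_power)
qed

text \<open>Rectangles \<open>A \<times> B\<close> determine both sides. For fixed \<open>B\<close>
  each side is a measure in \<open>A\<close>, and on the half-lines \<open>{..r}\<close> the two
  agree by the scaling of sectors.\<close>

lemma polar_coordinates_measure:
  "density lborel (\<lambda>r. ennreal (polar_const TYPE('a::euclidean_space) * r ^ (DIM('a) - 1)) * indicator {0<..} r)
     \<Otimes>\<^sub>M distr unif_ball borel sgn = distr lborel (borel \<Otimes>\<^sub>M borel) (\<lambda>x::'a. (norm x, sgn x))"
  (is "?D \<Otimes>\<^sub>M ?N = ?M")
proof (rule pair_measure_eqI)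
  interpret U: prob_space "unif_ball :: 'a measure" by (rule prob_space_unif_ball)
  interpret N: prob_space "distr unif_ball borel (sgn :: 'a \<Rightarrow> 'a)" by (rule U.prob_space_distr) simp
  show "sigma_finite_measure ?N" by unfold_locales
  show "sigma_finite_measure ?D"
    by (subst sigma_finite_measure.sigma_finite_iff_density_finite'[OF sigma_finite_lborel]) (auto simp: ennreal_mult_eq_top_iff indicator_def)
  show "sets (?D \<Otimes>\<^sub>M ?N) = sets ?M" by (simp cong: sets_pair_measure_cong)
  fix A :: "real set" and B :: "'a set"
  assume "A \<in> sets ?D" "B \<in> sets ?N"
  hence A[measurable]: "A \<in> sets borel" and B[measurable]: "B \<in> sets borel" by auto
  let ?v = "measure lborel (cball (0::'a) 1)"
  have v: "?v > 0" by simp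
  \<comment> \<open>The direction law comes from the ball, so its mass on \<open>B\<close> is the
    volume of a sector over the volume of the ball; multiplying out avoids divisions below.\<close>
  have NB: "ennreal ?v * emeasure ?N B = emeasure lborel {x::'a. norm x \<le> 1 \<and> sgn x \<in> B}"
  proof -
    have "emeasure ?N B = emeasure lborel (cball 0 1 \<inter> (sgn -` B)) / emeasure lborel (cball (0::'a) 1)"
      by (subst emeasure_distr, simp, simp) (auto simp: unif_ball_def emeasure_uniform_measure intro!: emeasure_uniform_measure measurable_sets_borel[OF measurable_sgn_euclidean])
    also have "cball 0 1 \<inter> (sgn -` B) = {x::'a. norm x \<le> 1 \<and> sgn x \<in> B}" by auto
    finally show ?thesis
      using v by (simp add: emeasure_unit_cball ennreal_times_divide, subst mult.commute, subst mult_divide_eq_ennreal) auto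
  qed
  have D: "emeasure ?D {..r} = (if r \<le> 0 then 0 else ennreal (?v * r ^ DIM('a)))" for r
  proof -
    have "emeasure ?D {..r} = (\<integral>\<^sup>+ s. ennreal (?v * real DIM('a) * s ^ (DIM('a) - 1)) * (indicator {0<..} s * indicator {..r} s) \<partial>lborel)"
      by (subst emeasure_density) (auto simp: polar_const_def mult_ac)
    also have "\<dots> = (if r \<le> 0 then 0 else ennreal (?v * r ^ DIM('a)))"
    proof (cases "r \<le> 0")
      case True
      hence "indicator {0<..} s * indicator {..r} s = (0::ennreal)" for s :: real
        by (auto simp: indicator_def)
      thus ?thesis using True by (simp del: mult_eq_0_iff)
    next
      case False
      have "(\<integral>\<^sup>+ s. ennreal (?v * real DIM('a) * s ^ (DIM('a) - 1)) * (indicator {0<..} s * indicator {..r} s) \<partial>lborel)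
        = (\<integral>\<^sup>+ s. ennreal (?v * real DIM('a) * s ^ (DIM('a) - 1)) * indicator {0..r} s \<partial>lborel)"
        using AE_lborel_singleton[of "0::real"]
        by (intro nn_integral_cong_AE) (auto simp: indicator_def elim!: eventually_mono)
      thus ?thesis using False by (subst (asm) nn_integral_power_Icc) auto
    qed
    finally show ?thesis .
  qed
  define M1 where "M1 = scale_measure (emeasure ?N B) ?D"
  define M2 where "M2 = distr (density lborel (indicator (sgn -` B))) borel (norm :: 'a \<Rightarrow> real)"
  have sB[measurable]: "(sgn -` B :: 'a set) \<in> sets borel"
    by (intro measurable_sets_borel[OF measurable_sgn_euclidean]) simp
  have M2: "emeasure M2 A = emeasure ?M (A \<times> B)" if [measurable]: "A \<in> sets borel" for A
  proof -
    have "emeasure M2 A = (\<integral>\<^sup>+ x. indicator (sgn -` B) x * indicator (norm -` A) x \<partial>(lborel :: 'a measure))"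
      unfolding M2_def by (subst emeasure_distr, simp, simp, subst emeasure_density) (auto intro!: measurable_sets_borel[OF borel_measurable_norm] simp: indicator_vimage)
    also have "\<dots> = (\<integral>\<^sup>+ x. indicator ((\<lambda>x. (norm x, sgn x)) -` (A \<times> B)) x \<partial>(lborel :: 'a measure))"
      by (intro nn_integral_cong) (auto simp: indicator_def)
    also have "\<dots> = emeasure lborel ((\<lambda>x::'a. (norm x, sgn x)) -` (A \<times> B))"
      by (intro nn_integral_indicator) (simp add: vimage_def, measurable)
    also have "\<dots> = emeasure ?M (A \<times> B)"
      by (subst emeasure_distr) auto
    finally show ?thesis .
  qed
  have "M1 = M2"
  proof (rule measure_eqI_generator_eq[where E="range (\<lambda>r. {..r})" and \<Omega>=UNIV and A="\<lambda>n. {..real n}"])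
    show "Int_stable (range (\<lambda>r::real. {..r}))"
      by (auto simp: Int_stable_def)
    show "sets M1 = sigma_sets UNIV (range (\<lambda>r. {..r}))" "sets M2 = sigma_sets UNIV (range (\<lambda>r. {..r}))"
      unfolding M1_def M2_def by (simp_all add: borel_eq_atMost)
    show "(\<Union>i. {..real i}) = UNIV" by (auto intro: real_arch_simple)
    fix n :: nat
    show "emeasure M1 {..real n} \<noteq> \<infinity>"
      by (auto simp: M1_def D ennreal_mult_eq_top_iff simp del: One_nat_def split: if_splits)
  next
    fix X assume "X \<in> range (\<lambda>r::real. {..r})"
    then obtain r where X: "X = {..r}" by auto
    have "emeasure M2 {..r} = emeasure lborel {x. norm x \<le> r \<and> sgn x \<in> B}"
      by (subst M2, simp, subst emeasure_distr) (auto simp: vimage_def conj_commute)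
    also have "\<dots> = emeasure M1 {..r}"
    proof (cases "r \<le> 0")
      case True
      hence "emeasure lborel {x. norm x \<le> r \<and> sgn x \<in> B} \<le> emeasure lborel {0::'a}"
        by (intro emeasure_mono subsetI) (auto dest: order_trans[of "norm _" r 0])
      thus ?thesis using True by (simp add: M1_def D del: One_nat_def)
    next
      case False
      hence "emeasure M1 {..r} = emeasure ?N B * ennreal (?v * r ^ DIM('a))"
        by (simp add: M1_def D del: One_nat_def)
      also have "\<dots> = ennreal (r ^ DIM('a)) * (ennreal ?v * emeasure ?N B)"
        using False by (simp add: ennreal_mult' mult_ac)
      also have "\<dots> = emeasure lborel {x. norm x \<le> r \<and> sgn x \<in> B}"
        using False by (subst NB, subst emeasure_sector) auto
      finally show ?thesis ..
    qed
    finally show "emeasure M1 X = emeasure M2 X" by (simp add: X)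
  qed auto
  hence "emeasure M1 A = emeasure M2 A" by simp
  thus "emeasure ?D A * emeasure ?N B = emeasure ?M (A \<times> B)"
    by (simp add: M1_def M2 mult_ac)
qed

lemma nn_integral_polar:
  fixes G :: "'a::euclidean_space \<Rightarrow> ennreal"
  assumes [measurable]: "G \<in> borel_measurable borel"
  shows "(\<integral>\<^sup>+ x. G x \<partial>lborel) =
    (\<integral>\<^sup>+ r\<in>{0<..}. ennreal (polar_const TYPE('a) * r ^ (DIM('a) - 1)) * (\<integral>\<^sup>+ z. G (r *\<^sub>R sgn z) \<partial>unif_ball) \<partial>lborel)"
proof -
  interpret U: prob_space "unif_ball :: 'a measure" by (rule prob_space_unif_ball)
  interpret N: prob_space "distr unif_ball borel (sgn :: 'a \<Rightarrow> 'a)" by (rule U.prob_space_distr) simp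
  let ?d = "\<lambda>r. ennreal (polar_const TYPE('a) * r ^ (DIM('a) - 1)) * indicator {0<..} r"
  have "(\<integral>\<^sup>+ x. G x \<partial>lborel) = (\<integral>\<^sup>+ x. G (fst (norm x, sgn x) *\<^sub>R snd (norm x, sgn x)) \<partial>lborel)"
    by (intro nn_integral_cong arg_cong[where f=G], case_tac "x = 0") (simp_all add: sgn_div_norm)
  also have "\<dots> = (\<integral>\<^sup>+ y. G (fst y *\<^sub>R snd y) \<partial>distr lborel (borel \<Otimes>\<^sub>M borel) (\<lambda>x::'a. (norm x, sgn x)))"
    by (subst nn_integral_distr) auto
  also have "\<dots> = (\<integral>\<^sup>+ y. G (fst y *\<^sub>R snd y) \<partial>(density lborel ?d \<Otimes>\<^sub>M distr unif_ball borel sgn))"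
    by (simp only: polar_coordinates_measure)
  also have "\<dots> = (\<integral>\<^sup>+ r. (\<integral>\<^sup>+ w. G (r *\<^sub>R w) \<partial>distr unif_ball borel sgn) \<partial>density lborel ?d)"
    by (subst N.nn_integral_fst[symmetric]) (auto cong: measurable_cong_sets)
  also have "\<dots> = (\<integral>\<^sup>+ r. ?d r * (\<integral>\<^sup>+ w. G (r *\<^sub>R w) \<partial>distr unif_ball borel sgn) \<partial>lborel)"
    by (subst nn_integral_density) auto
  also have "\<dots> = (\<integral>\<^sup>+ r\<in>{0<..}. ennreal (polar_const TYPE('a) * r ^ (DIM('a) - 1)) * (\<integral>\<^sup>+ z. G (r *\<^sub>R sgn z) \<partial>unif_ball) \<partial>lborel)"
    by (intro nn_integral_cong) (auto simp: nn_integral_distr mult_ac)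
  finally show ?thesis .
qed

lemma integral_polar:
  fixes G :: "'a::euclidean_space \<Rightarrow> real"
  assumes G: "integrable lborel G"
  shows "(\<integral>x. G x \<partial>lborel) =
    (\<integral>r\<in>{0<..}. (polar_const TYPE('a) * r ^ (DIM('a) - 1)) * (\<integral>z. G (r *\<^sub>R sgn z) \<partial>unif_ball) \<partial>lborel)"
proof -
  interpret U: prob_space "unif_ball :: 'a measure" by (rule prob_space_unif_ball)
  interpret N: prob_space "distr unif_ball borel (sgn :: 'a \<Rightarrow> 'a)" by (rule U.prob_space_distr) simp
  have [measurable]: "G \<in> borel_measurable borel" using G by auto
  let ?d = "\<lambda>r. ennreal (polar_const TYPE('a) * r ^ (DIM('a) - 1)) * indicator {0<..} r"
  let ?dr = "\<lambda>r::real. indicator {0<..} r * (polar_const TYPE('a) * r ^ (DIM('a) - 1))"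
  have d: "?d = (\<lambda>r. ennreal (?dr r))" by (auto simp: indicator_def)
  have dr: "?dr r \<ge> 0" for r using polar_const_pos[where 'a='a] by (auto simp: indicator_def)
  interpret D: sigma_finite_measure "density lborel ?d"
    by (subst sigma_finite_measure.sigma_finite_iff_density_finite'[OF sigma_finite_lborel]) (auto simp: ennreal_mult_eq_top_iff indicator_def)
  interpret P: pair_sigma_finite "density lborel ?d" "distr unif_ball borel (sgn :: 'a \<Rightarrow> 'a)" ..
  have eqG: "G x = G (fst (norm x, sgn x) *\<^sub>R snd (norm x, sgn x))" for x
    by (cases "x = 0") (simp_all add: sgn_div_norm)
  have eqG': "G (norm x *\<^sub>R sgn x) = G x" for x
    using eqG[of x] by simp
  have i: "integrable (distr lborel (borel \<Otimes>\<^sub>M borel) (\<lambda>x::'a. (norm x, sgn x))) (\<lambda>y. G (fst y *\<^sub>R snd y))"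
    using G by (subst integrable_distr_eq) (simp_all add: eqG')
  have "(\<integral>x. G x \<partial>lborel) = (\<integral>y. G (fst y *\<^sub>R snd y) \<partial>distr lborel (borel \<Otimes>\<^sub>M borel) (\<lambda>x::'a. (norm x, sgn x)))"
    by (subst integral_distr) (simp_all add: eqG')
  also have "\<dots> = (\<integral>y. G (fst y *\<^sub>R snd y) \<partial>(density lborel ?d \<Otimes>\<^sub>M distr unif_ball borel sgn))"
    by (simp only: polar_coordinates_measure)
  also have "\<dots> = (\<integral>r. (\<integral>w. G (r *\<^sub>R w) \<partial>distr unif_ball borel sgn) \<partial>density lborel ?d)"
    using i unfolding polar_coordinates_measure[symmetric]
    by (subst P.integral_fst'[symmetric]) (auto cong: measurable_cong_sets)
  also have "\<dots> = (\<integral>r. ?dr r * (\<integral>w. G (r *\<^sub>R w) \<partial>distr unif_ball borel sgn) \<partial>lborel)"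
    unfolding d using dr by (subst integral_real_density) auto
  also have "\<dots> = (\<integral>r\<in>{0<..}. (polar_const TYPE('a) * r ^ (DIM('a) - 1)) * (\<integral>z. G (r *\<^sub>R sgn z) \<partial>unif_ball) \<partial>lborel)"
    unfolding set_lebesgue_integral_def
    by (intro Bochner_Integration.integral_cong) (auto simp: integral_distr mult_ac)
  finally show ?thesis .
qed

section \<open>Integration by parts on the sphere\<close>

text \<open>Difference quotients integrate to 0 by translation invariance, and dominated convergence
  passes to the derivative. Boundedness and measurability of \<open>D\<close> are enough for this,
  without continuity.\<close>

lemma integral_directional_derivative_eq_0:
  fixes \<Phi> D :: "'a::euclidean_space \<Rightarrow> real" and e :: 'a
  assumes deriv: "\<And>x. ((\<lambda>s. \<Phi> (x + s *\<^sub>R e)) has_real_derivative D x) (at 0)"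
    and supp: "\<And>x. norm x > R \<Longrightarrow> \<Phi> x = 0"
    and bound: "\<And>x. \<bar>D x\<bar> \<le> C"
    and int: "integrable lborel \<Phi>" and [measurable]: "D \<in> borel_measurable borel"
  shows "integrable lborel D" "(\<integral>x. D x \<partial>lborel) = 0"
proof -
  have [measurable]: "\<Phi> \<in> borel_measurable borel" using int by auto
  define q where "q = (\<lambda>n x. (\<Phi> (x + inverse (real (Suc n)) *\<^sub>R e) - \<Phi> x) / inverse (real (Suc n)))"
  have d: "((\<lambda>s. \<Phi> (x + s *\<^sub>R e)) has_real_derivative D (x + t *\<^sub>R e)) (at t)" for x t
    using deriv[of "x + t *\<^sub>R e"] DERIV_shift[of "\<lambda>s. \<Phi> (x + s *\<^sub>R e)" "D (x + t *\<^sub>R e)" 0 t]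
    by (simp add: scaleR_add_left add_ac)
  have C: "C \<ge> 0" using bound[of 0] by linarith
  have lim: "(\<lambda>n. q n x) \<longlonglongrightarrow> D x" for x
  proof -
    have "((\<lambda>h. (\<Phi> (x + h *\<^sub>R e) - \<Phi> x) / h) \<longlongrightarrow> D x) (at 0)"
      using deriv[of x] by (simp add: has_field_derivative_def DERIV_def flip: has_field_derivative_def)
    moreover have "filterlim (\<lambda>n. inverse (real (Suc n))) (at 0) sequentially"
      by (intro filterlim_atI LIMSEQ_inverse_real_of_nat) auto
    ultimately show ?thesis unfolding q_def by (rule filterlim_compose)
  qed
  \<comment> \<open>Inside the enlarged ball the mean value theorem bounds the quotient; outside it,
    a step of length at most \<open>norm e\<close> cannot reach the support.\<close>
  have qb: "norm (q n x) \<le> C * indicator (cball 0 (R + norm e)) x" for n x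
  proof (cases "norm x \<le> R + norm e")
    case True
    let ?h = "inverse (real (Suc n))"
    have "\<exists>z::real. 0 < z \<and> z < ?h \<and> \<Phi> (x + ?h *\<^sub>R e) - \<Phi> (x + 0 *\<^sub>R e) = (?h - 0) * D (x + z *\<^sub>R e)"
      using MVT2[of 0 ?h "\<lambda>s. \<Phi> (x + s *\<^sub>R e)" "\<lambda>z. D (x + z *\<^sub>R e)"] d by simp
    then obtain z where "\<Phi> (x + ?h *\<^sub>R e) - \<Phi> x = ?h * D (x + z *\<^sub>R e)" by auto
    hence "q n x = D (x + z *\<^sub>R e)" by (simp add: q_def)
    thus ?thesis using bound True by (simp add: indicator_def)
  next
    case False
    let ?h = "inverse (real (Suc n))"
    have "norm (?h *\<^sub>R e) \<le> 1 * norm e"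
      unfolding norm_scaleR by (intro mult_right_mono) (auto simp: field_simps)
    hence "norm (x + ?h *\<^sub>R e) > R" using False norm_diff_ineq[of x "?h *\<^sub>R e"] by linarith
    moreover have "norm x > R" using False norm_ge_zero[of e] by linarith
    ultimately have "q n x = 0" using supp by (simp add: q_def)
    thus ?thesis using C by (simp add: indicator_def)
  qed
  have q0: "(\<integral>x. q n x \<partial>lborel) = 0" for n
  proof -
    let ?h = "inverse (real (Suc n))"
    have D: "distr lborel borel (\<lambda>x. ?h *\<^sub>R e + x) = lborel"
      using lborel_distr_plus[of "?h *\<^sub>R e"] by simp
    have "integrable (distr lborel borel (\<lambda>x. ?h *\<^sub>R e + x)) \<Phi>" using int unfolding D .
    hence i: "integrable lborel (\<lambda>x. \<Phi> (x + ?h *\<^sub>R e))"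
      by (subst (asm) integrable_distr_eq) (auto simp: add.commute)
    have "(\<integral>x. \<Phi> x \<partial>lborel) = (\<integral>x. \<Phi> x \<partial>distr lborel borel (\<lambda>x. ?h *\<^sub>R e + x))"
      by (simp only: D)
    also have "\<dots> = (\<integral>x. \<Phi> (x + ?h *\<^sub>R e) \<partial>lborel)"
      by (subst integral_distr) (auto simp: add.commute)
    finally show ?thesis unfolding q_def using i int by simp
  qed
  have w: "integrable lborel (\<lambda>x::'a. C * indicator (cball 0 (R + norm e)) x)"
    using emeasure_lborel_cball_finite[of "0::'a" "R + norm e"]
    by (intro integrable_mult_right integrable_real_indicator) auto
  have m: "q n \<in> borel_measurable lborel" for n unfolding q_def by measurable
  have D[measurable]: "D \<in> borel_measurable lborel" by simp
  have al: "AE x in lborel. (\<lambda>n. q n x) \<longlonglongrightarrow> D x" by (intro AE_I2 lim)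
  have ab: "AE x in lborel. norm (q n x) \<le> C * indicator (cball 0 (R + norm e)) x" for n by (intro AE_I2 qb)
  have *: "(\<lambda>n. \<integral>x. q n x \<partial>lborel) \<longlonglongrightarrow> (\<integral>x. D x \<partial>lborel)"
    by (rule integral_dominated_convergence[where s=q, OF D m w al ab])
  show "integrable lborel D"
    by (rule integrable_dominated_convergence[where s=q, OF D m w al ab])
  show "(\<integral>x. D x \<partial>lborel) = 0" using * by (simp add: q0 LIMSEQ_const_iff)
qed

lemma abs_sgn_inner_le_1:
  assumes "norm (e::'a::euclidean_space) = 1"
  shows "\<bar>sgn x \<bullet> e\<bar> \<le> 1"
  using Cauchy_Schwarz_ineq2[of "sgn x" e] assms by (auto simp: norm_sgn split: if_splits)

lemma has_real_derivative_norm_line: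
  fixes x e :: "'a::euclidean_space"
  assumes x: "x \<noteq> 0"
  shows "((\<lambda>s. norm (x + s *\<^sub>R e)) has_real_derivative sgn x \<bullet> e) (at 0)"
proof -
  have xx: "x \<bullet> x > 0" using x by simp
  have "((\<lambda>s. x \<bullet> x + 2 * s * (x \<bullet> e) + s\<^sup>2 * (e \<bullet> e)) has_real_derivative 2 * (x \<bullet> e)) (at 0)"
    by (auto intro!: derivative_eq_intros)
  from DERIV_chain2[OF _ this, of sqrt "inverse (sqrt (x \<bullet> x)) / 2"] DERIV_real_sqrt[OF xx]
  have "((\<lambda>s. sqrt (x \<bullet> x + 2 * s * (x \<bullet> e) + s\<^sup>2 * (e \<bullet> e))) has_real_derivative sgn x \<bullet> e) (at 0)"
    by (simp add: sgn_div_norm norm_eq_sqrt_inner)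
  moreover have "norm (x + s *\<^sub>R e) = sqrt (x \<bullet> x + 2 * s * (x \<bullet> e) + s\<^sup>2 * (e \<bullet> e))" for s
    by (simp add: norm_eq_sqrt_inner inner_add_left inner_add_right inner_commute power2_eq_square algebra_simps)
  ultimately show ?thesis by simp
qed

lemma has_real_derivative_sgn_inner_line:
  fixes x e :: "'a::euclidean_space"
  assumes x: "x \<noteq> 0" and e: "norm e = 1"
  shows "((\<lambda>s. sgn (x + s *\<^sub>R e) \<bullet> e) has_real_derivative (1 - (sgn x \<bullet> e)\<^sup>2) / norm x) (at 0)"
proof -
  have ee: "e \<bullet> e = 1" using e by (simp add: norm_eq_1)
  have "((\<lambda>s. (x \<bullet> e + s) / norm (x + s *\<^sub>R e)) has_real_derivative (1 - (sgn x \<bullet> e)\<^sup>2) / norm x) (at 0)"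
    using x by (auto intro!: derivative_eq_intros has_real_derivative_norm_line simp: sgn_div_norm power2_eq_square field_simps)
  thus ?thesis by (simp add: sgn_div_norm inner_add_left ee divide_inverse mult.commute)
qed

lemma continuous_on_Icc_bounded:
  fixes g :: "real \<Rightarrow> real"
  assumes "continuous_on {a..b} g"
  obtains C where "C \<ge> 0" "\<And>u. u \<in> {a..b} \<Longrightarrow> \<bar>g u\<bar> \<le> C"
proof -
  have "bounded (g ` {a..b})"
    using assms by (intro compact_imp_bounded compact_continuous_image) auto
  then obtain C where "\<forall>u\<in>{a..b}. \<bar>g u\<bar> \<le> C" unfolding bounded_iff by auto
  thus ?thesis using that[of "max 0 C"] by (auto simp: le_max_iff_disj)
qed

text \<open>Derived from flat space: the radial cutoff times \<open>g (sgn x \<bullet> e)\<close>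
  has compact support, so its derivative along \<open>e\<close> integrates to 0. In polar
  coordinates this is a linear relation between the two spherical integrals, whose radial
  coefficients are proportional.\<close>

lemma sphere_integration_by_parts:
  fixes e :: "'a::euclidean_space" and g g' :: "real \<Rightarrow> real"
  assumes e: "norm e = 1" and dim: "DIM('a) \<ge> 2"
    and deriv: "\<And>u. u \<in> {-1..1} \<Longrightarrow> (g has_real_derivative g' u) (at u within {-1..1})"
    and cont: "continuous_on {-1..1} g'"
  shows "(\<integral>z. (1 - (sgn z \<bullet> e)\<^sup>2) * g' (sgn z \<bullet> e) \<partial>unif_ball) =
         (real DIM('a) - 1) * (\<integral>z. (sgn z \<bullet> e) * g (sgn z \<bullet> e) \<partial>unif_ball)"
proof -
  interpret U: prob_space "unif_ball :: 'a measure" by (rule prob_space_unif_ball)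
  \<comment> \<open>\<open>g\<close> and \<open>g'\<close> are controlled on [-1, 1] only; composing
    with the clamp yields functions continuous on the whole line, hence Borel, that agree at every
    cosine.\<close>
  define cl :: "real \<Rightarrow> real" where "cl = (\<lambda>u. max (-1) (min 1 u))"
  have cl: "cl u \<in> {-1..1}" for u by (auto simp: cl_def)
  have u: "sgn z \<bullet> e \<in> {-1..1}" for z using abs_sgn_inner_le_1[OF e, of z] by auto
  have clu: "cl (sgn z \<bullet> e) = sgn z \<bullet> e" for z using u[of z] by (auto simp: cl_def)
  have contg: "continuous_on {-1..1} g" using deriv by (rule DERIV_continuous_on)
  have ccl: "continuous_on UNIV cl" unfolding cl_def by (intro continuous_intros)
  have "continuous_on UNIV (\<lambda>u. g (cl u))" "continuous_on UNIV (\<lambda>u. g' (cl u))"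
    using cl by (auto intro!: continuous_on_compose2[OF contg] continuous_on_compose2[OF cont] ccl)
  hence [measurable]: "(\<lambda>u. g (cl u)) \<in> borel_measurable borel" "(\<lambda>u. g' (cl u)) \<in> borel_measurable borel"
    by (auto intro: borel_measurable_continuous_onI)
  have "(\<lambda>z. g (cl (sgn z \<bullet> e))) \<in> borel_measurable borel" "(\<lambda>z. g' (cl (sgn z \<bullet> e))) \<in> borel_measurable borel"
    by measurable
  hence [measurable]: "(\<lambda>z. g (sgn z \<bullet> e)) \<in> borel_measurable borel" "(\<lambda>z. g' (sgn z \<bullet> e)) \<in> borel_measurable borel"
    by (simp_all add: clu)
  obtain G where G: "\<And>u. u \<in> {-1..1} \<Longrightarrow> \<bar>g u\<bar> \<le> G" and G0: "G \<ge> 0"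
    using continuous_on_Icc_bounded[OF contg] by metis
  obtain G' where G': "\<And>u. u \<in> {-1..1} \<Longrightarrow> \<bar>g' u\<bar> \<le> G'" and G0': "G' \<ge> 0"
    using continuous_on_Icc_bounded[OF cont] by metis
  note G0 = G0 G0'
  \<comment> \<open>The cutoff lives on [1, 3], away from the origin, where \<open>sgn\<close> is
    not smooth. Squaring the positive part makes it continuously differentiable at both
    ends.\<close>
  define k where "k = (\<lambda>r::real. max 0 ((r - 1) * (3 - r)))"
  define ch where "ch = (\<lambda>r. (k r)\<^sup>2)"
  define ch' where "ch' = (\<lambda>r. 2 * k r * (4 - 2 * r))"
  have ck: "continuous_on A k" for A unfolding k_def by (intro continuous_intros)
  have cchi: "continuous_on A ch" "continuous_on A ch'" for A
    unfolding ch_def ch'_def by (intro continuous_intros ck)+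
  have [measurable]: "ch \<in> borel_measurable borel" "ch' \<in> borel_measurable borel"
    using cchi by (auto intro: borel_measurable_continuous_onI)
  have dmax: "((\<lambda>y::real. (max 0 y)\<^sup>2) has_real_derivative 2 * max 0 y) (at y)" for y
  proof (cases y "0::real" rule: linorder_cases)
    case less
    have "((\<lambda>y. 0) has_real_derivative 0) (at y)" by simp
    hence "((\<lambda>y::real. (max 0 y)\<^sup>2) has_real_derivative 0) (at y)"
      by (rule has_field_derivative_transform_within_open[of _ _ _ "{..<0}"]) (use less in auto)
    thus ?thesis using less by simp
  next
    case greater
    have "((\<lambda>y. y\<^sup>2) has_real_derivative 2 * y) (at y)" by (auto intro!: derivative_eq_intros)
    hence "((\<lambda>y::real. (max 0 y)\<^sup>2) has_real_derivative 2 * y) (at y)"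
      by (rule has_field_derivative_transform_within_open[of _ _ _ "{0<..}"]) (use greater in auto)
    thus ?thesis using greater by simp
  next
    case equal
    have "((\<lambda>h::real. (max 0 h)\<^sup>2 / h) \<longlongrightarrow> 0) (at 0)"
      by (rule Lim_null_comparison[where g="\<lambda>h. \<bar>h\<bar>"])
         (auto intro!: always_eventually tendsto_eq_intros simp: max_def power2_eq_square)
    thus ?thesis using equal by (simp add: DERIV_def)
  qed
  have dchi: "(ch has_real_derivative ch' r) (at r)" for r
  proof -
    have "((\<lambda>r::real. (r - 1) * (3 - r)) has_real_derivative (4 - 2 * r)) (at r)"
      by (auto intro!: derivative_eq_intros)
    from DERIV_chain2[OF dmax this] show ?thesis
      by (simp add: ch_def[abs_def] ch'_def k_def)
  qed
  have k0: "k r = 0" if "r \<notin> {1..3}" for r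
  proof -
    have "(r - 1) * (3 - r) \<le> 0" using that by (auto simp: mult_le_0_iff)
    thus ?thesis by (simp add: k_def)
  qed
  obtain X where X: "\<And>r. r \<in> {1..3} \<Longrightarrow> \<bar>ch r\<bar> \<le> X" and X0: "X \<ge> 0"
    using continuous_on_Icc_bounded[OF cchi(1)] by metis
  obtain X' where X': "\<And>r. r \<in> {1..3} \<Longrightarrow> \<bar>ch' r\<bar> \<le> X'" and X0': "X' \<ge> 0"
    using continuous_on_Icc_bounded[OF cchi(2)] by metis
  note X0 = X0 X0'
  define \<Phi> where "\<Phi> = (\<lambda>x. ch (norm x) * g (sgn x \<bullet> e))"
  define D where "D = (\<lambda>x. ch' (norm x) * ((sgn x \<bullet> e) * g (sgn x \<bullet> e)) +
     ch (norm x) / norm x * ((1 - (sgn x \<bullet> e)\<^sup>2) * g' (sgn x \<bullet> e)))"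
  have [measurable]: "\<Phi> \<in> borel_measurable borel" "D \<in> borel_measurable borel"
    unfolding \<Phi>_def D_def by measurable
  have Phi_b: "\<bar>\<Phi> x\<bar> \<le> X * G * indicator (cball 0 3) x" for x
  proof (cases "norm x \<in> {1..3}")
    case True
    thus ?thesis unfolding \<Phi>_def abs_mult using X[OF True] G[OF u] X0 G0 by (auto intro!: mult_mono)
  next
    case False
    thus ?thesis using X0 G0 by (simp add: \<Phi>_def ch_def k0)
  qed
  have u2: "\<bar>1 - (sgn x \<bullet> e)\<^sup>2\<bar> \<le> 1" for x :: 'a
    using u[of x] by (simp add: abs_le_iff power2_le_iff_abs_le abs_square_le_1)
  have D_b: "\<bar>D x\<bar> \<le> X' * (1 * G) + X / 1 * (1 * G')" for x
  proof (cases "norm x \<in> {1..3}")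
    case True
    have "\<bar>D x\<bar> \<le> \<bar>ch' (norm x)\<bar> * (\<bar>sgn x \<bullet> e\<bar> * \<bar>g (sgn x \<bullet> e)\<bar>) +
      \<bar>ch (norm x)\<bar> / norm x * (\<bar>1 - (sgn x \<bullet> e)\<^sup>2\<bar> * \<bar>g' (sgn x \<bullet> e)\<bar>)"
      unfolding D_def by (rule order_trans[OF abs_triangle_ineq]) (simp add: abs_mult)
    also have "\<dots> \<le> X' * (1 * G) + X / 1 * (1 * G')"
      using X[OF True] X'[OF True] G[OF u] G'[OF u] X0 G0 True abs_sgn_inner_le_1[OF e, of x] u2[of x]
      by (intro add_mono mult_mono frac_le) auto
    finally show ?thesis .
  next
    case False
    thus ?thesis using X0 G0 by (simp add: D_def ch_def ch'_def k0)
  qed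
  have iPhi: "integrable lborel \<Phi>"
  proof (rule Bochner_Integration.integrable_bound)
    show "integrable lborel (\<lambda>x::'a. X * G * indicator (cball 0 3) x)"
      using emeasure_lborel_cball_finite[of "0::'a" 3]
      by (intro integrable_mult_right integrable_real_indicator) auto
  qed (use Phi_b X0 G0 in \<open>auto simp: abs_mult\<close>)
  have dPhi: "((\<lambda>s. \<Phi> (x + s *\<^sub>R e)) has_real_derivative D x) (at 0)" for x
  proof (cases "norm x < 1")
    case True
    have "((\<lambda>s. 0) has_real_derivative 0) (at (0::real))" by simp
    hence "((\<lambda>s. \<Phi> (x + s *\<^sub>R e)) has_real_derivative 0) (at 0)"
    proof (rule has_field_derivative_transform_within_open[of _ _ _ "{s. norm (x + s *\<^sub>R e) < 1}"])
      show "open {s. norm (x + s *\<^sub>R e) < 1}" by (intro open_Collect_less continuous_intros)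
    qed (use True in \<open>auto simp: \<Phi>_def ch_def k0\<close>)
    thus ?thesis using True by (simp add: D_def ch_def ch'_def k0)
  next
    case False
    hence x: "x \<noteq> 0" by auto
    have "((\<lambda>s. ch (norm (x + s *\<^sub>R e))) has_real_derivative ch' (norm x) * (sgn x \<bullet> e)) (at 0)"
      using DERIV_chain2[of ch "ch' (norm x)" "\<lambda>s. norm (x + s *\<^sub>R e)" 0] has_real_derivative_norm_line[OF x] dchi
      by simp
    moreover have "((\<lambda>s. g (sgn (x + s *\<^sub>R e) \<bullet> e)) has_real_derivative
       (1 - (sgn x \<bullet> e)\<^sup>2) / norm x * g' (sgn x \<bullet> e)) (at 0)"
    proof -
      have "(g has_real_derivative g' (sgn x \<bullet> e)) (at (sgn (x + 0 *\<^sub>R e) \<bullet> e) within {-1..1})"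
        using deriv[OF u[of x]] by simp
      \<comment> \<open>At the cosines 1 and -1 \<open>g\<close> has a one-sided derivative only.
        The chain rule relative to the image still applies, because the cosine never leaves
        [-1, 1].\<close>
      hence "(g has_real_derivative g' (sgn x \<bullet> e)) (at (sgn (x + 0 *\<^sub>R e) \<bullet> e) within range (\<lambda>s. sgn (x + s *\<^sub>R e) \<bullet> e))"
        by (rule DERIV_subset) (use u in auto)
      from DERIV_image_chain[OF this has_real_derivative_sgn_inner_line[OF x e]] show ?thesis
        by (simp add: mult.commute o_def)
    qed
    ultimately have "((\<lambda>s. \<Phi> (x + s *\<^sub>R e)) has_real_derivative
        ch' (norm x) * (sgn x \<bullet> e) * g (sgn (x + 0 *\<^sub>R e) \<bullet> e) + (1 - (sgn x \<bullet> e)\<^sup>2) / norm x * g' (sgn x \<bullet> e) * ch (norm (x + 0 *\<^sub>R e))) (at 0)"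
      unfolding \<Phi>_def by (rule DERIV_mult)
    thus ?thesis by (simp add: D_def algebra_simps add_divide_distrib diff_divide_distrib)
  qed
  note D = integral_directional_derivative_eq_0[OF dPhi _ D_b iPhi, of 3]
  have iD: "integrable lborel D" and D0: "(\<integral>x. D x \<partial>lborel) = 0"
    by (rule D; auto simp: \<Phi>_def ch_def k0)+
  let ?I = "\<integral>z. (sgn z \<bullet> e) * g (sgn z \<bullet> e) \<partial>unif_ball"
  let ?J = "\<integral>z. (1 - (sgn z \<bullet> e)\<^sup>2) * g' (sgn z \<bullet> e) \<partial>unif_ball"
  have iI: "integrable unif_ball (\<lambda>z. (sgn z \<bullet> e) * g (sgn z \<bullet> e))"
    using abs_sgn_inner_le_1[OF e] G[OF u] G0
    by (intro U.integrable_const_bound[of _ "1 * G"] AE_I2) (auto simp: abs_mult intro!: mult_mono[of _ 1 _ G, simplified])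
  have iJ: "integrable unif_ball (\<lambda>z. (1 - (sgn z \<bullet> e)\<^sup>2) * g' (sgn z \<bullet> e))"
    using u2 G'[OF u] G0
    by (intro U.integrable_const_bound[of _ "1 * G'"] AE_I2) (auto simp: abs_mult intro!: mult_mono[of _ 1 _ G', simplified])
  have E: "(\<integral>z. D (r *\<^sub>R sgn z) \<partial>unif_ball) = ch' r * ?I + ch r / r * ?J" if r: "r > 0" for r
  proof -
    have "AE z in unif_ball. (z::'a) \<noteq> 0"
      using AE_lborel_singleton[of "0::'a"] unfolding unif_ball_def
      by (intro AE_uniform_measureI) auto
    hence "AE z in unif_ball. D (r *\<^sub>R sgn z) = ch' r * ((sgn z \<bullet> e) * g (sgn z \<bullet> e)) + ch r / r * ((1 - (sgn z \<bullet> e)\<^sup>2) * g' (sgn z \<bullet> e))"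
    proof eventually_elim
      case (elim z)
      have "sgn (sgn z) = sgn z" "norm (sgn z) = 1" using elim by (auto simp: sgn_div_norm norm_sgn)
      thus ?case using r by (simp add: D_def sgn_scaleR)
    qed
    hence "(\<integral>z. D (r *\<^sub>R sgn z) \<partial>unif_ball) = (\<integral>z. ch' r * ((sgn z \<bullet> e) * g (sgn z \<bullet> e)) + ch r / r * ((1 - (sgn z \<bullet> e)\<^sup>2) * g' (sgn z \<bullet> e)) \<partial>unif_ball)"
      by (intro integral_cong_AE) measurable
    thus ?thesis using iI iJ by simp
  qed
  let ?p = "DIM('a)"
  obtain m where m: "?p = m + 2" using dim by (metis add.commute le_Suc_ex)
  have "0 = (\<integral>r\<in>{0<..}. polar_const TYPE('a) * r ^ (?p - 1) * (\<integral>z. D (r *\<^sub>R sgn z) \<partial>unif_ball) \<partial>lborel)"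
    using D0 integral_polar[OF iD] by simp
  also have "\<dots> = (\<integral>r\<in>{1..3}. polar_const TYPE('a) * (r ^ (?p - 1) * ch' r * ?I + r ^ (?p - 2) * ch r * ?J) \<partial>lborel)"
    unfolding set_lebesgue_integral_def
  proof (intro Bochner_Integration.integral_cong refl)
    fix r :: real
    show "indicator {0<..} r *\<^sub>R (polar_const TYPE('a) * r ^ (?p - 1) * (\<integral>z. D (r *\<^sub>R sgn z) \<partial>unif_ball)) =
      indicator {1..3} r *\<^sub>R (polar_const TYPE('a) * (r ^ (?p - 1) * ch' r * ?I + r ^ (?p - 2) * ch r * ?J))"
    proof (cases "r > 0")
      case True
      hence "r ^ (m + 1) * (x * I + y / r * J) = r ^ (m + 1) * x * I + r ^ m * y * J" for x y I J
        by (simp add: field_simps)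
      note this[of "ch' r" ?I "ch r" ?J]
      moreover have "?p - 1 = m + 1" "?p - 2 = m" using m by auto
      ultimately have "polar_const TYPE('a) * r ^ (?p - 1) * (\<integral>z. D (r *\<^sub>R sgn z) \<partial>unif_ball) =
         polar_const TYPE('a) * (r ^ (?p - 1) * ch' r * ?I + r ^ (?p - 2) * ch r * ?J)"
        using E[OF True] by (simp only: mult.assoc[of "polar_const TYPE('a)"])
      moreover have "ch r = 0 \<and> ch' r = 0" if "r \<notin> {1..3}" using k0[OF that] by (simp add: ch_def ch'_def)
      ultimately show ?thesis using True by (cases "r \<in> {1..3}") (simp_all only: indicator_simps, simp_all)
    qed (auto simp: indicator_def)
  qed
  also have "\<dots> = polar_const TYPE('a) * integral {1..3} (\<lambda>r. r ^ (?p - 1) * ch' r * ?I + r ^ (?p - 2) * ch r * ?J)"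
    by (subst set_borel_integral_eq_integral(2))
       (auto intro!: borel_integrable_atLeastAtMost' continuous_intros cchi)
  finally have "0 = integral {1..3} (\<lambda>r. r ^ (?p - 1) * ch' r * ?I + r ^ (?p - 2) * ch r * ?J)"
    using polar_const_pos[where 'a='a] by simp
  also have "\<dots> = integral {1..3} (\<lambda>r. r ^ (?p - 1) * ch' r) * ?I + integral {1..3} (\<lambda>r. r ^ (?p - 2) * ch r) * ?J"
    by (subst integral_add) (auto intro!: integrable_continuous_real continuous_intros cchi)
  \<comment> \<open>Radial integration by parts; the boundary terms vanish with the cutoff. Both
    spherical integrals then carry the same nonzero radial factor, which cancels.\<close>
  also have "integral {1..3} (\<lambda>r. r ^ (?p - 1) * ch' r) = - (real ?p - 1) * integral {1..3} (\<lambda>r. r ^ (?p - 2) * ch r)"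
  proof -
    have "((\<lambda>r. r ^ (?p - 1) * ch' r + (real ?p - 1) * (r ^ (?p - 2) * ch r)) has_integral (3 ^ (?p - 1) * ch 3 - 1 ^ (?p - 1) * ch 1)) {1..3}"
    proof (rule fundamental_theorem_of_calculus)
      fix r :: real
      show "((\<lambda>r. r ^ (?p - 1) * ch r) has_vector_derivative r ^ (?p - 1) * ch' r + (real ?p - 1) * (r ^ (?p - 2) * ch r)) (at r within {1..3})"
      proof -
        have e: "?p - 1 = Suc m" "?p - 2 = m" "real ?p - 1 = 1 + real m" using m by auto
        have "((\<lambda>r. r ^ Suc m) has_real_derivative (1 + real m) * r ^ m) (at r)"
          using DERIV_pow[of "Suc m" r UNIV] by simp
        from DERIV_mult[OF this dchi] show ?thesis
          unfolding has_real_derivative_iff_has_vector_derivative[symmetric] e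
          by (auto intro: has_field_derivative_at_within simp: mult_ac add_ac)
      qed
    qed simp
    moreover have "ch 3 = 0" "ch 1 = 0" by (auto simp: ch_def k_def)
    ultimately have "integral {1..3} (\<lambda>r. r ^ (?p - 1) * ch' r + (real ?p - 1) * (r ^ (?p - 2) * ch r)) = 0"
      by (simp add: has_integral_iff)
    hence "integral {1..3} (\<lambda>r. r ^ (?p - 1) * ch' r) + (real ?p - 1) * integral {1..3} (\<lambda>r. r ^ (?p - 2) * ch r) = 0"
      by (subst (asm) integral_add) (auto intro!: integrable_continuous_real continuous_intros cchi)
    thus ?thesis by algebra
  qed
  finally have "integral {1..3} (\<lambda>r. r ^ (?p - 2) * ch r) * (?J - (real ?p - 1) * ?I) = 0"
    by (simp add: algebra_simps)
  moreover have "integral {1..3} (\<lambda>r. r ^ (?p - 2) * ch r) \<noteq> 0"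
  proof
    assume "integral {1..3} (\<lambda>r. r ^ (?p - 2) * ch r) = 0"
    moreover have "continuous_on {1..3} (\<lambda>r. r ^ (?p - 2) * ch r)" by (intro continuous_intros cchi)
    ultimately have "\<forall>r\<in>{1..3}. r ^ (?p - 2) * ch r = 0"
      by (subst (asm) integral_eq_0_iff) (auto simp: ch_def)
    from bspec[OF this, of 2] show False by (simp add: ch_def k_def)
  qed
  ultimately show ?thesis by simp
qed

section \<open>Spherical means\<close>

text \<open>
  The norm of \<open>a e + t w\<close> for unit vectors \<open>e\<close> and \<open>w\<close> with \<open>w \<bullet> e = v\<close>.
\<close>
definition rad :: "real \<Rightarrow> real \<Rightarrow> real \<Rightarrow> real" where
  "rad a t v = sqrt (a\<^sup>2 + t\<^sup>2 + 2 * a * t * v)"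

lemma rad_commute: "rad a t v = rad t a v"
  by (simp add: rad_def algebra_simps)

lemma rad_arg_bounds:
  fixes a t v :: real
  assumes "a \<ge> 0" "t \<ge> 0" "v \<in> {-1..1}"
  shows "(a - t)\<^sup>2 \<le> a\<^sup>2 + t\<^sup>2 + 2 * a * t * v" "a\<^sup>2 + t\<^sup>2 + 2 * a * t * v \<le> (a + t)\<^sup>2"
proof -
  have "(a * t) * v \<le> (a * t) * 1" using assms by (intro mult_left_mono) auto
  moreover have "(a * t) * (-1) \<le> (a * t) * v" using assms by (intro mult_left_mono) auto
  ultimately show "(a - t)\<^sup>2 \<le> a\<^sup>2 + t\<^sup>2 + 2 * a * t * v" "a\<^sup>2 + t\<^sup>2 + 2 * a * t * v \<le> (a + t)\<^sup>2"
    by (simp_all add: power2_eq_square algebra_simps)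
qed

lemma rad_bounds:
  fixes a t v :: real
  assumes "a \<ge> 0" "t \<ge> 0" "v \<in> {-1..1}"
  shows "\<bar>a - t\<bar> \<le> rad a t v" "rad a t v \<le> a + t"
  using rad_arg_bounds[OF assms] assms
  by (auto simp: rad_def real_le_lsqrt intro!: real_le_rsqrt)

lemma rad_nonneg: "a \<ge> 0 \<Longrightarrow> t \<ge> 0 \<Longrightarrow> v \<in> {-1..1} \<Longrightarrow> rad a t v \<ge> 0"
  using rad_bounds(1)[of a t v] by linarith

lemma rad_pos: "a \<ge> 0 \<Longrightarrow> t \<ge> 0 \<Longrightarrow> t \<noteq> a \<Longrightarrow> v \<in> {-1..1} \<Longrightarrow> rad a t v > 0"
  using rad_bounds(1)[of a t v] by linarith

lemma rad_square:
  fixes a t v :: real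
  assumes "a \<ge> 0" "t \<ge> 0" "v \<in> {-1..1}"
  shows "(rad a t v)\<^sup>2 = a\<^sup>2 + t\<^sup>2 + 2 * a * t * v"
  unfolding rad_def using rad_arg_bounds(1)[OF assms]
  by (intro real_sqrt_pow2) (meson order_trans zero_le_power2)

text \<open>\<open>t + a * v\<close> is the component along the unit vector w of a e + t w, so this
  is the Cauchy-Schwarz inequality in coordinates.\<close>

lemma abs_radial_le_rad:
  fixes a t v :: real
  assumes "a \<ge> 0" "t \<ge> 0" "v \<in> {-1..1}"
  shows "\<bar>t + a * v\<bar> \<le> rad a t v"
proof -
  have "v\<^sup>2 \<le> 1" using assms by (simp add: abs_square_le_1 abs_le_iff)
  hence "a\<^sup>2 * v\<^sup>2 \<le> a\<^sup>2 * 1" by (intro mult_left_mono) auto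
  hence "(t + a * v)\<^sup>2 \<le> a\<^sup>2 + t\<^sup>2 + 2 * a * t * v"
    by (simp add: power2_eq_square algebra_simps)
  thus ?thesis unfolding rad_def by (intro real_le_rsqrt) simp
qed

lemma continuous_on_rad [continuous_intros]:
  "continuous_on A f \<Longrightarrow> continuous_on A g \<Longrightarrow> continuous_on A h \<Longrightarrow> continuous_on A (\<lambda>x. rad (f x) (g x) (h x))"
  unfolding rad_def by (intro continuous_intros)

lemma tendsto_rad [tendsto_intros]:
  "(f \<longlongrightarrow> a) F \<Longrightarrow> (g \<longlongrightarrow> b) F \<Longrightarrow> (h \<longlongrightarrow> c) F \<Longrightarrow> ((\<lambda>x. rad (f x) (g x) (h x)) \<longlongrightarrow> rad a b c) F"
  unfolding rad_def by (intro tendsto_intros)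

lemma measurable_rad [measurable]:
  assumes [measurable]: "f \<in> borel_measurable M" "g \<in> borel_measurable M" "h \<in> borel_measurable M"
  shows "(\<lambda>x. rad (f x) (g x) (h x)) \<in> borel_measurable M"
  unfolding rad_def by measurable

text \<open>\<open>t \<noteq> a\<close> keeps the radicand positive: a sphere of radius
  \<open>t\<close> about a point at distance \<open>a\<close> meets the origin only if the two
  coincide.\<close>

lemma has_real_derivative_rad:
  fixes a t v :: real
  assumes "a \<ge> 0" "t \<ge> 0" "t \<noteq> a" "v \<in> {-1..1}"
  shows "((\<lambda>t. rad a t v) has_real_derivative (t + a * v) / rad a t v) (at t)"
proof -
  have "a\<^sup>2 + t\<^sup>2 + 2 * a * t * v > 0"
    using rad_square[OF assms(1,2,4)] rad_pos[OF assms] by (metis zero_less_power)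
  thus ?thesis unfolding rad_def
    by (auto intro!: derivative_eq_intros simp: field_simps)
qed

lemma has_real_derivative_rad_cos:
  fixes a t v :: real
  assumes "a \<ge> 0" "t \<ge> 0" "t \<noteq> a" "v \<in> {-1..1}"
  shows "((\<lambda>v. rad a t v) has_real_derivative a * t / rad a t v) (at v)"
proof -
  have "a\<^sup>2 + t\<^sup>2 + 2 * a * t * v > 0"
    using rad_square[OF assms(1,2,4)] rad_pos[OF assms] by (metis zero_less_power)
  thus ?thesis unfolding rad_def
    by (auto intro!: derivative_eq_intros simp: field_simps)
qed

lemma has_real_derivative_inverse_power:
  fixes r :: real
  assumes "r > 0"
  shows "((\<lambda>r. inverse (r ^ k)) has_real_derivative - real k * inverse (r ^ (k + 1))) (at r)"
proof (cases k)
  case (Suc j)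
  have "((\<lambda>r::real. r ^ Suc j) has_real_derivative real (Suc j) * r ^ j) (at r)"
    using DERIV_pow[of "Suc j" r UNIV] by simp
  from DERIV_inverse'[OF this] have "((\<lambda>r. inverse (r ^ Suc j)) has_real_derivative
      - (inverse (r ^ Suc j) * (real (Suc j) * r ^ j) * inverse (r ^ Suc j))) (at r)"
    using assms by simp
  also have "- (inverse (r ^ Suc j) * (real (Suc j) * r ^ j) * inverse (r ^ Suc j)) = - real k * inverse (r ^ (k + 1))"
    unfolding Suc using assms by (simp add: field_simps)
  finally show ?thesis unfolding Suc .
qed simp

text \<open>
  \<open>P\<close> and \<open>u\<close> play the roles of the uniform law on the unit sphere of \<open>\<real>\<^sup>p\<close> and of a coordinate.
\<close>
locale sphere_coord = prob_space P for P :: "'z measure" +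
  fixes u :: "'z \<Rightarrow> real" and p :: nat
  assumes u_meas [measurable]: "u \<in> borel_measurable P"
    and u_range: "u z \<in> {-1..1}"
    and p_ge: "p \<ge> 4"
    and u_ne: "AE z in P. u z \<noteq> -1"
    and ibp: "(\<And>v. v \<in> {-1..1} \<Longrightarrow> (g has_real_derivative g' v) (at v within {-1..1})) \<Longrightarrow>
        continuous_on {-1..1} g' \<Longrightarrow>
        expectation (\<lambda>z. (1 - (u z)\<^sup>2) * g' (u z)) = (real p - 1) * expectation (\<lambda>z. u z * g (u z))"
begin

lemma measurable_cont:
  assumes "continuous_on {-1..1} g"
  shows "(\<lambda>z. g (u z) :: real) \<in> borel_measurable P"
proof -
  have "continuous_on UNIV (\<lambda>v. g (max (-1) (min 1 v)))"
    by (rule continuous_on_compose2[OF assms]) (auto intro!: continuous_intros)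
  hence [measurable]: "(\<lambda>v. g (max (-1) (min 1 v))) \<in> borel_measurable borel"
    by (rule borel_measurable_continuous_onI)
  have "(\<lambda>z. g (max (-1) (min 1 (u z)))) \<in> borel_measurable P" by measurable
  moreover have "max (-1) (min 1 (u z)) = u z" for z using u_range[of z] by auto
  ultimately show ?thesis by simp
qed

lemma integrable_cont:
  assumes "continuous_on {-1..1} g"
  shows "integrable P (\<lambda>z. g (u z) :: real)"
proof -
  have "bounded (g ` {-1..1})"
    using assms by (intro compact_imp_bounded compact_continuous_image) auto
  then obtain C where "\<forall>v\<in>{-1..1}. \<bar>g v\<bar> \<le> C" unfolding bounded_iff by auto
  thus ?thesis using u_range measurable_cont[OF assms]
    by (intro integrable_const_bound[of _ C] AE_I2) auto
qed

lemma expectation_tendsto: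
  fixes K :: "real \<Rightarrow> 'z \<Rightarrow> real"
  assumes m: "\<And>t. t \<in> S \<Longrightarrow> K t \<in> borel_measurable P" and m0: "K0 \<in> borel_measurable P"
    and b: "\<And>t z. t \<in> S \<Longrightarrow> \<bar>K t z\<bar> \<le> C"
    and lim: "AE z in P. ((\<lambda>t. K t z) \<longlongrightarrow> K0 z) (at t0 within S)"
  shows "((\<lambda>t. expectation (K t)) \<longlongrightarrow> expectation K0) (at t0 within S)"
  unfolding tendsto_at_iff_sequentially o_def
proof (intro allI impI)
  fix X :: "nat \<Rightarrow> real" assume X: "\<forall>i. X i \<in> S - {t0}" "X \<longlonglongrightarrow> t0"
  show "(\<lambda>i. expectation (K (X i))) \<longlonglongrightarrow> expectation K0"
  proof (rule integral_dominated_convergence[where w="\<lambda>_. C"])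
    show "AE z in P. (\<lambda>i. K (X i) z) \<longlonglongrightarrow> K0 z"
      using lim by eventually_elim (use X in \<open>auto simp: tendsto_at_iff_sequentially o_def\<close>)
    show "AE z in P. norm (K (X i) z) \<le> C" for i using X b by (intro AE_I2) auto
    show "K (X i) \<in> borel_measurable P" for i using X m by auto
  qed (use m0 in auto)
qed

text \<open>Differentiation under the expectation; the quotients are dominated because
  \<open>K'\<close> is bounded on a compact rectangle.\<close>

lemma has_real_derivative_expectation:
  fixes K K' :: "real \<Rightarrow> real \<Rightarrow> real"
  assumes t0: "l < t0" "t0 < h"
    and d: "\<And>t v. t \<in> {l<..<h} \<Longrightarrow> v \<in> {-1..1} \<Longrightarrow> ((\<lambda>t. K t v) has_real_derivative K' t v) (at t)"
    and c: "\<And>t. t \<in> {l<..<h} \<Longrightarrow> continuous_on {-1..1} (K t)"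
    and c': "continuous_on ({l..h} \<times> {-1..1}) (\<lambda>x. K' (fst x) (snd x))"
  shows "((\<lambda>t. expectation (\<lambda>z. K t (u z))) has_real_derivative expectation (\<lambda>z. K' t0 (u z))) (at t0)"
proof -
  have "bounded ((\<lambda>x. K' (fst x) (snd x)) ` ({l..h} \<times> {-1..1}))"
    by (intro compact_imp_bounded compact_continuous_image c' compact_Times) auto
  then obtain C where C: "\<And>t v. t \<in> {l..h} \<Longrightarrow> v \<in> {-1..1} \<Longrightarrow> \<bar>K' t v\<bar> \<le> C"
    unfolding bounded_iff by fastforce
  have c0: "continuous_on {-1..1} (K' t0)"
  proof -
    have "continuous_on {-1..1} (Pair t0 :: real \<Rightarrow> _)" by (intro continuous_intros)
    moreover have "Pair t0 ` {-1..1} \<subseteq> {l..h} \<times> {-1..1::real}" using t0 by auto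
    ultimately show ?thesis using continuous_on_compose2[OF c', of "{-1..1}" "\<lambda>v. (t0, v)"] by simp
  qed
  have lim: "((\<lambda>t. expectation (\<lambda>z. (K t (u z) - K t0 (u z)) / (t - t0))) \<longlongrightarrow> expectation (\<lambda>z. K' t0 (u z))) (at t0 within {l<..<h})"
  proof (rule expectation_tendsto[where C=C])
    fix t z assume t: "t \<in> {l<..<h}"
    have [measurable]: "(\<lambda>z. K t (u z)) \<in> borel_measurable P" "(\<lambda>z. K t0 (u z)) \<in> borel_measurable P"
      using measurable_cont[OF c[OF t]] measurable_cont[OF c[of t0]] t0 by auto
    show "(\<lambda>z. (K t (u z) - K t0 (u z)) / (t - t0)) \<in> borel_measurable P" by measurable
    show "\<bar>(K t (u z) - K t0 (u z)) / (t - t0)\<bar> \<le> C"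
    proof (cases "t = t0")
      case True
      thus ?thesis using C[of t0 "u z"] t0 u_range[of z] by auto
    next
      case False
      have "norm (K t (u z) - K t0 (u z)) \<le> C * norm (t - t0)"
      proof (rule field_differentiable_bound[where S="{l<..<h}" and f'="\<lambda>t. K' t (u z)"])
        fix s assume "s \<in> {l<..<h}"
        thus "((\<lambda>t. K t (u z)) has_real_derivative K' s (u z)) (at s within {l<..<h})"
          using d u_range by (blast intro: has_field_derivative_at_within)
      qed (use t t0 C u_range in auto)
      thus ?thesis using False by (simp add: field_simps abs_divide)
    qed
  next
    show "(\<lambda>z. K' t0 (u z)) \<in> borel_measurable P" by (rule measurable_cont[OF c0])
    show "AE z in P. ((\<lambda>t. (K t (u z) - K t0 (u z)) / (t - t0)) \<longlongrightarrow> K' t0 (u z)) (at t0 within {l<..<h})"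
    proof (rule AE_I2)
      fix z
      have "((\<lambda>t. K t (u z)) has_real_derivative K' t0 (u z)) (at t0 within {l<..<h})"
        using d[of t0 "u z"] u_range t0 by (auto intro: has_field_derivative_at_within)
      thus "((\<lambda>t. (K t (u z) - K t0 (u z)) / (t - t0)) \<longlongrightarrow> K' t0 (u z)) (at t0 within {l<..<h})"
        by (simp add: has_field_derivative_iff)
    qed
  qed
  have "expectation (\<lambda>z. (K t (u z) - K t0 (u z)) / (t - t0)) =
     (expectation (\<lambda>z. K t (u z)) - expectation (\<lambda>z. K t0 (u z))) / (t - t0)" if "t \<in> {l<..<h}" for t
    using integrable_cont[OF c[OF that]] integrable_cont[OF c[of t0]] t0 by simp
  hence "\<forall>\<^sub>F t in at t0 within {l<..<h}. expectation (\<lambda>z. (K t (u z) - K t0 (u z)) / (t - t0)) =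
     (expectation (\<lambda>z. K t (u z)) - expectation (\<lambda>z. K t0 (u z))) / (t - t0)"
    unfolding eventually_at_filter by (intro always_eventually allI impI)
  note Lim_transform_eventually[OF lim this]
  thus ?thesis using t0 by (simp add: has_field_derivative_iff at_within_open[of _ "{l<..<h}"])
qed

text \<open>The divergence theorem for the field M(|x|) x. Up to the area of the unit sphere, the
  left side is its flux through the sphere of radius t about a e, since x = a e + t w has normal
  component \<open>t + a * u\<close>. The derivative of the flux is the spherical mean of the
  divergence p M + r M'.\<close>

lemma flux_deriv:
  assumes a: "a \<ge> 0" and t: "t > 0" "t \<noteq> a"
    and dM: "\<And>r. r > 0 \<Longrightarrow> (M has_real_derivative M' r) (at r)"
    and cM': "continuous_on {0<..} M'"
  shows "((\<lambda>t. t ^ (p - 1) * expectation (\<lambda>z. M (rad a t (u z)) * (t + a * u z))) has_real_derivative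
     t ^ (p - 1) * expectation (\<lambda>z. real p * M (rad a t (u z)) + rad a t (u z) * M' (rad a t (u z)))) (at t)"
proof -
  define m where "m = p - 2"
  have m: "p = m + 2" using p_ge by (simp add: m_def)
  define d where "d = min t \<bar>t - a\<bar> / 2"
  have d: "d > 0" "d < t" "d < \<bar>t - a\<bar>" using t by (auto simp: d_def min_def)
  have S: "s > 0" "s \<noteq> a" if "s \<in> {t - d..t + d}" for s using that d by auto
  have cM: "continuous_on {0<..} M" using dM by (intro DERIV_continuous_on) (auto intro: has_field_derivative_at_within)
  have rp: "rad a s v > 0" if "s \<in> {t - d..t + d}" "v \<in> {-1..1}" for s v
    using rad_pos[of a s v] S[OF that(1)] a that by auto
  have ct: "t \<in> {t - d..t + d}" using d by auto
  define K where "K = (\<lambda>s v. M (rad a s v) * (s + a * v))"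
  define K' where "K' = (\<lambda>s v. M' (rad a s v) * ((s + a * v) / rad a s v) * (s + a * v) + M (rad a s v))"
  have DE: "((\<lambda>s. expectation (\<lambda>z. K s (u z))) has_real_derivative expectation (\<lambda>z. K' t (u z))) (at t)"
  proof (rule has_real_derivative_expectation[where l="t - d" and h="t + d"])
    fix s v :: real assume s: "s \<in> {t - d<..<t + d}" and v: "v \<in> {-1..1}"
    have s': "s \<in> {t - d..t + d}" using s by auto
    have "((\<lambda>s. M (rad a s v)) has_real_derivative M' (rad a s v) * ((s + a * v) / rad a s v)) (at s)"
      using DERIV_chain2[OF dM[OF rp[OF s' v]] has_real_derivative_rad[of a s v]] a S[OF s'] v by auto
    thus "((\<lambda>s. K s v) has_real_derivative K' s v) (at s)"
      unfolding K_def K'_def by (auto intro!: derivative_eq_intros)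
  next
    fix s assume s: "s \<in> {t - d<..<t + d}"
    hence s': "s \<in> {t - d..t + d}" by auto
    show "continuous_on {-1..1} (K s)" unfolding K_def
      using rp[OF s'] by (auto intro!: continuous_intros continuous_on_compose2[OF cM])
  next
    show "continuous_on ({t - d..t + d} \<times> {-1..1}) (\<lambda>x. K' (fst x) (snd x))" unfolding K'_def
      using rp by (auto intro!: continuous_intros continuous_on_compose2[OF cM] continuous_on_compose2[OF cM'] simp: less_imp_neq[THEN not_sym])
  qed (use d in auto)
  define g where "g = (\<lambda>v. M (rad a t v))"
  define g' where "g' = (\<lambda>v. M' (rad a t v) * (a * t / rad a t v))"
  have rp': "rad a t v > 0" if "v \<in> {-1..1}" for v using rp[OF ct that] .
  have cg': "continuous_on {-1..1} g'" unfolding g'_def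
    using rp' by (auto intro!: continuous_intros continuous_on_compose2[OF cM'] simp: less_imp_neq[THEN not_sym])
  have cg: "continuous_on {-1..1} g" unfolding g_def
    using rp' by (auto intro!: continuous_intros continuous_on_compose2[OF cM] simp: less_imp_neq[THEN not_sym])
  have ib: "expectation (\<lambda>z. (1 - (u z)\<^sup>2) * g' (u z)) = (real p - 1) * expectation (\<lambda>z. u z * g (u z))"
  proof (rule ibp)
    fix v :: real assume v: "v \<in> {-1..1}"
    show "(g has_real_derivative g' v) (at v within {-1..1})"
      unfolding g_def g'_def
      using DERIV_chain2[OF dM[OF rp'[OF v]] has_real_derivative_rad_cos[of a t v]] a t v
      by (auto intro: has_field_derivative_at_within)
  qed (rule cg')
  define q where "q = (\<lambda>v. real p * M (rad a t v) + rad a t v * M' (rad a t v))"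
  have cq: "continuous_on {-1..1} q" unfolding q_def
    using rp' by (auto intro!: continuous_intros continuous_on_compose2[OF cM] continuous_on_compose2[OF cM'] simp: less_imp_neq[THEN not_sym])
  have cK: "continuous_on {-1..1} (K t)" unfolding K_def
    using rp' by (auto intro!: continuous_intros continuous_on_compose2[OF cM])
  have cK': "continuous_on {-1..1} (K' t)" unfolding K'_def
    using rp' by (auto intro!: continuous_intros continuous_on_compose2[OF cM] continuous_on_compose2[OF cM'] simp: less_imp_neq[THEN not_sym])
  \<comment> \<open>By r^2 - (t + a v)^2 = a^2 (1 - v^2), the normal derivative differs from the
    full divergence exactly by the tangential integrand of \<open>ib\<close>, whose mean is
    0.\<close>
  have pw: "(real p - 1) * K t v + t * K' t v = t * q v + a * ((real p - 1) * (v * g v) - (1 - v\<^sup>2) * g' v)"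
    if v: "v \<in> {-1..1}" for v
  proof -
    let ?r = "rad a t v"
    have r: "?r > 0" by (rule rp'[OF v])
    have r2: "(t + a * v)\<^sup>2 = ?r\<^sup>2 - a\<^sup>2 * (1 - v\<^sup>2)"
      using rad_square[of a t v] a t v by (simp add: power2_eq_square algebra_simps)
    have "(t + a * v) / ?r * (t + a * v) = (t + a * v)\<^sup>2 / ?r" by (simp add: power2_eq_square)
    also have "\<dots> = ?r - a\<^sup>2 * (1 - v\<^sup>2) / ?r" unfolding r2 using r by (simp add: field_simps power2_eq_square)
    finally have e: "(t + a * v) / ?r * (t + a * v) = ?r - a\<^sup>2 * (1 - v\<^sup>2) / ?r" .
    have K': "K' t v = M' ?r * (?r - a\<^sup>2 * (1 - v\<^sup>2) / ?r) + M ?r"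
      unfolding K'_def using e by (simp only: mult.assoc)
    show ?thesis unfolding K' unfolding K_def q_def g_def g'_def m using r
      by (simp add: field_simps power2_eq_square)
  qed
  have "(real p - 1) * expectation (\<lambda>z. K t (u z)) + t * expectation (\<lambda>z. K' t (u z))
     = expectation (\<lambda>z. (real p - 1) * K t (u z) + t * K' t (u z))"
    using integrable_cont[OF cK] integrable_cont[OF cK'] by simp
  also have "\<dots> = expectation (\<lambda>z. t * q (u z) + a * ((real p - 1) * (u z * g (u z)) - (1 - (u z)\<^sup>2) * g' (u z)))"
    by (simp only: pw[OF u_range])
  also have "\<dots> = t * expectation (\<lambda>z. q (u z)) + a * ((real p - 1) * expectation (\<lambda>z. u z * g (u z)) - expectation (\<lambda>z. (1 - (u z)\<^sup>2) * g' (u z)))"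
  proof -
    have "integrable P (\<lambda>z. u z * g (u z))" "integrable P (\<lambda>z. (1 - (u z)\<^sup>2) * g' (u z))"
      by (rule integrable_cont[of "\<lambda>v. v * g v"] integrable_cont[of "\<lambda>v. (1 - v\<^sup>2) * g' v"], intro continuous_intros cg cg')+
    thus ?thesis using integrable_cont[OF cq] by simp
  qed
  also have "\<dots> = t * expectation (\<lambda>z. q (u z))" using ib by simp
  finally have E: "(real p - 1) * expectation (\<lambda>z. K t (u z)) + t * expectation (\<lambda>z. K' t (u z)) = t * expectation (\<lambda>z. q (u z))" .
  have "((\<lambda>s. s ^ (p - 1) * expectation (\<lambda>z. K s (u z))) has_real_derivative
      t ^ (p - 1) * expectation (\<lambda>z. K' t (u z)) + real (p - 1) * t ^ (p - 1 - 1) * expectation (\<lambda>z. K t (u z))) (at t)"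
    by (auto intro!: derivative_eq_intros DE)
  also have "t ^ (p - 1) * expectation (\<lambda>z. K' t (u z)) + real (p - 1) * t ^ (p - 1 - 1) * expectation (\<lambda>z. K t (u z))
    = t ^ m * ((real p - 1) * expectation (\<lambda>z. K t (u z)) + t * expectation (\<lambda>z. K' t (u z)))"
    unfolding m by (simp add: algebra_simps)
  also have "\<dots> = t ^ m * (t * expectation (\<lambda>z. q (u z)))" by (simp only: E)
  also have "\<dots> = t ^ (p - 1) * expectation (\<lambda>z. q (u z))" using m by simp
  finally show ?thesis unfolding K_def q_def .
qed

text \<open>The field x / |x|^p is divergence-free off the origin, and a ball of radius t < a about
  a point at distance a does not contain the origin. The flux is therefore constant in t and tends
  to 0 as the ball shrinks.\<close>

lemma flux_zero:
  assumes t: "0 < t" "t < a"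
  shows "expectation (\<lambda>z. inverse (rad a t (u z) ^ p) * (t + a * u z)) = 0"
proof -
  define J where "J = (\<lambda>t. t ^ (p - 1) * expectation (\<lambda>z. inverse (rad a t (u z) ^ p) * (t + a * u z)))"
  have dJ: "(J has_real_derivative 0) (at s)" if s: "0 < s" "s < a" for s
  proof -
    have "(J has_real_derivative s ^ (p - 1) * expectation (\<lambda>z. real p * inverse (rad a s (u z) ^ p) + rad a s (u z) * (- real p * inverse (rad a s (u z) ^ (p + 1))))) (at s)"
      unfolding J_def
    proof (rule flux_deriv)
      fix r :: real assume r: "r > 0"
      show "((\<lambda>r. inverse (r ^ p)) has_real_derivative - real p * inverse (r ^ (p + 1))) (at r)"
        by (rule has_real_derivative_inverse_power[OF r])
    qed (use s in \<open>auto intro!: continuous_intros\<close>)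
    moreover have "(\<lambda>z. real p * inverse (rad a s (u z) ^ p) + rad a s (u z) * (- real p * inverse (rad a s (u z) ^ (p + 1)))) = (\<lambda>z. 0)"
    proof
      fix z
      show "real p * inverse (rad a s (u z) ^ p) + rad a s (u z) * (- real p * inverse (rad a s (u z) ^ (p + 1))) = 0"
        using rad_pos[of a s "u z"] s u_range[of z] by (simp add: field_simps)
    qed
    ultimately show ?thesis by (simp only: integral_zero mult_zero_right)
  qed
  have const: "J s = J t" if "0 < s" "s < a" for s
    using DERIV_isconst3[of 0 a s t J] dJ that t by auto
  \<comment> \<open>On the sphere the field stays bounded as s tends to 0, so the flux is of order
    \<open>s ^ (p - 1)\<close>.\<close>
  have bound: "\<bar>J s\<bar> \<le> s ^ (p - 1) * (inverse ((a - s) ^ p) * (a + s))" if s: "0 < s" "s < a" for s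
  proof -
    have "\<bar>inverse (rad a s (u z) ^ p) * (s + a * u z)\<bar> \<le> inverse ((a - s) ^ p) * (a + s)" for z
    proof -
      have b: "a - s \<le> rad a s (u z)" "\<bar>s + a * u z\<bar> \<le> a + s"
        using rad_bounds[of a s "u z"] abs_radial_le_rad[of a s "u z"] s u_range[of z] by auto
      have "inverse (rad a s (u z) ^ p) \<le> inverse ((a - s) ^ p)"
        using b s by (intro le_imp_inverse_le power_mono zero_less_power) auto
      moreover have "inverse (rad a s (u z) ^ p) \<ge> 0" using b s by (simp add: order_trans[OF _ b(1)])
      ultimately show ?thesis unfolding abs_mult using b s by (intro mult_mono) auto
    qed
    hence "\<bar>expectation (\<lambda>z. inverse (rad a s (u z) ^ p) * (s + a * u z))\<bar> \<le> inverse ((a - s) ^ p) * (a + s)"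
      using s by (intro order_trans[OF integral_norm_bound[THEN order_trans[OF eq_refl[OF real_norm_def[symmetric]]]] integral_le_const]) (auto intro!: integrable_abs integrable_const_bound[of _ "inverse ((a - s) ^ p) * (a + s)"])
    thus ?thesis unfolding J_def abs_mult using s by (simp add: mult_left_mono)
  qed
  have "((\<lambda>s. s ^ (p - 1) * (inverse ((a - s) ^ p) * (a + s))) \<longlongrightarrow> 0 ^ (p - 1) * (inverse ((a - 0) ^ p) * (a + 0))) (at_right 0)"
    using t by (intro tendsto_intros) auto
  hence lim: "((\<lambda>s. s ^ (p - 1) * (inverse ((a - s) ^ p) * (a + s))) \<longlongrightarrow> 0) (at_right 0)"
    using p_ge by (simp add: zero_power)
  have "\<forall>\<^sub>F s in at_right 0. s \<in> {0<..<a}"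
    by (rule eventually_at_right_real) (use t in auto)
  hence "\<forall>\<^sub>F s in at_right 0. \<bar>J t\<bar> \<le> s ^ (p - 1) * (inverse ((a - s) ^ p) * (a + s))"
    by eventually_elim (use const bound in force)
  hence "\<bar>J t\<bar> \<le> 0" using lim by (intro tendsto_lowerbound[OF lim]) auto
  thus ?thesis using t by (simp add: J_def)
qed

section \<open>Newton's theorem: spherical means of the harmonic kernel and its first moment\<close>

lemma has_real_derivative_mean:
  assumes t: "0 < t" "t \<noteq> a" "a \<ge> 0"
    and dM: "\<And>r. r > 0 \<Longrightarrow> (M has_real_derivative M' r) (at r)"
    and cM': "continuous_on {0<..} M'"
  shows "((\<lambda>t. expectation (\<lambda>z. M (rad a t (u z)))) has_real_derivative
     expectation (\<lambda>z. M' (rad a t (u z)) * ((t + a * u z) / rad a t (u z)))) (at t)"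
proof -
  define d where "d = min t \<bar>t - a\<bar> / 2"
  have d: "d > 0" "d < t" "d < \<bar>t - a\<bar>" using t by (auto simp: d_def min_def)
  have S: "s > 0" "s \<noteq> a" if "s \<in> {t - d..t + d}" for s using that d by auto
  have cM: "continuous_on {0<..} M" using dM by (intro DERIV_continuous_on) (auto intro: has_field_derivative_at_within)
  have rp: "rad a s v > 0" if "s \<in> {t - d..t + d}" "v \<in> {-1..1}" for s v
    using rad_pos[of a s v] S[OF that(1)] t that by auto
  show ?thesis
  proof (rule has_real_derivative_expectation[where l="t - d" and h="t + d" and K="\<lambda>t v. M (rad a t v)" and K'="\<lambda>t v. M' (rad a t v) * ((t + a * v) / rad a t v)"])
    fix s v :: real assume s: "s \<in> {t - d<..<t + d}" and v: "v \<in> {-1..1}"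
    have s': "s \<in> {t - d..t + d}" using s by auto
    show "((\<lambda>s. M (rad a s v)) has_real_derivative M' (rad a s v) * ((s + a * v) / rad a s v)) (at s)"
      using DERIV_chain2[OF dM[OF rp[OF s' v]] has_real_derivative_rad[of a s v]] t S[OF s'] v by auto
  next
    fix s assume s: "s \<in> {t - d<..<t + d}"
    hence s': "s \<in> {t - d..t + d}" by auto
    show "continuous_on {-1..1} (\<lambda>v. M (rad a s v))"
      using rp[OF s'] by (auto intro!: continuous_intros continuous_on_compose2[OF cM])
  next
    show "continuous_on ({t - d..t + d} \<times> {-1..1}) (\<lambda>x. M' (rad a (fst x) (snd x)) * ((fst x + a * snd x) / rad a (fst x) (snd x)))"
      using rp by (auto intro!: continuous_intros continuous_on_compose2[OF cM'] simp: less_imp_neq[THEN not_sym])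
  qed (use d in auto)
qed

text \<open>Mean value property of the harmonic function |x|^(2-p): the derivative in the radius is
  a multiple of the vanishing flux, and letting the sphere shrink identifies the constant as the
  value at the centre.\<close>

lemma newton_inside:
  assumes t: "0 < t" "t < a"
  shows "expectation (\<lambda>z. inverse (rad a t (u z) ^ (p - 2))) = inverse (a ^ (p - 2))"
proof -
  define N where "N = (\<lambda>t. expectation (\<lambda>z. inverse (rad a t (u z) ^ (p - 2))))"
  have dN: "(N has_real_derivative 0) (at s)" if s: "0 < s" "s < a" for s
  proof -
    have "(N has_real_derivative expectation (\<lambda>z. - real (p - 2) * inverse (rad a s (u z) ^ (p - 1)) * ((s + a * u z) / rad a s (u z)))) (at s)"
      unfolding N_def
    proof (rule has_real_derivative_mean)
      fix r :: real assume r: "r > 0"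
      show "((\<lambda>r. inverse (r ^ (p - 2))) has_real_derivative - real (p - 2) * inverse (r ^ (p - 1))) (at r)"
      proof -
        have e: "p - 2 + 1 = p - 1" using p_ge by simp
        show ?thesis by (rule has_real_derivative_inverse_power[OF r, of "p - 2", unfolded e])
      qed
    qed (use s in \<open>auto intro!: continuous_intros\<close>)
    also have "expectation (\<lambda>z. - real (p - 2) * inverse (rad a s (u z) ^ (p - 1)) * ((s + a * u z) / rad a s (u z)))
      = expectation (\<lambda>z. - real (p - 2) * (inverse (rad a s (u z) ^ p) * (s + a * u z)))"
    proof (intro Bochner_Integration.integral_cong refl)
      fix z
      have "rad a s (u z) > 0" using rad_pos[of a s "u z"] s u_range[of z] by simp
      moreover have "rad a s (u z) ^ p = rad a s (u z) ^ (p - 1) * rad a s (u z)"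
        using p_ge by (metis One_nat_def Suc_pred' less_le_trans power_Suc2 zero_less_numeral)
      ultimately show "- real (p - 2) * inverse (rad a s (u z) ^ (p - 1)) * ((s + a * u z) / rad a s (u z)) = - real (p - 2) * (inverse (rad a s (u z) ^ p) * (s + a * u z))"
        by (simp add: field_simps)
    qed
    also have "\<dots> = 0" using flux_zero[of s a] s by simp
    finally show ?thesis .
  qed
  have const: "N s = N t" if "0 < s" "s < a" for s
    using DERIV_isconst3[of 0 a s t N] dN that t by auto
  have bound: "inverse ((a + s) ^ (p - 2)) \<le> N s \<and> N s \<le> inverse ((a - s) ^ (p - 2))" if s: "0 < s" "s < a" for s
  proof -
    have "continuous_on {-1..1} (\<lambda>v. inverse (rad a s v ^ (p - 2)))"
      using rad_pos[of a s] s by (auto intro!: continuous_intros simp: less_imp_neq[THEN not_sym])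
    from integrable_cont[OF this] have i: "integrable P (\<lambda>z. inverse (rad a s (u z) ^ (p - 2)))" .
    have b: "a - s \<le> rad a s (u z)" "rad a s (u z) \<le> a + s" for z
      using rad_bounds[of a s "u z"] s u_range[of z] by auto
    have b0: "rad a s (u z) > 0" for z using b(1)[of z] s by linarith
    show ?thesis unfolding N_def using s b b0
      by (intro conjI integral_ge_const integral_le_const i AE_I2 le_imp_inverse_le power_mono zero_less_power) (auto intro: less_imp_le)
  qed
  have lim1: "((\<lambda>s. inverse ((a + s) ^ (p - 2))) \<longlongrightarrow> inverse ((a + 0) ^ (p - 2))) (at_right 0)"
   and lim2: "((\<lambda>s. inverse ((a - s) ^ (p - 2))) \<longlongrightarrow> inverse ((a - 0) ^ (p - 2))) (at_right 0)"
    using t by (intro tendsto_intros; simp)+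
  have "\<forall>\<^sub>F s in at_right 0. s \<in> {0<..<a}"
    by (rule eventually_at_right_real) (use t in auto)
  hence ev: "\<forall>\<^sub>F s in at_right 0. inverse ((a + s) ^ (p - 2)) \<le> N t" "\<forall>\<^sub>F s in at_right 0. N t \<le> inverse ((a - s) ^ (p - 2))"
    by (eventually_elim, use const bound in force)+
  have "inverse ((a + 0) ^ (p - 2)) \<le> N t" by (rule tendsto_upperbound[OF lim1 ev(1)]) simp
  moreover have "N t \<le> inverse ((a - 0) ^ (p - 2))" by (rule tendsto_lowerbound[OF lim2 ev(2)]) simp
  ultimately show ?thesis by (simp add: N_def)
qed

text \<open>\<open>rad\<close> is symmetric in its first two arguments, so a sphere enclosing the
  origin is the inside case with \<open>a\<close> and \<open>t\<close> interchanged.\<close>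

lemma newton:
  assumes "0 < t" "0 < a" "t \<noteq> a"
  shows "expectation (\<lambda>z. inverse (rad a t (u z) ^ (p - 2))) = inverse (max a t ^ (p - 2))"
  using newton_inside[of t a] newton_inside[of a t] assms
  by (cases t a rule: linorder_cases) (auto simp: rad_commute max_def)

text \<open>The degree-one coefficient of the Newton kernel on the sphere. Integration by parts
  produces the mean of (1 - u^2) / r^p, which an algebraic identity reduces to
  \<open>newton_inside\<close>, the unknown mean and the vanishing flux; this leaves a linear
  equation for the unknown.\<close>

lemma newton_first_inside:
  assumes t: "0 < t" "t < a"
  shows "expectation (\<lambda>z. u z * inverse (rad a t (u z) ^ (p - 2))) = - (real p - 2) / real p * (t / a ^ (p - 1))"
proof -
  define m where "m = p - 4"
  have m: "p = m + 4" using p_ge by (simp add: m_def)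
  define G where "G = inverse (a ^ (p - 2))"
  define g where "g = (\<lambda>v. inverse (rad a t v ^ (p - 2)))"
  define g' where "g' = (\<lambda>v. - (real p - 2) * (a * t) * inverse (rad a t v ^ p))"
  define y where "y = expectation (\<lambda>z. u z * g (u z))"
  have rp: "rad a t v > 0" if "v \<in> {-1..1}" for v using rad_pos[of a t v] t that by simp
  have ci: "continuous_on {-1..1} (\<lambda>v. inverse (rad a t v ^ k))" for k
    using rp by (auto intro!: continuous_intros simp: less_imp_neq[THEN not_sym])
  have "expectation (\<lambda>z. (1 - (u z)\<^sup>2) * g' (u z)) = (real p - 1) * y"
    unfolding y_def
  proof (rule ibp)
    show "continuous_on {-1..1} g'" unfolding g'_def by (intro continuous_intros ci)
    fix v :: real assume v: "v \<in> {-1..1}"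
    have "((\<lambda>v. inverse (rad a t v ^ (p - 2))) has_real_derivative
       - real (p - 2) * inverse (rad a t v ^ (p - 1)) * (a * t / rad a t v)) (at v)"
    proof (rule DERIV_chain2[of "\<lambda>r. inverse (r ^ (p - 2))"])
      show "((\<lambda>r. inverse (r ^ (p - 2))) has_real_derivative - real (p - 2) * inverse (rad a t v ^ (p - 1))) (at (rad a t v))"
        using has_real_derivative_inverse_power[OF rp[OF v], of "p - 2"] unfolding m by (simp add: numeral_eq_Suc)
    qed (use has_real_derivative_rad_cos[of a t v] t v in auto)
    also have "- real (p - 2) * inverse (rad a t v ^ (p - 1)) * (a * t / rad a t v) = g' v"
      unfolding g'_def m using rp[OF v] by (simp add: field_simps numeral_eq_Suc)
    finally show "(g has_real_derivative g' v) (at v within {-1..1})"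
      unfolding g_def by (rule has_field_derivative_at_within)
  qed
  also have "expectation (\<lambda>z. (1 - (u z)\<^sup>2) * g' (u z)) =
     - (real p - 2) * (t / a) * expectation (\<lambda>z. a\<^sup>2 * ((1 - (u z)\<^sup>2) * inverse (rad a t (u z) ^ p)))"
  proof -
    have "w * (- (real p - 2) * (a * t) * X) = - (real p - 2) * (t / a) * (a\<^sup>2 * (w * X))" for w X :: real
      using t by (simp add: power2_eq_square)
    thus ?thesis unfolding g'_def by (simp only: integral_mult_right_zero)
  qed
  also have "expectation (\<lambda>z. a\<^sup>2 * ((1 - (u z)\<^sup>2) * inverse (rad a t (u z) ^ p))) =
    expectation (\<lambda>z. g (u z) / 2 - a / (2 * t) * (u z * g (u z)) - (t\<^sup>2 - a\<^sup>2) / (2 * t) * (inverse (rad a t (u z) ^ p) * (t + a * u z)))"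
  proof (intro Bochner_Integration.integral_cong refl)
    fix z
    let ?v = "u z" and ?r = "rad a t (u z)"
    have r: "?r > 0" using rp u_range by blast
    have r2: "?r\<^sup>2 = a\<^sup>2 + t\<^sup>2 + 2 * a * t * ?v" using rad_square[of a t ?v] t u_range by auto
    have ipg: "g ?v = inverse (?r ^ p) * ?r\<^sup>2"
      unfolding g_def m using r by (simp add: field_simps power_add flip: power_Suc power2_eq_square) (simp add: numeral_eq_Suc)
    \<comment> \<open>Chosen so that, after division by r^p, each term on the right is a mean
      already known, the unknown \<open>y\<close>, or the integrand of
      \<open>flux_zero\<close>.\<close>
    have "a\<^sup>2 * (1 - ?v\<^sup>2) = ?r\<^sup>2 / 2 - a / (2 * t) * (?v * ?r\<^sup>2) - (t\<^sup>2 - a\<^sup>2) / (2 * t) * (t + a * ?v)"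
      unfolding r2 using t by (simp add: field_simps power2_eq_square)
    hence e: "a\<^sup>2 * ((1 - ?v\<^sup>2) * inverse (?r ^ p)) = (?r\<^sup>2 / 2 - a / (2 * t) * (?v * ?r\<^sup>2) - (t\<^sup>2 - a\<^sup>2) / (2 * t) * (t + a * ?v)) * inverse (?r ^ p)"
      by (metis mult.assoc)
    show "a\<^sup>2 * ((1 - ?v\<^sup>2) * inverse (?r ^ p)) = g ?v / 2 - a / (2 * t) * (?v * g ?v) - (t\<^sup>2 - a\<^sup>2) / (2 * t) * (inverse (?r ^ p) * (t + a * ?v))"
    proof -
      have "(R / 2 - A * (w * R) - C * D) * X = X * R / 2 - A * (w * (X * R)) - C * (X * D)" for R A w C D X :: real
        by (simp add: algebra_simps)
      note this[of "?r\<^sup>2" "a / (2 * t)" ?v "(t\<^sup>2 - a\<^sup>2) / (2 * t)" "t + a * ?v" "inverse (?r ^ p)"]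
      thus ?thesis unfolding ipg using e by (simp only:)
    qed
  qed
  also have "\<dots> = G / 2 - a / (2 * t) * y"
  proof -
    have "integrable P (\<lambda>z. g (u z))" "integrable P (\<lambda>z. u z * g (u z))" "integrable P (\<lambda>z. inverse (rad a t (u z) ^ p) * (t + a * u z))"
      unfolding g_def
      by (intro integrable_cont[of "\<lambda>v. inverse (rad a t v ^ (p - 2))"] integrable_cont[of "\<lambda>v. v * inverse (rad a t v ^ (p - 2))"]
         integrable_cont[of "\<lambda>v. inverse (rad a t v ^ p) * (t + a * v)"] continuous_intros ci)+
    moreover have "expectation (\<lambda>z. g (u z)) = G" using newton_inside[OF t] by (simp add: g_def G_def)
    ultimately show ?thesis using flux_zero[OF t] by (simp add: y_def)
  qed
  finally have "- (real p - 2) * (t / a) * (G / 2 - a / (2 * t) * y) = (real p - 1) * y" .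
  moreover define w where "w = t / a * G"
  moreover have "t / a * (G / 2 - a / (2 * t) * y) = w / 2 - y / 2" using t by (simp add: w_def field_simps)
  ultimately have "- (real p - 2) * (w / 2 - y / 2) = (real p - 1) * y" by (simp only: mult.assoc)
  hence "real p * y = - (real p - 2) * w" by (simp add: algebra_simps)
  moreover have "real p \<noteq> 0" using p_ge by simp
  ultimately have "y = - (real p - 2) / real p * w" by (simp add: nonzero_eq_divide_eq mult.commute)
  also have "w = t / a * G" by (simp add: w_def)
  also have "t / a * G = t / a ^ (p - 1)" unfolding G_def m using t by (simp add: field_simps numeral_eq_Suc)
  finally show ?thesis unfolding y_def g_def .
qed

lemma newton_first:
  assumes "0 < t" "0 < a" "t \<noteq> a"
  shows "expectation (\<lambda>z. u z * inverse (rad a t (u z) ^ (p - 2))) = - (real p - 2) / real p * (min a t / max a t ^ (p - 1))"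
  using newton_first_inside[of t a] newton_first_inside[of a t] assms
  by (cases t a rule: linorder_cases) (auto simp: rad_commute max_def min_def)

text \<open>A sphere with \<open>t = a\<close> passes through the origin only at the antipode
  \<open>u z = -1\<close>, a null set by \<open>u_ne\<close>.\<close>

lemma rad_pos_AE:
  assumes "a \<ge> 0" "t > 0"
  shows "AE z in P. rad a t (u z) > 0"
  using u_ne
proof eventually_elim
  case (elim z)
  show ?case
  proof (cases "t = a")
    case True
    have "a\<^sup>2 + t\<^sup>2 + 2 * a * t * u z = 2 * a\<^sup>2 * (1 + u z)" using True by (simp add: power2_eq_square algebra_simps)
    also have "\<dots> > 0" using elim u_range[of z] assms True by (intro mult_pos_pos) auto
    finally show ?thesis by (simp add: rad_def)
  qed (use rad_pos u_range assms in auto)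
qed

section \<open>Spherical means of superharmonic radial functions\<close>

lemma integrable_mean:
  assumes [measurable]: "M \<in> borel_measurable borel" and "\<And>r. \<bar>M r\<bar> \<le> (C::real)"
  shows "integrable P (\<lambda>z. M (rad a t (u z)))"
  by (intro integrable_const_bound[of _ C] AE_I2) (use assms in auto)

text \<open>
  With \<open>M' r = - \<kappa> r / r\<^bsup>p - 1\<^esup>\<close>, superharmonicity of \<open>x \<mapsto> M \<parallel>x\<parallel>\<close> amounts to \<open>\<kappa>\<close> being nondecreasing.
  Inside the sphere of radius \<open>a\<close> the factor \<open>t + a u\<close> is negative precisely where \<open>\<kappa>\<close> is below its
  value at \<open>(a\<^sup>2 - t\<^sup>2)\<^bsup>1/2\<^esup>\<close>, which reduces the sign of the derivative to the harmonic case.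
\<close>
lemma mean_antimono_inside:
  assumes dM: "\<And>r. r > 0 \<Longrightarrow> (M has_real_derivative - \<kappa> r * inverse (r ^ (p - 1))) (at r)"
    and c\<kappa>: "continuous_on {0<..} \<kappa>"
    and mono: "\<And>r s. 0 < r \<Longrightarrow> r \<le> s \<Longrightarrow> \<kappa> r \<le> \<kappa> s"
    and st: "0 < s" "s \<le> t" "t < a"
  shows "expectation (\<lambda>z. M (rad a t (u z))) \<le> expectation (\<lambda>z. M (rad a s (u z)))"
proof (rule DERIV_nonpos_imp_nonincreasing[OF st(2)])
  fix x assume "s \<le> x" "x \<le> t"
  hence x: "0 < x" "x < a" using st by auto
  have rp: "rad a x v > 0" if "v \<in> {-1..1}" for v using rad_pos[of a x v] that x by simp
  have rn: "rad a x v ^ k \<noteq> 0" "rad a x v \<noteq> 0" if "v \<in> {-1..1}" for v k using rp[OF that] by auto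
  have ck: "continuous_on {-1..1} (\<lambda>v. \<kappa> (rad a x v))"
    by (rule continuous_on_compose2[OF c\<kappa>]) (use rp in \<open>auto intro!: continuous_intros\<close>)
  have "((\<lambda>t. expectation (\<lambda>z. M (rad a t (u z)))) has_real_derivative
      expectation (\<lambda>z. - \<kappa> (rad a x (u z)) * inverse (rad a x (u z) ^ (p - 1)) * ((x + a * u z) / rad a x (u z)))) (at x)"
    by (rule has_real_derivative_mean[OF _ _ _ dM]) (use x in \<open>auto intro!: continuous_intros c\<kappa>\<close>)
  moreover have "expectation (\<lambda>z. - \<kappa> (rad a x (u z)) * inverse (rad a x (u z) ^ (p - 1)) * ((x + a * u z) / rad a x (u z)))
     \<le> expectation (\<lambda>z. - \<kappa> (sqrt (a\<^sup>2 - x\<^sup>2)) * (inverse (rad a x (u z) ^ p) * (x + a * u z)))"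
  proof (rule integral_mono)
    have "continuous_on {-1..1} (\<lambda>v. inverse (rad a x v ^ k))" for k
      by (rule continuous_on_inverse) (auto intro!: continuous_intros dest: rn(1)[of _ k])
    note ci = this
    have cq: "continuous_on {-1..1} (\<lambda>v. (x + a * v) / rad a x v)"
      by (rule continuous_on_divide) (auto intro!: continuous_intros dest: rn(2))
    have "continuous_on {-1..1} (\<lambda>v. - \<kappa> (rad a x v) * inverse (rad a x v ^ (p - 1)) * ((x + a * v) / rad a x v))"
      by (rule continuous_on_mult[OF continuous_on_mult[OF continuous_on_minus[OF ck] ci] cq])
    from integrable_cont[OF this] show "integrable P (\<lambda>z. - \<kappa> (rad a x (u z)) * inverse (rad a x (u z) ^ (p - 1)) * ((x + a * u z) / rad a x (u z)))" .
    have "continuous_on {-1..1} (\<lambda>v. - \<kappa> (sqrt (a\<^sup>2 - x\<^sup>2)) * (inverse (rad a x v ^ p) * (x + a * v)))"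
      by (intro continuous_on_mult ci continuous_on_add continuous_on_const continuous_on_id)
    from integrable_cont[OF this] show "integrable P (\<lambda>z. - \<kappa> (sqrt (a\<^sup>2 - x\<^sup>2)) * (inverse (rad a x (u z) ^ p) * (x + a * u z)))" .
    fix z
    let ?r = "rad a x (u z)" and ?q = "sqrt (a\<^sup>2 - x\<^sup>2)"
    have r: "?r > 0" by (rule rp[OF u_range])
    have ax: "a\<^sup>2 - x\<^sup>2 > 0" using x by (simp add: power_strict_mono)
    have r0: "?q > 0" using ax by simp
    have e: "2 * x * (x + a * u z) = ?r\<^sup>2 - ?q\<^sup>2"
      using rad_square[of a x "u z"] x u_range ax by (simp add: power2_eq_square algebra_simps)
    have "\<kappa> ?q * (x + a * u z) \<le> \<kappa> ?r * (x + a * u z)"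
    proof (cases "x + a * u z \<ge> 0")
      case True
      hence "?q\<^sup>2 \<le> ?r\<^sup>2" using e x by (smt (verit) mult_nonneg_nonneg)
      from power2_le_imp_le[OF this less_imp_le[OF r]] have "?q \<le> ?r" .
      thus ?thesis using mono[OF r0] True by (intro mult_right_mono) auto
    next
      case False
      hence "2 * x * (x + a * u z) \<le> 0" using x by (intro mult_nonneg_nonpos) auto
      hence "?r\<^sup>2 \<le> ?q\<^sup>2" using e by simp
      from power2_le_imp_le[OF this less_imp_le[OF r0]] have "?r \<le> ?q" .
      thus ?thesis using mono[OF r] False by (intro mult_right_mono_neg) auto
    qed
    moreover have "0 \<le> inverse (?r ^ p)" using r by simp
    ultimately have "\<kappa> ?q * (x + a * u z) * inverse (?r ^ p) \<le> \<kappa> ?r * (x + a * u z) * inverse (?r ^ p)"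
      by (rule mult_right_mono)
    moreover have "?r ^ p = ?r ^ (p - 1) * ?r" using p_ge by (simp flip: power_Suc2)
    ultimately have e: "- \<kappa> ?r * inverse (?r ^ (p - 1)) * ((x + a * u z) / ?r) = - (\<kappa> ?r * (x + a * u z) * inverse (?r ^ p))"
      "- \<kappa> ?q * (inverse (?r ^ p) * (x + a * u z)) = - (\<kappa> ?q * (x + a * u z) * inverse (?r ^ p))"
      "\<kappa> ?q * (x + a * u z) * inverse (?r ^ p) \<le> \<kappa> ?r * (x + a * u z) * inverse (?r ^ p)"
      by (simp_all add: divide_inverse)
    show "- \<kappa> ?r * inverse (?r ^ (p - 1)) * ((x + a * u z) / ?r) \<le> - \<kappa> ?q * (inverse (?r ^ p) * (x + a * u z))"
      unfolding e(1,2) neg_le_iff_le by (rule e(3))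
  qed
  moreover have "expectation (\<lambda>z. - \<kappa> (sqrt (a\<^sup>2 - x\<^sup>2)) * (inverse (rad a x (u z) ^ p) * (x + a * u z))) = 0"
    using flux_zero[OF x] by simp
  ultimately show "\<exists>y. ((\<lambda>t. expectation (\<lambda>z. M (rad a t (u z)))) has_real_derivative y) (at x) \<and> y \<le> 0"
    by fastforce
qed

lemma mean_antimono:
  assumes dM: "\<And>r. r > 0 \<Longrightarrow> (M has_real_derivative - \<kappa> r * inverse (r ^ (p - 1))) (at r)"
    and c\<kappa>: "continuous_on {0<..} \<kappa>"
    and mono: "\<And>r s. 0 < r \<Longrightarrow> r \<le> s \<Longrightarrow> \<kappa> r \<le> \<kappa> s"
    and nonneg: "\<And>r. 0 < r \<Longrightarrow> \<kappa> r \<ge> 0"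
    and [measurable]: "M \<in> borel_measurable borel" and bound: "\<And>r. \<bar>M r\<bar> \<le> C"
    and st: "0 < s" "s \<le> t" and a: "a \<ge> 0"
  shows "expectation (\<lambda>z. M (rad a t (u z))) \<le> expectation (\<lambda>z. M (rad a s (u z)))"
proof -
  have outside: "expectation (\<lambda>z. M (rad a t (u z))) \<le> expectation (\<lambda>z. M (rad a s (u z)))"
    if "0 < s" "s \<le> t" "a \<le> s" for s t
  proof (rule integral_mono_AE)
    show "AE z in P. M (rad a t (u z)) \<le> M (rad a s (u z))"
      using rad_pos_AE[OF a that(1)]
    proof eventually_elim
      case (elim z)
      \<comment> \<open>The squared distances differ by
        \<open>(t - s) * (t + s + 2 * (a * u z))\<close>, and the second factor is nonnegative as
        both radii are at least \<open>a\<close>.\<close>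
      have "a * (-1) \<le> a * u z" using a u_range[of z] by (intro mult_left_mono) auto
      hence "0 \<le> (t - s) * (t + s + 2 * (a * u z))" using that by (intro mult_nonneg_nonneg) auto
      hence "rad a s (u z) \<le> rad a t (u z)" unfolding rad_def
        by (intro real_sqrt_le_mono) (simp add: power2_eq_square algebra_simps)
      thus ?case
      proof (rule DERIV_nonpos_imp_nonincreasing)
        fix x assume "rad a s (u z) \<le> x"
        hence "x > 0" using elim by linarith
        thus "\<exists>y. (M has_real_derivative y) (at x) \<and> y \<le> 0"
          using dM[of x] nonneg[of x] by (intro exI[of _ "- \<kappa> x * inverse (x ^ (p - 1))"]) simp
      qed
    qed
  qed (intro integrable_mean[OF _ bound], simp)+
  have upto: "expectation (\<lambda>z. M (rad a a (u z))) \<le> expectation (\<lambda>z. M (rad a s (u z)))" if "0 < s" "s < a" for s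
  proof -
    have lim: "((\<lambda>t. expectation (\<lambda>z. M (rad a t (u z)))) \<longlongrightarrow> expectation (\<lambda>z. M (rad a a (u z)))) (at a within {..<a})"
    proof (rule expectation_tendsto[where C=C])
      have "a > 0" using that by simp
      show "AE z in P. ((\<lambda>t. M (rad a t (u z))) \<longlongrightarrow> M (rad a a (u z))) (at a within {..<a})"
        using rad_pos_AE[OF a \<open>a > 0\<close>]
      proof eventually_elim
        case (elim z)
        have "isCont M (rad a a (u z))" using dM[OF elim] by (rule DERIV_isCont)
        thus ?case by (rule isCont_tendsto_compose) (intro tendsto_intros)
      qed
    qed (use bound in auto)
    show ?thesis
    proof (rule tendsto_upperbound[OF lim])
      have "\<forall>\<^sub>F t in at_left a. t \<in> {s<..<a}" by (rule eventually_at_left_real) (use that in auto)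
      thus "\<forall>\<^sub>F t in at a within {..<a}. expectation (\<lambda>z. M (rad a t (u z))) \<le> expectation (\<lambda>z. M (rad a s (u z)))"
        by eventually_elim (use that in \<open>auto intro!: mean_antimono_inside[OF dM c\<kappa> mono]\<close>)
    qed simp
  qed
  show ?thesis
  proof (cases "a \<le> s")
    case True
    thus ?thesis using outside[OF st] by simp
  next
    case False
    show ?thesis
    proof (cases "t < a")
      case True
      thus ?thesis using mean_antimono_inside[OF dM c\<kappa> mono st] by simp
    next
      case F: False
      have "expectation (\<lambda>z. M (rad a t (u z))) \<le> expectation (\<lambda>z. M (rad a a (u z)))"
        using F False st by (intro outside) auto
      also have "\<dots> \<le> expectation (\<lambda>z. M (rad a s (u z)))" using False st by (intro upto) auto
      finally show ?thesis .
    qed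
  qed
qed

text \<open>
  Rescaling \<open>t\<close> to \<open>s\<close> shrinks \<open>a\<close>, and the mean is symmetric in \<open>a\<close> and \<open>t\<close>.
\<close>
lemma square_mean_mono:
  assumes dM: "\<And>r. r > 0 \<Longrightarrow> (M has_real_derivative - \<kappa> r * inverse (r ^ (p - 1))) (at r)"
    and c\<kappa>: "continuous_on {0<..} \<kappa>"
    and mono: "\<And>r s. 0 < r \<Longrightarrow> r \<le> s \<Longrightarrow> \<kappa> r \<le> \<kappa> s"
    and nonneg: "\<And>r. 0 < r \<Longrightarrow> \<kappa> r \<ge> 0"
    and [measurable]: "M \<in> borel_measurable borel" and bound: "\<And>r. \<bar>M r\<bar> \<le> C"
    and sq: "\<And>r s. 0 < r \<Longrightarrow> r \<le> s \<Longrightarrow> r\<^sup>2 * M r \<le> s\<^sup>2 * M s"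
    and st: "0 < s" "s \<le> t" and a: "a > 0"
  shows "s\<^sup>2 * expectation (\<lambda>z. M (rad a s (u z))) \<le> t\<^sup>2 * expectation (\<lambda>z. M (rad a t (u z)))"
proof -
  define l where "l = t / s"
  have l: "l \<ge> 1" "t = l * s" using st by (auto simp: l_def)
  have al: "0 < a / l" "a / l \<le> a" using a l by (auto simp: field_simps)
  have e: "rad a t v = l * rad (a / l) s v" for v
  proof -
    have "a\<^sup>2 + t\<^sup>2 + 2 * a * t * v = l\<^sup>2 * ((a / l)\<^sup>2 + s\<^sup>2 + 2 * (a / l) * s * v)"
      using l by (simp add: field_simps power2_eq_square)
    thus ?thesis unfolding rad_def using l by (simp add: real_sqrt_mult)
  qed
  have "expectation (\<lambda>z. M (rad a s (u z))) \<le> expectation (\<lambda>z. M (rad (a / l) s (u z)))"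
    using mean_antimono[OF dM c\<kappa> mono nonneg _ bound al(1,2), of s] st by (simp add: rad_commute[of s])
  also have "\<dots> \<le> expectation (\<lambda>z. l\<^sup>2 * M (rad a t (u z)))"
  proof (rule integral_mono_AE)
    show "AE z in P. M (rad (a / l) s (u z)) \<le> l\<^sup>2 * M (rad a t (u z))"
      using rad_pos_AE[OF less_imp_le[OF al(1)] st(1)]
    proof eventually_elim
      case (elim z)
      have "rad (a / l) s (u z) \<le> l * rad (a / l) s (u z)" using l elim by simp
      from sq[OF elim this] have "(rad (a / l) s (u z))\<^sup>2 * M (rad (a / l) s (u z)) \<le> (rad (a / l) s (u z))\<^sup>2 * (l\<^sup>2 * M (rad a t (u z)))"
        by (simp add: e power_mult_distrib mult_ac)
      thus ?case using elim by simp
    qed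
  qed (intro integrable_mult_right integrable_mean[OF _ bound], simp)+
  finally have "s\<^sup>2 * expectation (\<lambda>z. M (rad a s (u z))) \<le> s\<^sup>2 * (l\<^sup>2 * expectation (\<lambda>z. M (rad a t (u z))))"
    by (intro mult_left_mono) simp_all
  thus ?thesis by (simp add: l(2) power_mult_distrib mult_ac)
qed

lemma measurable_mean:
  fixes M :: "real \<Rightarrow> real"
  assumes [measurable]: "M \<in> borel_measurable borel"
  shows "(\<lambda>t. expectation (\<lambda>z. M (rad a t (u z)))) \<in> borel_measurable borel"
proof -
  have "(\<lambda>(t, z). M (rad a t (u z))) \<in> borel_measurable (borel \<Otimes>\<^sub>M P)" by measurable
  thus ?thesis by (rule borel_measurable_lebesgue_integral[of "\<lambda>t z. M (rad a t (u z))"])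
qed

lemma power_mean_integrable:
  assumes [measurable]: "M \<in> borel_measurable borel" and bound: "\<And>r. \<bar>M r\<bar> \<le> C"
  shows "set_integrable lborel {0..t} (\<lambda>s. s ^ k * expectation (\<lambda>z. M (rad a s (u z))))"
proof -
  note [measurable] = measurable_mean[of M a]
  have "\<bar>expectation (\<lambda>z. M (rad a s (u z)))\<bar> \<le> C" for s
  proof -
    have "\<bar>expectation (\<lambda>z. M (rad a s (u z)))\<bar> \<le> expectation (\<lambda>z. \<bar>M (rad a s (u z))\<bar>)" by (rule integral_abs_bound)
    also have "\<dots> \<le> C" by (intro integral_le_const AE_I2 bound integrable_abs integrable_mean[OF _ bound]) simp
    finally show ?thesis .
  qed
  thus ?thesis unfolding set_integrable_def
    by (intro integrableI_bounded_set_indicator[where B="t ^ k * C", of "{0..t}"])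
       (auto simp: abs_mult emeasure_lborel_Icc_eq intro!: mult_mono power_mono AE_I2)
qed

text \<open>If the divergence of M(|x|) x is at least c M, integrating it over concentric spheres
  bounds the flux below by c times the ball integral of \<open>M\<close>. The flux is differentiable
  off the radius \<open>a\<close> and continuous there, which suffices for the fundamental theorem
  of calculus.\<close>

lemma flux_lower_bound:
  assumes dM: "\<And>r. r > 0 \<Longrightarrow> (M has_real_derivative M' r) (at r)"
    and cM': "continuous_on {0<..} M'"
    and Mm [measurable]: "M \<in> borel_measurable borel" and bound: "\<And>r. \<bar>M r\<bar> \<le> C"
    and ineq: "\<And>r. r > 0 \<Longrightarrow> c * M r \<le> real p * M r + r * M' r"
    and t: "t > 0" and a: "a \<ge> 0"
  shows "c * integral {0..t} (\<lambda>s. s ^ (p - 1) * expectation (\<lambda>z. M (rad a s (u z)))) \<le>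
     t ^ (p - 1) * expectation (\<lambda>z. M (rad a t (u z)) * (t + a * u z))"
proof -
  define J where "J = (\<lambda>t. t ^ (p - 1) * expectation (\<lambda>z. M (rad a t (u z)) * (t + a * u z)))"
  define J' where "J' = (\<lambda>t. t ^ (p - 1) * expectation (\<lambda>z. real p * M (rad a t (u z)) + rad a t (u z) * M' (rad a t (u z))))"
  define g where "g = (\<lambda>s. c * (s ^ (p - 1) * expectation (\<lambda>z. M (rad a s (u z)))))"
  have C: "C \<ge> 0" using bound[of 0] by linarith
  have "continuous_on {0..t} (\<lambda>t. expectation (\<lambda>z. M (rad a t (u z)) * (t + a * u z)))"
    unfolding continuous_on_def
  proof
    fix x assume x: "x \<in> {0..t}"
    show "((\<lambda>t. expectation (\<lambda>z. M (rad a t (u z)) * (t + a * u z))) \<longlongrightarrow> expectation (\<lambda>z. M (rad a x (u z)) * (x + a * u z))) (at x within {0..t})"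
    proof (rule expectation_tendsto[where C="C * (a + t)"])
      fix s z assume s: "s \<in> {0..t}"
      have "\<bar>s + a * u z\<bar> \<le> a + t" using abs_radial_le_rad[of a s "u z"] rad_bounds(2)[of a s "u z"] s a u_range[of z] by auto
      thus "\<bar>M (rad a s (u z)) * (s + a * u z)\<bar> \<le> C * (a + t)"
        unfolding abs_mult using bound C by (intro mult_mono) auto
    next
      show "AE z in P. ((\<lambda>t. M (rad a t (u z)) * (t + a * u z)) \<longlongrightarrow> M (rad a x (u z)) * (x + a * u z)) (at x within {0..t})"
      proof (rule AE_I2)
        fix z
        show "((\<lambda>t. M (rad a t (u z)) * (t + a * u z)) \<longlongrightarrow> M (rad a x (u z)) * (x + a * u z)) (at x within {0..t})"
        proof (cases "rad a x (u z) > 0")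
          case True
          have "isCont M (rad a x (u z))" using dM[OF True] by (rule DERIV_isCont)
          hence "((\<lambda>t. M (rad a t (u z))) \<longlongrightarrow> M (rad a x (u z))) (at x within {0..t})"
            by (rule isCont_tendsto_compose) (intro tendsto_intros)
          thus ?thesis by (intro tendsto_intros)
        next
          \<comment> \<open>At the origin \<open>M\<close> may be discontinuous, but it is bounded
            and the normal component is at most \<open>rad\<close>, so the product still tends to
            0.\<close>
          case False
          have "((\<lambda>s. C * rad a s (u z)) \<longlongrightarrow> C * rad a x (u z)) (at x within {0..t})" by (intro tendsto_intros)
          moreover have r0: "rad a x (u z) = 0" using False rad_nonneg[of a x "u z"] x a u_range[of z] by auto
          ultimately have l0: "((\<lambda>s. C * rad a s (u z)) \<longlongrightarrow> 0) (at x within {0..t})" by simp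
          have "x + a * u z = 0" using abs_radial_le_rad[of a x "u z"] r0 x a u_range[of z] by auto
          moreover have "((\<lambda>t. M (rad a t (u z)) * (t + a * u z)) \<longlongrightarrow> 0) (at x within {0..t})"
          proof (rule Lim_null_comparison[OF _ l0])
            show "\<forall>\<^sub>F s in at x within {0..t}. norm (M (rad a s (u z)) * (s + a * u z)) \<le> C * rad a s (u z)"
              unfolding eventually_at_filter
            proof (intro always_eventually allI impI)
              fix s assume "s \<in> {0..t}"
              hence "\<bar>s + a * u z\<bar> \<le> rad a s (u z)" using abs_radial_le_rad[of a s "u z"] a u_range[of z] by auto
              thus "norm (M (rad a s (u z)) * (s + a * u z)) \<le> C * rad a s (u z)"
                unfolding real_norm_def abs_mult using bound C by (intro mult_mono) auto
            qed
          qed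
          ultimately show ?thesis by simp
        qed
      qed
    qed measurable
  qed
  hence cJ: "continuous_on {0..t} J" unfolding J_def by (intro continuous_intros)
  have dJ: "(J has_real_derivative J' s) (at s)" if "s > 0" "s \<noteq> a" for s
    unfolding J_def J'_def by (rule flux_deriv[OF a that dM cM'])
  have J': "(J' has_integral J t - J 0) {0..t}"
  proof (rule fundamental_theorem_of_calculus_interior_strong[where S="{a}"])
    fix x assume "x \<in> {0<..<t} - {a}"
    thus "(J has_vector_derivative J' x) (at x)"
      using dJ[of x] by (simp add: has_real_derivative_iff_has_vector_derivative)
  qed (use t cJ in auto)
  hence J'': "((\<lambda>s. if s \<in> {0, a} then g s else J' s) has_integral J t - J 0) {0..t}"
    by (rule has_integral_spike_finite[of "{0, a}", rotated -1]) auto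
  have gi: "g integrable_on {0..t}" unfolding g_def
    using set_borel_integral_eq_integral(1)[OF power_mean_integrable[OF Mm bound, where t=t and k="p - 1" and a=a]]
    by (intro integrable_on_mult_right) simp
  have "integral {0..t} g \<le> J t - J 0"
  proof (rule has_integral_le[OF integrable_integral[OF gi] J''])
    fix s assume s: "s \<in> {0..t}"
    show "g s \<le> (if s \<in> {0, a} then g s else J' s)"
    proof (cases "s \<in> {0, a}")
      case False
      hence s': "s > 0" "s \<noteq> a" using s by auto
      have rp: "rad a s v > 0" if "v \<in> {-1..1}" for v using rad_pos[of a s v] s' a that by auto
      have cM: "continuous_on {0<..} M" using dM by (intro DERIV_continuous_on) (auto intro: has_field_derivative_at_within)
      have "expectation (\<lambda>z. c * M (rad a s (u z))) \<le> expectation (\<lambda>z. real p * M (rad a s (u z)) + rad a s (u z) * M' (rad a s (u z)))"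
      proof (rule integral_mono)
        show "integrable P (\<lambda>z. real p * M (rad a s (u z)) + rad a s (u z) * M' (rad a s (u z)))"
          by (rule integrable_cont[of "\<lambda>v. real p * M (rad a s v) + rad a s v * M' (rad a s v)"])
             (use rp in \<open>auto intro!: continuous_intros continuous_on_compose2[OF cM] continuous_on_compose2[OF cM']\<close>)
        show "integrable P (\<lambda>z. c * M (rad a s (u z)))"
          by (intro integrable_mult_right integrable_mean[OF _ bound]) simp
      qed (rule ineq[OF rp[OF u_range]])
      hence "s ^ (p - 1) * (c * expectation (\<lambda>z. M (rad a s (u z)))) \<le> J' s"
        unfolding J'_def using s' by (intro mult_left_mono) auto
      thus ?thesis using False by (simp add: g_def mult_ac)
    qed simp
  qed
  moreover have "J 0 = 0" unfolding J_def using p_ge by (simp add: zero_power)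
  moreover have "integral {0..t} g = c * integral {0..t} (\<lambda>s. s ^ (p - 1) * expectation (\<lambda>z. M (rad a s (u z))))"
    unfolding g_def by simp
  ultimately have "c * integral {0..t} (\<lambda>s. s ^ (p - 1) * expectation (\<lambda>z. M (rad a s (u z)))) \<le> J t" by linarith
  thus ?thesis unfolding J_def .
qed

end

text \<open>Chebyshev's inequality for \<beta> / \<alpha> and h ordered alike, written with cross
  products so that zeros of \<alpha> cause no trouble. The pairwise hypothesis is integrated first
  in s and then in t.\<close>

lemma chebyshev_integral_inequality:
  fixes \<alpha> \<beta> h :: "'a \<Rightarrow> real"
  assumes int: "integrable M \<alpha>" "integrable M \<beta>" "integrable M (\<lambda>x. \<alpha> x * h x)" "integrable M (\<lambda>x. \<beta> x * h x)"
    and pw: "\<And>s t. s \<in> space M \<Longrightarrow> t \<in> space M \<Longrightarrow> 0 \<le> (\<beta> s * \<alpha> t - \<beta> t * \<alpha> s) * (h s - h t)"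
  shows "(\<integral>x. \<beta> x \<partial>M) * (\<integral>x. \<alpha> x * h x \<partial>M) \<le> (\<integral>x. \<beta> x * h x \<partial>M) * (\<integral>x. \<alpha> x \<partial>M)"
proof -
  let ?a = "\<integral>x. \<alpha> x \<partial>M" and ?b = "\<integral>x. \<beta> x \<partial>M"
  let ?ah = "\<integral>x. \<alpha> x * h x \<partial>M" and ?bh = "\<integral>x. \<beta> x * h x \<partial>M"
  have "0 \<le> ?bh * \<alpha> t - ?b * (\<alpha> t * h t) - ?ah * \<beta> t + ?a * (\<beta> t * h t)" if t: "t \<in> space M" for t
  proof -
    have "0 \<le> (\<integral>s. (\<beta> s * \<alpha> t - \<beta> t * \<alpha> s) * (h s - h t) \<partial>M)"
      by (intro Bochner_Integration.integral_nonneg pw t)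
    also have "\<dots> = (\<integral>s. \<alpha> t * (\<beta> s * h s) - (\<alpha> t * h t) * \<beta> s - \<beta> t * (\<alpha> s * h s) + (\<beta> t * h t) * \<alpha> s \<partial>M)"
      by (simp add: algebra_simps)
    also have "\<dots> = \<alpha> t * ?bh - (\<alpha> t * h t) * ?b - \<beta> t * ?ah + (\<beta> t * h t) * ?a"
      using int by simp
    finally show ?thesis by (simp add: algebra_simps)
  qed
  hence "0 \<le> (\<integral>t. ?bh * \<alpha> t - ?b * (\<alpha> t * h t) - ?ah * \<beta> t + ?a * (\<beta> t * h t) \<partial>M)"
    by (intro Bochner_Integration.integral_nonneg)
  also have "\<dots> = ?bh * ?a - ?b * ?ah - ?ah * ?b + ?a * ?bh"
    using int by simp
  finally show ?thesis by (simp add: algebra_simps)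
qed

text \<open>
  Minorants instead of derivatives, because the \<open>\<kappa>\<close> of interest involves \<open>F\<close>, which need not be
  differentiable where \<open>f\<close> is discontinuous.
\<close>
lemma dini_mono:
  fixes \<kappa> :: "real \<Rightarrow> real"
  assumes cont: "continuous_on {0<..} \<kappa>"
    and minorant: "\<And>r. 0 < r \<Longrightarrow> \<exists>g d. g r = \<kappa> r \<and> (\<forall>s\<ge>r. g s \<le> \<kappa> s) \<and> (g has_real_derivative d) (at r) \<and> 0 \<le> d"
    and xy: "0 < x" "x \<le> y"
  shows "\<kappa> x \<le> \<kappa> y"
proof (rule field_le_epsilon)
  fix e0 :: real assume e0: "e0 > 0"
  \<comment> \<open>An added slope \<open>e\<close> turns the weak \<open>0 \<le> d\<close> into
    strict increase, at a total cost of at most \<open>e0\<close> on the interval; the 1 keeps the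
    divisor positive for \<open>x = y\<close>.\<close>
  define e where "e = e0 / (y - x + 1)"
  have e: "e > 0" "e * (y - x) \<le> e0" using e0 xy by (auto simp: e_def field_simps)
  define G where "G = (\<lambda>s. \<kappa> s + e * (s - x))"
  define S where "S = {s \<in> {x..y}. G x \<le> G s}"
  have cG: "continuous_on {x..y} G" unfolding G_def
    by (intro continuous_intros continuous_on_subset[OF cont]) (use xy in auto)
  have "closed S" unfolding S_def
    using continuous_closed_preimage[OF cG closed_atLeastAtMost closed_atLeast[of "G x"]]
    by (simp add: vimage_def Int_def)
  moreover have xS: "x \<in> S" using xy by (simp add: S_def)
  moreover have bdd: "bdd_above S" by (auto simp: S_def bdd_above_def)
  ultimately have supS: "Sup S \<in> S" by (intro closed_contains_Sup) auto
  define m where "m = Sup S"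
  have m: "x \<le> m" "m \<le> y" "G x \<le> G m" using supS by (auto simp: S_def m_def)
  have "m = y"
  proof (rule ccontr)
    assume "m \<noteq> y"
    hence my: "m < y" using m by simp
    obtain g d where g: "g m = \<kappa> m" "\<And>s. s \<ge> m \<Longrightarrow> g s \<le> \<kappa> s" "(g has_real_derivative d) (at m)" "0 \<le> d"
      using minorant[of m] m xy by auto
    have "((\<lambda>s. g s + e * (s - x)) has_real_derivative (d + e)) (at m)"
      by (auto intro!: derivative_eq_intros g(3))
    from DERIV_pos_inc_right[OF this] obtain q where q: "q > 0"
      "\<And>h. 0 < h \<Longrightarrow> h < q \<Longrightarrow> g m + e * (m - x) < g (m + h) + e * (m + h - x)"
      using g(4) e by auto
    define h where "h = min (q / 2) (y - m)"
    have h: "0 < h" "h < q" "m + h \<le> y" using q my by (auto simp: h_def)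
    have "G m < g (m + h) + e * (m + h - x)" using q(2)[OF h(1,2)] g(1) by (simp add: G_def)
    also have "\<dots> \<le> G (m + h)" using g(2)[of "m + h"] h by (simp add: G_def)
    finally have "m + h \<in> S" using m h by (simp add: S_def)
    hence "m + h \<le> m" unfolding m_def using bdd by (intro cSup_upper)
    thus False using h by simp
  qed
  thus "\<kappa> x \<le> \<kappa> y + e0" using m(3) e by (simp add: G_def)
qed

lemma power_split:
  fixes x :: "'a::monoid_mult"
  assumes "j + k = m"
  shows "x ^ m = x ^ j * x ^ k"
  using assms by (auto simp: power_add)

text \<open>
  The right-hand side has the sign of the derivative at \<open>r\<close> of a minorant of \<open>\<kappa>\<close> touching it there, with \<open>n = p - 4\<close>, \<open>q = \<psi> r\<close>, \<open>k = r\<^sup>2 f r / F r\<close>, and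
  \<open>K1\<close>, \<open>K2\<close> the integrals of \<open>s\<^bsup>p - 1\<^esup> f s\<close> and \<open>s\<^bsup>p + 1\<^esup> f s\<close> over \<open>(0, r)\<close> divided by \<open>B r\<close> and \<open>A r\<close>.
\<close>
lemma kappa_key_inequality:
  fixes K1 K2 k n q :: real
  assumes "n \<ge> 0" "0 \<le> K1" "K1 \<le> K2" "K2 - K1 \<le> 2" "K2 \<le> k" "K2 * q \<le> K1"
    and q: "q * (n + 4 - K2) = n + 2 - K1" and pos: "n + 4 - K2 > 0"
  shows "0 \<le> (k - K1) * (2 - (K2 - K1)) + (K1 - 2) * (K2 - K1)"
proof -
  \<comment> \<open>Otherwise the relation for \<open>q\<close> together with
    \<open>n \<ge> 0\<close>, that is p \<ge> 4, forces q \<ge> 1/2, and then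
    \<open>K2 * q \<le> K1\<close> already gives the claim.\<close>
  have "K2 \<le> 2 * K1"
  proof (rule ccontr)
    assume a: "\<not> K2 \<le> 2 * K1"
    hence K2: "K2 > 0" using assms by linarith
    have "q \<ge> 1 / 2"
    proof (rule ccontr)
      assume "\<not> q \<ge> 1 / 2"
      hence "q * (n + 4 - K2) \<le> 1 / 2 * (n + 4 - K2)" using pos by (intro mult_right_mono) auto
      hence "2 * (n + 2 - K1) \<le> n + 4 - K2" unfolding q by simp
      hence "n + K2 \<le> 2 * K1" by argo
      thus False using a assms(1) by argo
    qed
    hence "K2 * (1 / 2) \<le> K2 * q" using K2 by (intro mult_left_mono) auto
    thus False using assms a by linarith
  qed
  \<comment> \<open>This product is the target with \<open>k\<close> lowered to \<open>K2\<close>;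
    the target is nondecreasing in \<open>k\<close> because \<open>2 - (K2 - K1)\<close> is
    nonnegative.\<close>
  hence "0 \<le> (K2 - K1) * (2 * K1 - K2)" using assms by (intro mult_nonneg_nonneg) auto
  also have "\<dots> = (K2 - K1) * (2 - (K2 - K1)) + (K1 - 2) * (K2 - K1)" by (simp add: algebra_simps)
  also have "\<dots> \<le> (k - K1) * (2 - (K2 - K1)) + (K1 - 2) * (K2 - K1)"
    using assms by (intro add_right_mono mult_right_mono) auto
  finally show ?thesis .
qed

text \<open>Tonelli on the region s \<le> t: the exchange that converts weights in f into weights in
  F throughout.\<close>

lemma nn_integral_tail_int:
  fixes g :: "real \<Rightarrow> ennreal"
  assumes [measurable]: "f \<in> borel_measurable borel" "g \<in> borel_measurable borel"
  shows "(\<integral>\<^sup>+t\<in>{0<..}. ennreal (t * f t) * (\<integral>\<^sup>+s\<in>{0<..t}. g s \<partial>lborel) \<partial>lborel) = (\<integral>\<^sup>+s\<in>{0<..}. g s * tail_int f s \<partial>lborel)"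
proof -
  have "(\<integral>\<^sup>+t\<in>{0<..}. ennreal (t * f t) * (\<integral>\<^sup>+s\<in>{0<..t}. g s \<partial>lborel) \<partial>lborel)
    = (\<integral>\<^sup>+t. (\<integral>\<^sup>+s. ennreal (t * f t) * g s * (indicator {0<..} s * indicator {s..} t) \<partial>lborel) \<partial>lborel)"
  proof (intro nn_integral_cong)
    fix t :: real
    have "ennreal (t * f t) * (\<integral>\<^sup>+s\<in>{0<..t}. g s \<partial>lborel) * indicator {0<..} t =
      (\<integral>\<^sup>+s. (ennreal (t * f t) * indicator {0<..} t) * (g s * indicator {0<..t} s) \<partial>lborel)"
      by (subst nn_integral_cmult) (auto simp: mult_ac)
    also have "\<dots> = (\<integral>\<^sup>+s. ennreal (t * f t) * g s * (indicator {0<..} s * indicator {s..} t) \<partial>lborel)"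
      by (intro nn_integral_cong) (auto simp: indicator_def mult_ac)
    finally show "ennreal (t * f t) * (\<integral>\<^sup>+s\<in>{0<..t}. g s \<partial>lborel) * indicator {0<..} t = \<dots>" .
  qed
  also have "\<dots> = (\<integral>\<^sup>+s. (\<integral>\<^sup>+t. ennreal (t * f t) * g s * (indicator {0<..} s * indicator {s..} t) \<partial>lborel) \<partial>lborel)"
  proof (intro lborel_pair.Fubini')
    have "(\<lambda>x :: real \<times> real. indicator {fst x..} (snd x) :: ennreal) = (\<lambda>x. if fst x \<le> snd x then 1 else 0)"
      by (auto simp: fun_eq_iff indicator_def)
    hence [measurable]: "(\<lambda>x :: real \<times> real. indicator {fst x..} (snd x) :: ennreal) \<in> borel_measurable (borel \<Otimes>\<^sub>M borel)"
      by simp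
    show "(\<lambda>(s, t). ennreal (t * f t) * g s * (indicator {0<..} s * indicator {s..} t)) \<in> borel_measurable (lborel \<Otimes>\<^sub>M lborel)"
      unfolding case_prod_beta by measurable
  qed
  also have "\<dots> = (\<integral>\<^sup>+s\<in>{0<..}. g s * tail_int f s \<partial>lborel)"
  proof (intro nn_integral_cong)
    fix s :: real
    have "(\<integral>\<^sup>+t. ennreal (t * f t) * g s * (indicator {0<..} s * indicator {s..} t) \<partial>lborel) =
      (\<integral>\<^sup>+t. (g s * indicator {0<..} s) * (ennreal (t * f t) * indicator {s..} t) \<partial>lborel)"
      by (intro nn_integral_cong) (auto simp: mult_ac)
    also have "\<dots> = g s * tail_int f s * indicator {0<..} s"
      unfolding tail_int_def by (subst nn_integral_cmult) (auto simp: mult_ac)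
    finally show "(\<integral>\<^sup>+t. ennreal (t * f t) * g s * (indicator {0<..} s * indicator {s..} t) \<partial>lborel) = \<dots>" .
  qed
  finally show ?thesis .
qed

lemma abs_power_diff_le:
  fixes x y c :: real
  assumes "0 \<le> x" "x \<le> c" "0 \<le> y" "y \<le> c"
  shows "\<bar>x ^ k - y ^ k\<bar> \<le> real k * c ^ (k - 1) * \<bar>x - y\<bar>"
proof (cases k)
  case (Suc j)
  have "norm (x ^ k - y ^ k) \<le> real k * c ^ (k - 1) * norm (x - y)"
  proof (rule field_differentiable_bound[where S="{0..c}" and f'="\<lambda>z. real k * z ^ (k - 1)"])
    show "((\<lambda>z. z ^ k) has_real_derivative real k * z ^ (k - 1)) (at z within {0..c})" for z
      using DERIV_pow[of k z "{0..c}"] by simp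
  qed (use assms in \<open>auto simp: abs_mult intro!: mult_left_mono power_mono\<close>)
  thus ?thesis by simp
qed simp

section \<open>The radial profile of the estimator\<close>

locale radial_profile =
  fixes f :: "real \<Rightarrow> real" and p :: nat
  assumes f_meas [measurable]: "f \<in> borel_measurable borel"
    and f_nonneg: "\<And>t. 0 \<le> t \<Longrightarrow> 0 \<le> f t"
    and p_ge: "p \<ge> 4"
    and mass_int: "set_integrable lborel {0<..} (\<lambda>t. t ^ (p - 1) * f t)"
    and mass_pos: "0 < (LINT t:{0<..}|lborel. t ^ (p - 1) * f t)"
begin

text \<open>Real counterpart of \<open>tail_int\<close>, with which it agrees for
  \<open>u > 0\<close>. At 0 the integral may diverge, and the Bochner default 0 would then be
  meaningless, so the statements about \<open>F\<close> are restricted to positive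
  arguments.\<close>

definition F :: "real \<Rightarrow> real" where "F u = (LINT s:{u..}|lborel. s * f s)"

text \<open>
  By Fubini, \<open>W k R / k\<close> is the integral of \<open>s\<^bsup>k - 1\<^esup> F s\<close> over \<open>(0, R)\<close>, so \<open>\<phi>\<close> below is the paper's
  \<open>\<phi>\<^sub>*\<close>.
\<close>
definition W :: "nat \<Rightarrow> real \<Rightarrow> real" where
  "W k R = (LINT t:{0<..}|lborel. t * f t * min t R ^ k)"

definition "A R = W p R / real p"
definition "B R = W (p - 2) R / (real p - 2)"
definition "\<phi> R = A R / B R"
definition "\<psi> R = \<phi> R / R\<^sup>2"
definition "\<phi>' R = R ^ (p - 3) * F R * (R\<^sup>2 - \<phi> R) / B R"
definition "\<psi>' R = \<phi>' R / R\<^sup>2 - 2 * \<phi> R / R ^ 3"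
text \<open>This is - R^(p-1) \<psi>' R with the negative powers cleared, the inward radial flux of
  the gradient of x \<mapsto> \<psi> \<parallel>x\<parallel> up to a constant.\<close>

definition "\<kappa> R = R ^ (p - 4) * (2 * \<phi> R - R ^ (p - 2) * F R * (R\<^sup>2 - \<phi> R) / B R)"

lemma set_integrable_bounded_by_mass:
  assumes [measurable]: "g \<in> borel_measurable borel" "S \<in> sets borel" and S: "S \<subseteq> {0<..}"
    and b: "\<And>t. t \<in> S \<Longrightarrow> \<bar>g t\<bar> \<le> c * (t ^ (p - 1) * f t)"
  shows "set_integrable lborel S (g :: real \<Rightarrow> real)"
proof -
  have "set_integrable lborel S (\<lambda>t. c * (t ^ (p - 1) * f t))"
    using set_integrable_subset[OF mass_int _ S] by simp
  thus ?thesis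
  proof (rule set_integrable_bound)
    show "AE x in lborel. x \<in> S \<longrightarrow> norm (g x) \<le> norm (c * (x ^ (p - 1) * f x))"
      using b by (intro AE_I2) (auto intro: order_trans[OF _ abs_ge_self])
    show "set_borel_measurable lborel S g" unfolding set_borel_measurable_def by measurable
  qed
qed

lemma W_int:
  assumes k: "k \<ge> p - 2" and R: "R \<ge> 0"
  shows "set_integrable lborel {0<..} (\<lambda>t. t * f t * min t R ^ k)"
proof (rule set_integrable_bounded_by_mass[where c="R ^ (k - (p - 2))"])
  fix t :: real assume "t \<in> {0<..}"
  hence t: "t > 0" by simp
  have "min t R ^ k = min t R ^ (p - 2) * min t R ^ (k - (p - 2))" using k by (simp flip: power_add)
  also have "\<dots> \<le> t ^ (p - 2) * R ^ (k - (p - 2))"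
    using t R by (intro mult_mono power_mono) auto
  finally have "(t * f t) * min t R ^ k \<le> (t * f t) * (t ^ (p - 2) * R ^ (k - (p - 2)))"
    using t f_nonneg by (intro mult_left_mono) auto
  also have "\<dots> = R ^ (k - (p - 2)) * ((t * t ^ (p - 2)) * f t)" by (simp add: mult_ac)
  also have "t * t ^ (p - 2) = t ^ (p - 1)" using p_ge by (simp flip: power_Suc add: Suc_diff_Suc numeral_2_eq_2)
  finally show "\<bar>t * f t * min t R ^ k\<bar> \<le> R ^ (k - (p - 2)) * (t ^ (p - 1) * f t)"
    using t R f_nonneg[of t] by (simp add: abs_mult)
qed auto

text \<open>The mass controls s^(p-1) f only. Away from 0 that weight dominates s up to the constant
  \<open>inverse (u ^ (p - 2))\<close>.\<close>

lemma F_int: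
  assumes u: "u > 0"
  shows "set_integrable lborel {u..} (\<lambda>s. s * f s)"
proof (rule set_integrable_bounded_by_mass[where c="inverse (u ^ (p - 2))"])
  fix t assume "t \<in> {u..}"
  hence t: "t \<ge> u" "t > 0" using u by auto
  have "1 \<le> inverse (u ^ (p - 2)) * t ^ (p - 2)"
    using power_mono[OF t(1), of "p - 2"] u by (simp add: field_simps)
  hence "(t * f t) * 1 \<le> (t * f t) * (inverse (u ^ (p - 2)) * t ^ (p - 2))"
    using t f_nonneg by (intro mult_left_mono) auto
  also have "\<dots> = inverse (u ^ (p - 2)) * ((t * t ^ (p - 2)) * f t)" by (simp add: mult_ac)
  also have "t * t ^ (p - 2) = t ^ (p - 1)" using p_ge by (simp flip: power_Suc add: Suc_diff_Suc numeral_2_eq_2)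
  finally show "\<bar>t * f t\<bar> \<le> inverse (u ^ (p - 2)) * (t ^ (p - 1) * f t)"
    using t f_nonneg[of t] by (simp add: abs_mult)
qed (use u in auto)

lemma set_integral_f_nonneg:
  assumes "S \<subseteq> {0<..}" "\<And>t. t \<in> S \<Longrightarrow> g t \<ge> 0"
  shows "0 \<le> (LINT t:S|lborel. (g t * f t :: real))"
  unfolding set_lebesgue_integral_def using assms f_nonneg
  by (intro Bochner_Integration.integral_nonneg) (auto simp: indicator_def subset_iff)

lemma F_nonneg: "u > 0 \<Longrightarrow> F u \<ge> 0"
  unfolding F_def by (rule set_integral_f_nonneg) auto

lemma tail_int_eq:
  assumes u: "u > 0"
  shows "tail_int f u = ennreal (F u)"
proof -
  have "tail_int f u = (\<integral>\<^sup>+s. ennreal (indicator {u..} s *\<^sub>R (s * f s)) \<partial>lborel)"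
    unfolding tail_int_def by (intro nn_integral_cong) (auto simp: indicator_def)
  also have "\<dots> = ennreal (F u)"
    unfolding F_def set_lebesgue_integral_def using u f_nonneg
    by (intro nn_integral_eq_integral F_int[OF u, unfolded set_integrable_def]) (auto simp: indicator_def)
  finally show ?thesis .
qed

lemma F_diff:
  assumes "0 < u" "u \<le> v"
  shows "F u - F v = (LINT s:{u..<v}|lborel. s * f s)"
proof -
  have "{u..} = {u..<v} \<union> {v..}" using assms by auto
  hence "F u = (LINT s:{u..<v}|lborel. s * f s) + F v"
    unfolding F_def
    by (subst set_integral_Un[symmetric])
       (use F_int[of v] set_integrable_subset[OF F_int[of u], of "{u..<v}"] assms in auto)
  thus ?thesis by simp
qed

lemma F_antimono: "0 < u \<Longrightarrow> u \<le> v \<Longrightarrow> F v \<le> F u"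
  using F_diff[of u v] set_integral_f_nonneg[of "{u..<v}" "\<lambda>s. s"] by (simp add: subset_iff)

lemma F_continuous: "continuous_on {0<..} F"
  unfolding continuous_on_def
proof
  fix x :: real assume "x \<in> {0<..}"
  hence x: "x > 0" by simp
  have "(F \<longlongrightarrow> F x) (at x within {x/2<..})"
    unfolding tendsto_at_iff_sequentially o_def
  proof (intro allI impI)
    fix X :: "nat \<Rightarrow> real" assume X: "\<forall>i. X i \<in> {x/2<..} - {x}" "X \<longlonglongrightarrow> x"
    show "(\<lambda>i. F (X i)) \<longlonglongrightarrow> F x"
      unfolding F_def set_lebesgue_integral_def
    proof (rule integral_dominated_convergence[where w="\<lambda>s. indicator {x/2..} s *\<^sub>R (s * f s)"])
      show "integrable lborel (\<lambda>s. indicator {x/2..} s *\<^sub>R (s * f s))"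
        using F_int[of "x/2"] x by (simp add: set_integrable_def)
      show "AE s in lborel. (\<lambda>i. indicator {X i..} s *\<^sub>R (s * f s)) \<longlonglongrightarrow> indicator {x..} s *\<^sub>R (s * f s)"
        using AE_lborel_singleton[of x]
      proof eventually_elim
        case (elim s)
        have "eventually (\<lambda>i. indicator {X i..} s = (indicator {x..} s :: real)) sequentially"
        proof (cases "s < x")
          case True
          have "eventually (\<lambda>i. X i > s) sequentially" by (rule order_tendstoD(1)[OF X(2) True])
          thus ?thesis by eventually_elim (use True in auto)
        next
          case False
          hence "x < s" using elim by simp
          have "eventually (\<lambda>i. X i < s) sequentially" by (rule order_tendstoD(2)[OF X(2) \<open>x < s\<close>])
          thus ?thesis by eventually_elim (use \<open>x < s\<close> in auto)
        qed
        hence "eventually (\<lambda>i. indicator {x..} s *\<^sub>R (s * f s) = indicator {X i..} s *\<^sub>R (s * f s)) sequentially"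
          by eventually_elim simp
        thus ?case by (rule Lim_transform_eventually[OF tendsto_const])
      qed
      show "AE s in lborel. norm (indicator {X i..} s *\<^sub>R (s * f s)) \<le> indicator {x/2..} s *\<^sub>R (s * f s)" for i
      proof (intro AE_I2)
        fix s
        have "X i > x / 2" using X by auto
        thus "norm (indicator {X i..} s *\<^sub>R (s * f s)) \<le> indicator {x/2..} s *\<^sub>R (s * f s)"
          using x f_nonneg[of s] by (auto simp: indicator_def intro!: mult_nonneg_nonneg)
      qed
    qed measurable
  qed
  thus "(F \<longlongrightarrow> F x) (at x within {0<..})"
    using x at_within_open[of x "{x/2<..}"] at_within_open[of x "{0<..}"] by simp
qed

text \<open>The difference quotients of \<open>min t R ^ k\<close> vanish in the limit for t < R and
  tend to k R^(k-1) for t > R. The single radius t = R is null, so the derivative exists at every R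
  although f may be discontinuous.\<close>

lemma has_real_derivative_W:
  assumes R: "R > 0" and k: "k \<ge> p - 2"
  shows "(W k has_real_derivative real k * R ^ (k - 1) * F R) (at R)"
proof -
  \<comment> \<open>Keeping X in (R/2, 2R) makes the quotients vanish for t < R/2, where s f s might
    fail to be integrable, and fixes one Lipschitz constant for the powers.\<close>
  have "((\<lambda>X. (W k X - W k R) / (X - R)) \<longlongrightarrow> real k * R ^ (k - 1) * F R) (at R within {R/2<..<2*R})"
    unfolding tendsto_at_iff_sequentially o_def
  proof (intro allI impI)
    fix X :: "nat \<Rightarrow> real" assume X: "\<forall>i. X i \<in> {R/2<..<2*R} - {R}" "X \<longlonglongrightarrow> R"
    have X0: "X i \<ge> 0" "X i > R / 2" "X i < 2 * R" "X i \<noteq> R" for i using X(1) R by (auto dest!: spec[of _ i])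
    define q where "q = (\<lambda>i t. indicator {0<..} t * (t * f t * ((min t (X i) ^ k - min t R ^ k) / (X i - R))))"
    have "(\<lambda>i. LINT t|lborel. q i t) \<longlonglongrightarrow> (LINT t|lborel. real k * R ^ (k - 1) * (indicator {R..} t *\<^sub>R (t * f t)))"
    proof (rule integral_dominated_convergence[where w="\<lambda>t. (real k * (2 * R) ^ (k - 1)) * (indicator {R/2..} t *\<^sub>R (t * f t))"])
      show "integrable lborel (\<lambda>t. (real k * (2 * R) ^ (k - 1)) * (indicator {R/2..} t *\<^sub>R (t * f t)))"
        using F_int[of "R/2"] R by (simp add: set_integrable_def)
      show "AE t in lborel. (\<lambda>i. q i t) \<longlonglongrightarrow> real k * R ^ (k - 1) * (indicator {R..} t *\<^sub>R (t * f t))"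
        using AE_lborel_singleton[of R]
      proof eventually_elim
        case (elim t)
        show ?case
        proof (cases "t < R")
          case True
          have "eventually (\<lambda>i. X i > t) sequentially" by (rule order_tendstoD(1)[OF X(2) True])
          hence "eventually (\<lambda>i. 0 = q i t) sequentially"
            by eventually_elim (use True in \<open>simp add: q_def\<close>)
          hence "(\<lambda>i. q i t) \<longlonglongrightarrow> 0" by (rule Lim_transform_eventually[OF tendsto_const])
          thus ?thesis using True by simp
        next
          case False
          hence t: "R < t" using elim by simp
          have "eventually (\<lambda>i. X i < t) sequentially" by (rule order_tendstoD(2)[OF X(2) t])
          hence ev: "eventually (\<lambda>i. t * f t * ((X i ^ k - R ^ k) / (X i - R)) = q i t) sequentially"
            by eventually_elim (use t R in \<open>simp add: q_def\<close>)
          have "((\<lambda>x. x ^ k) has_real_derivative real k * R ^ (k - 1)) (at R)"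
            using DERIV_pow[of k R UNIV] by simp
          hence "((\<lambda>x. (x ^ k - R ^ k) / (x - R)) \<longlongrightarrow> real k * R ^ (k - 1)) (at R)"
            by (simp add: has_field_derivative_iff)
          hence "(\<lambda>i. (X i ^ k - R ^ k) / (X i - R)) \<longlonglongrightarrow> real k * R ^ (k - 1)"
            by (rule filterlim_compose) (use X(2) X0 in \<open>auto intro!: filterlim_atI\<close>)
          hence "(\<lambda>i. t * f t * ((X i ^ k - R ^ k) / (X i - R))) \<longlonglongrightarrow> t * f t * (real k * R ^ (k - 1))"
            by (intro tendsto_intros)
          from Lim_transform_eventually[OF this ev] show ?thesis using t by (simp add: mult_ac)
        qed
      qed
      show "AE t in lborel. norm (q i t) \<le> (real k * (2 * R) ^ (k - 1)) * (indicator {R/2..} t *\<^sub>R (t * f t))" for i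
      proof (intro AE_I2)
        fix t
        show "norm (q i t) \<le> (real k * (2 * R) ^ (k - 1)) * (indicator {R/2..} t *\<^sub>R (t * f t))"
        proof (cases "t \<ge> R / 2")
          case True
          hence t: "t > 0" using R by simp
          have "\<bar>min t (X i) ^ k - min t R ^ k\<bar> \<le> real k * (2 * R) ^ (k - 1) * \<bar>min t (X i) - min t R\<bar>"
            using t R X0[of i] by (intro abs_power_diff_le) auto
          also have "\<dots> \<le> real k * (2 * R) ^ (k - 1) * \<bar>X i - R\<bar>"
            using R by (intro mult_left_mono) auto
          finally have "\<bar>(min t (X i) ^ k - min t R ^ k) / (X i - R)\<bar> \<le> real k * (2 * R) ^ (k - 1)"
            using X0[of i] by (simp add: abs_divide divide_le_eq)
          hence "\<bar>t * f t\<bar> * \<bar>(min t (X i) ^ k - min t R ^ k) / (X i - R)\<bar> \<le> \<bar>t * f t\<bar> * (real k * (2 * R) ^ (k - 1))"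
            by (intro mult_left_mono) auto
          moreover have "\<bar>t * f t\<bar> = t * f t" using t f_nonneg[of t] by simp
          ultimately show ?thesis using True t by (simp add: q_def abs_mult mult_ac)
        next
          case False
          hence "q i t = 0" using X0[of i] R by (simp add: q_def)
          thus ?thesis using False by simp
        qed
      qed
    qed (simp_all add: q_def)
    moreover have "(LINT t|lborel. q i t) = (W k (X i) - W k R) / (X i - R)" for i
    proof -
      have "W k (X i) - W k R = (LINT t:{0<..}|lborel. t * f t * min t (X i) ^ k - t * f t * min t R ^ k)"
        unfolding W_def using R X0[of i] by (intro set_integral_diff(2)[symmetric] W_int k) auto
      hence "(W k (X i) - W k R) / (X i - R) = (LINT t:{0<..}|lborel. (t * f t * min t (X i) ^ k - t * f t * min t R ^ k) / (X i - R))"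
        by simp
      also have "\<dots> = (LINT t|lborel. q i t)"
        unfolding set_lebesgue_integral_def q_def
        by (intro Bochner_Integration.integral_cong) (auto simp: right_diff_distrib)
      finally show ?thesis ..
    qed
    ultimately show "(\<lambda>i. (W k (X i) - W k R) / (X i - R)) \<longlonglongrightarrow> real k * R ^ (k - 1) * F R"
      by (simp add: F_def set_lebesgue_integral_def)
  qed
  thus ?thesis using R at_within_open[of R "{R/2<..<2*R}"] by (simp add: has_field_derivative_iff)
qed

lemma W_le:
  assumes R: "R > 0"
  shows "W p R \<le> R\<^sup>2 * W (p - 2) R"
proof -
  have "W p R \<le> (LINT t:{0<..}|lborel. R\<^sup>2 * (t * f t * min t R ^ (p - 2)))"
    unfolding W_def
  proof (rule set_integral_mono)
    fix t :: real assume "t \<in> {0<..}"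
    hence t: "t > 0" by simp
    have "min t R ^ p = (min t R)\<^sup>2 * min t R ^ (p - 2)" using p_ge by (intro power_split) simp
    also have "\<dots> \<le> R\<^sup>2 * min t R ^ (p - 2)" using t R by (intro mult_right_mono power_mono) auto
    finally have "t * f t * min t R ^ p \<le> t * f t * (R\<^sup>2 * min t R ^ (p - 2))"
      using t f_nonneg[of t] by (intro mult_left_mono) auto
    thus "t * f t * min t R ^ p \<le> R\<^sup>2 * (t * f t * min t R ^ (p - 2))" by (simp add: mult_ac)
  qed (use R W_int in auto)
  thus ?thesis unfolding W_def by simp
qed

lemma W_pos:
  assumes R: "R > 0" and k: "k \<ge> p - 2"
  shows "W k R > 0"
proof (rule ccontr)
  assume "\<not> W k R > 0"
  moreover have "W k R \<ge> 0" unfolding W_def using R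
    set_integral_f_nonneg[of "{0<..}" "\<lambda>t. t * min t R ^ k"] by (simp add: mult_ac)
  ultimately have "W k R = 0" by simp
  hence "(LINT t|lborel. indicator {0<..} t *\<^sub>R (t * f t * min t R ^ k)) = 0"
    by (simp add: W_def set_lebesgue_integral_def)
  moreover have "integrable lborel (\<lambda>t. indicator {0<..} t *\<^sub>R (t * f t * min t R ^ k))"
    using W_int[OF k, of R] R by (simp add: set_integrable_def)
  ultimately have "AE t in lborel. indicator {0<..} t *\<^sub>R (t * f t * min t R ^ k) = 0"
    using R f_nonneg by (subst (asm) integral_nonneg_eq_0_iff_AE) (auto simp: indicator_def)
  hence "AE t in lborel. indicator {0<..} t *\<^sub>R (t ^ (p - 1) * f t) = 0"
    by eventually_elim (use R in \<open>auto simp: indicator_def min_def split: if_splits\<close>)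
  hence "(LINT t:{0<..}|lborel. t ^ (p - 1) * f t) = 0"
    unfolding set_lebesgue_integral_def by (subst integral_cong_AE[where g="\<lambda>_. 0"]) auto
  thus False using mass_pos by simp
qed

lemma A_pos: "R > 0 \<Longrightarrow> A R > 0" and B_pos: "R > 0 \<Longrightarrow> B R > 0"
  using W_pos[of R p] W_pos[of R "p - 2"] p_ge by (auto simp: A_def B_def)

lemma has_real_derivative_A: "R > 0 \<Longrightarrow> (A has_real_derivative R ^ (p - 1) * F R) (at R)"
  using DERIV_cdivide[OF has_real_derivative_W[of R p], of "real p"] p_ge by (simp add: A_def[abs_def])

lemma has_real_derivative_B: "R > 0 \<Longrightarrow> (B has_real_derivative R ^ (p - 3) * F R) (at R)"
  using DERIV_cdivide[OF has_real_derivative_W[of R "p - 2"], of "real p - 2"] p_ge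
  by (simp add: B_def[abs_def] of_nat_diff numeral_eq_Suc)

lemma A_le: "R > 0 \<Longrightarrow> A R \<le> R\<^sup>2 * B R"
proof -
  assume R: "R > 0"
  have "A R \<le> W p R / (real p - 2)" unfolding A_def using W_pos[OF R, of p] p_ge
    by (intro divide_left_mono) auto
  also have "\<dots> \<le> R\<^sup>2 * B R" unfolding B_def using W_le[OF R] p_ge by (simp add: divide_right_mono)
  finally show ?thesis .
qed

lemma phi_pos: "R > 0 \<Longrightarrow> \<phi> R > 0"
  using A_pos B_pos by (simp add: \<phi>_def)

lemma phi_le: "R > 0 \<Longrightarrow> \<phi> R \<le> R\<^sup>2"
  using A_le[of R] B_pos[of R] by (simp add: \<phi>_def divide_le_eq)

lemma psi_pos: "R > 0 \<Longrightarrow> \<psi> R > 0"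
  using phi_pos by (simp add: \<psi>_def)

lemma psi_le: "R > 0 \<Longrightarrow> \<psi> R \<le> 1"
  using phi_le[of R] by (simp add: \<psi>_def)

lemma has_real_derivative_phi:
  assumes R: "R > 0"
  shows "(\<phi> has_real_derivative \<phi>' R) (at R)"
proof -
  have "(\<phi> has_real_derivative (R ^ (p - 1) * F R * B R - A R * (R ^ (p - 3) * F R)) / (B R * B R)) (at R)"
    unfolding \<phi>_def[abs_def]
    by (rule DERIV_divide[OF has_real_derivative_A[OF R] has_real_derivative_B[OF R]]) (use B_pos[OF R] in auto)
  also have "(R ^ (p - 1) * F R * B R - A R * (R ^ (p - 3) * F R)) / (B R * B R) = \<phi>' R"
  proof -
    have "R ^ (p - 1) = R ^ (p - 3) * R\<^sup>2" using p_ge by (intro power_split) simp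
    thus ?thesis unfolding \<phi>'_def \<phi>_def using B_pos[OF R] by (simp add: field_simps)
  qed
  finally show ?thesis .
qed

lemma phi'_nonneg: "R > 0 \<Longrightarrow> \<phi>' R \<ge> 0"
  using F_nonneg[of R] phi_le[of R] B_pos[of R] by (simp add: \<phi>'_def)

lemma phi_mono: "0 < r \<Longrightarrow> r \<le> s \<Longrightarrow> \<phi> r \<le> \<phi> s"
  by (rule DERIV_nonneg_imp_nondecreasing[of r s \<phi>])
     (meson has_real_derivative_phi phi'_nonneg less_le_trans)+

lemma has_real_derivative_psi:
  assumes R: "R > 0"
  shows "(\<psi> has_real_derivative \<psi>' R) (at R)"
  unfolding \<psi>_def[abs_def] \<psi>'_def using R
  by (auto intro!: derivative_eq_intros has_real_derivative_phi simp: field_simps power2_eq_square power3_eq_cube)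

lemma continuous_on_phi: "continuous_on {0<..} \<phi>"
  by (rule DERIV_continuous_on[where D="\<phi>'"]) (rule has_field_derivative_at_within, rule has_real_derivative_phi, simp)

lemma continuous_on_B: "continuous_on {0<..} B"
  by (rule DERIV_continuous_on[where D="\<lambda>R. R ^ (p - 3) * F R"])
     (rule has_field_derivative_at_within, rule has_real_derivative_B, simp)

lemma continuous_on_phi': "continuous_on {0<..} \<phi>'"
proof -
  have "\<forall>R\<in>{0<..}. B R \<noteq> 0" using B_pos by (metis greaterThan_iff less_irrefl)
  thus ?thesis unfolding \<phi>'_def[abs_def]
    by (intro continuous_on_divide continuous_on_mult continuous_on_diff continuous_on_power continuous_on_id F_continuous continuous_on_phi continuous_on_B)
qed

lemma continuous_on_psi': "continuous_on {0<..} \<psi>'"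
  unfolding \<psi>'_def[abs_def]
  by (intro continuous_on_divide continuous_on_mult continuous_on_diff continuous_on_power continuous_on_id continuous_on_const continuous_on_phi continuous_on_phi') auto

lemma continuous_on_kappa: "continuous_on {0<..} \<kappa>"
proof -
  have "\<forall>R\<in>{0<..}. B R \<noteq> 0" using B_pos by (metis greaterThan_iff less_irrefl)
  thus ?thesis unfolding \<kappa>_def[abs_def]
    by (intro continuous_on_divide continuous_on_mult continuous_on_diff continuous_on_power continuous_on_id continuous_on_const F_continuous continuous_on_phi continuous_on_B)
qed

lemma psi'_eq_kappa:
  assumes R: "R > 0"
  shows "\<psi>' R = - \<kappa> R * inverse (R ^ (p - 1))"
proof -
  define n where "n = p - 4"
  have n: "p = n + 4" using p_ge by (simp add: n_def)
  have e: "p - 1 = n + 3" "p - 2 = n + 2" "p - 3 = n + 1" "p - 4 = n" using n by auto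
  show ?thesis unfolding \<psi>'_def \<phi>'_def \<kappa>_def e using R B_pos[OF R]
    by (simp add: field_simps power_add power2_eq_square power3_eq_cube)
qed

text \<open>The right side is the divergence of \<psi> \<parallel>x\<parallel> x and equals (p - 2)
  \<psi> + \<phi>' / R, so the claim is \<phi>' \<ge> 0. This is the hypothesis of
  \<open>flux_lower_bound\<close> with c = p - 2.\<close>

lemma psi_flux_ineq: "R > 0 \<Longrightarrow> (real p - 2) * \<psi> R \<le> real p * \<psi> R + R * \<psi>' R"
  using phi'_nonneg[of R] by (simp add: \<psi>_def \<psi>'_def field_simps power2_eq_square power3_eq_cube)

lemma square_psi: "R > 0 \<Longrightarrow> R\<^sup>2 * \<psi> R = \<phi> R"
  by (simp add: \<psi>_def)

text \<open>\<phi> is nondecreasing, and as R grows the truncations in \<open>W\<close> disappear;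
  the bound is the limit of A / B.\<close>

lemma phi_le_limit:
  assumes int: "set_integrable lborel {0<..} (\<lambda>t. t ^ (p + 1) * f t)" and R: "R > 0"
  shows "\<phi> R \<le> (real p - 2) / real p * ((LINT t:{0<..}|lborel. t ^ (p + 1) * f t) / (LINT t:{0<..}|lborel. t ^ (p - 1) * f t))"
proof -
  have lim: "(\<lambda>n. W k (real n)) \<longlonglongrightarrow> (LINT t:{0<..}|lborel. t * f t * t ^ k)"
    if i: "set_integrable lborel {0<..} (\<lambda>t. t * f t * t ^ k)" for k
    unfolding W_def set_lebesgue_integral_def
  proof (rule integral_dominated_convergence[where w="\<lambda>t. indicator {0<..} t *\<^sub>R (t * f t * t ^ k)"])
    show "integrable lborel (\<lambda>t. indicator {0<..} t *\<^sub>R (t * f t * t ^ k))" using i by (simp add: set_integrable_def)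
    show "AE t in lborel. (\<lambda>n. indicator {0<..} t *\<^sub>R (t * f t * min t (real n) ^ k)) \<longlonglongrightarrow> indicator {0<..} t *\<^sub>R (t * f t * t ^ k)"
    proof (rule AE_I2)
      fix t
      have "eventually (\<lambda>n. t \<le> real n) sequentially"
        using filterlim_real_sequentially by (auto simp: filterlim_at_top)
      hence "eventually (\<lambda>n. indicator {0<..} t *\<^sub>R (t * f t * t ^ k) = indicator {0<..} t *\<^sub>R (t * f t * min t (real n) ^ k)) sequentially"
        by eventually_elim (simp add: min_absorb1)
      thus "(\<lambda>n. indicator {0<..} t *\<^sub>R (t * f t * min t (real n) ^ k)) \<longlonglongrightarrow> indicator {0<..} t *\<^sub>R (t * f t * t ^ k)"
        by (rule Lim_transform_eventually[OF tendsto_const])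
    qed
    show "AE t in lborel. norm (indicator {0<..} t *\<^sub>R (t * f t * min t (real n) ^ k)) \<le> indicator {0<..} t *\<^sub>R (t * f t * t ^ k)" for n
    proof (rule AE_I2)
      fix t
      show "norm (indicator {0<..} t *\<^sub>R (t * f t * min t (real n) ^ k)) \<le> indicator {0<..} t *\<^sub>R (t * f t * t ^ k)"
      proof (cases "t > 0")
        case True
        have "min t (real n) ^ k \<le> t ^ k" using True by (intro power_mono) auto
        hence "t * f t * min t (real n) ^ k \<le> t * f t * t ^ k"
          using True f_nonneg[of t] by (intro mult_left_mono) auto
        moreover have "0 \<le> t * f t * min t (real n) ^ k" using True f_nonneg[of t] by simp
        ultimately show ?thesis using True by simp
      qed simp
    qed
  qed measurable
  have e1: "t * f t * t ^ p = t ^ (p + 1) * f t" for t by simp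
  have e2: "t * f t * t ^ (p - 2) = t ^ (p - 1) * f t" for t
  proof -
    have "p - 1 = Suc (p - 2)" using p_ge by simp
    thus ?thesis by simp
  qed
  let ?I2 = "LINT t:{0<..}|lborel. t ^ (p + 1) * f t" and ?I = "LINT t:{0<..}|lborel. t ^ (p - 1) * f t"
  have "(\<lambda>n. W p (real n)) \<longlonglongrightarrow> ?I2" using lim[of p] int by (simp only: e1)
  moreover have "(\<lambda>n. W (p - 2) (real n)) \<longlonglongrightarrow> ?I" using lim[of "p - 2"] mass_int by (simp only: e2)
  ultimately have "(\<lambda>n. (W p (real n) / real p) / (W (p - 2) (real n) / (real p - 2))) \<longlonglongrightarrow> (?I2 / real p) / (?I / (real p - 2))"
    using mass_pos p_ge by (intro tendsto_intros) auto
  hence L: "(\<lambda>n. \<phi> (real n)) \<longlonglongrightarrow> (?I2 / real p) / (?I / (real p - 2))" by (simp add: \<phi>_def A_def B_def)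
  have "\<phi> R \<le> (?I2 / real p) / (?I / (real p - 2))"
  proof (rule tendsto_lowerbound[OF L])
    have "eventually (\<lambda>n. R \<le> real n) sequentially"
      using filterlim_real_sequentially by (auto simp: filterlim_at_top)
    thus "eventually (\<lambda>n. \<phi> R \<le> \<phi> (real n)) sequentially"
      by eventually_elim (rule phi_mono[OF R])
  qed simp
  thus ?thesis by (simp add: mult_ac)
qed

section \<open>Moments of \<open>f\<close> truncated at \<open>R\<close>, and moments of
  \<open>F\<close>\<close>

definition L :: "nat \<Rightarrow> real \<Rightarrow> real" where
  "L k R = (LINT t:{0<..<R}|lborel. t ^ (k + 1) * f t)"

lemma L_int:
  assumes k: "k \<ge> p - 2" and R: "R > 0"
  shows "set_integrable lborel {0<..<R} (\<lambda>t. t ^ (k + 1) * f t)"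
proof (rule set_integrable_bounded_by_mass[where c="R ^ (k - (p - 2))"])
  fix t assume "t \<in> {0<..<R}"
  hence t: "0 < t" "t < R" by auto
  have "t ^ (k + 1) = t ^ (k - (p - 2)) * t ^ (p - 1)" using k p_ge by (intro power_split) simp
  also have "\<dots> \<le> R ^ (k - (p - 2)) * t ^ (p - 1)" using t by (intro mult_right_mono power_mono) auto
  finally have "t ^ (k + 1) * f t \<le> R ^ (k - (p - 2)) * t ^ (p - 1) * f t"
    using t f_nonneg[of t] by (intro mult_right_mono) auto
  thus "\<bar>t ^ (k + 1) * f t\<bar> \<le> R ^ (k - (p - 2)) * (t ^ (p - 1) * f t)"
    using t f_nonneg[of t] by (simp add: abs_mult mult.assoc)
qed auto

text \<open>Splitting at \<open>R\<close> isolates the boundary term \<open>R ^ k * F R\<close>;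
  this is integration by parts without differentiating \<open>F\<close>.\<close>

lemma W_eq_L:
  assumes k: "k \<ge> p - 2" and R: "R > 0"
  shows "W k R = L k R + R ^ k * F R"
proof -
  have e: "{0<..} = {0<..<R} \<union> {R..}" using R by auto
  have "W k R = (LINT t:{0<..<R}|lborel. t * f t * min t R ^ k) + (LINT t:{R..}|lborel. t * f t * min t R ^ k)"
    unfolding W_def e using W_int[OF k, of R] R
    by (intro set_integral_Un) (auto simp: e elim: set_integrable_subset)
  also have "(LINT t:{0<..<R}|lborel. t * f t * min t R ^ k) = L k R"
    unfolding L_def by (intro set_lebesgue_integral_cong) auto
  also have "(LINT t:{R..}|lborel. t * f t * min t R ^ k) = (LINT t:{R..}|lborel. R ^ k * (t * f t))"
    by (intro set_lebesgue_integral_cong) (auto simp: min_absorb2)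
  finally show ?thesis by (simp add: F_def)
qed

lemma F_measurable_on: "(\<lambda>s. indicator {0<..} s * F s) \<in> borel_measurable borel"
  using borel_measurable_continuous_on_indicator[OF _ F_continuous] by simp

text \<open>Since k s^(k-1) integrates to \<open>min t R ^ k\<close> over the points s < R with s
  \<le> t, Tonelli turns the integral of F into \<open>W\<close>.\<close>

lemma W_tail:
  assumes k: "k \<ge> p - 2" and R: "R > 0"
  shows "set_integrable lborel {0<..<R} (\<lambda>s. s ^ (k - 1) * F s)"
    and "real k * (LINT s:{0<..<R}|lborel. s ^ (k - 1) * F s) = W k R"
proof -
  have k0: "k > 0" using k p_ge by simp
  define g where "g = (\<lambda>s. ennreal (1 * real k * s ^ (k - 1)) * indicator {..<R} s)"
  have inner: "(\<integral>\<^sup>+s\<in>{0<..t}. g s \<partial>lborel) = ennreal (min t R ^ k)" if t: "t > 0" for t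
  proof -
    have "(\<integral>\<^sup>+s\<in>{0<..t}. g s \<partial>lborel) = (\<integral>\<^sup>+ s. ennreal (1 * real k * s ^ (k - 1)) * indicator {0..min t R} s \<partial>lborel)"
      using AE_lborel_singleton[of "0::real"] AE_lborel_singleton[of R]
      by (intro nn_integral_cong_AE) (auto simp: g_def indicator_def)
    also have "\<dots> = ennreal (1 * min t R ^ k)"
      using t R k0 by (intro nn_integral_power_Icc) auto
    finally show ?thesis by simp
  qed
  have m: "(\<lambda>s. indicator {0<..<R} s *\<^sub>R (real k * (s ^ (k - 1) * F s))) \<in> borel_measurable lborel"
  proof -
    have [measurable]: "(\<lambda>s. indicator {0<..} s * F s) \<in> borel_measurable borel" by (rule F_measurable_on)
    have "(\<lambda>s. indicator {..<R} s * (real k * (s ^ (k - 1) * (indicator {0<..} s * F s)))) \<in> borel_measurable lborel"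
      by measurable
    also have "(\<lambda>s. indicator {..<R} s * (real k * (s ^ (k - 1) * (indicator {0<..} s * F s)))) = (\<lambda>s. indicator {0<..<R} s *\<^sub>R (real k * (s ^ (k - 1) * F s)))"
      by (auto simp: indicator_def)
    finally show ?thesis .
  qed
  have "(\<integral>\<^sup>+ s. ennreal (indicator {0<..<R} s *\<^sub>R (real k * (s ^ (k - 1) * F s))) \<partial>lborel) = (\<integral>\<^sup>+s\<in>{0<..}. g s * tail_int f s \<partial>lborel)"
    by (intro nn_integral_cong) (auto simp: g_def indicator_def tail_int_eq F_nonneg simp flip: ennreal_mult' ennreal_mult'' mult.assoc)
  also have "\<dots> = (\<integral>\<^sup>+t\<in>{0<..}. ennreal (t * f t) * (\<integral>\<^sup>+s\<in>{0<..t}. g s \<partial>lborel) \<partial>lborel)"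
    by (rule nn_integral_tail_int[symmetric]) (auto simp: g_def)
  also have "\<dots> = (\<integral>\<^sup>+t. ennreal (indicator {0<..} t *\<^sub>R (t * f t * min t R ^ k)) \<partial>lborel)"
  proof (intro nn_integral_cong)
    fix t :: real
    show "ennreal (t * f t) * (\<integral>\<^sup>+s\<in>{0<..t}. g s \<partial>lborel) * indicator {0<..} t = ennreal (indicator {0<..} t *\<^sub>R (t * f t * min t R ^ k))"
    proof (cases "t > 0")
      case True
      thus ?thesis using R f_nonneg[of t] by (simp add: inner ennreal_mult)
    qed simp
  qed
  also have "\<dots> = ennreal (W k R)"
    unfolding W_def set_lebesgue_integral_def using W_int[OF k, of R] R f_nonneg
    by (intro nn_integral_eq_integral) (auto simp: set_integrable_def indicator_def)
  finally have "has_bochner_integral lborel (\<lambda>s. indicator {0<..<R} s *\<^sub>R (real k * (s ^ (k - 1) * F s))) (W k R)"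
    using W_pos[OF R k] F_nonneg by (intro has_bochner_integral_nn_integral m) (auto simp: indicator_def)
  note hb = this[unfolded has_bochner_integral_iff]
  have "set_integrable lborel {0<..<R} (\<lambda>s. real k * (s ^ (k - 1) * F s))"
    using hb unfolding set_integrable_def by (rule conjunct1)
  thus "set_integrable lborel {0<..<R} (\<lambda>s. s ^ (k - 1) * F s)" using k0 by simp
  have "(LINT s:{0<..<R}|lborel. real k * (s ^ (k - 1) * F s)) = W k R"
    using hb unfolding set_lebesgue_integral_def by (rule conjunct2)
  thus "real k * (LINT s:{0<..<R}|lborel. s ^ (k - 1) * F s) = W k R" by simp
qed

lemma A_tail: "R > 0 \<Longrightarrow> set_integrable lborel {0<..<R} (\<lambda>s. s ^ (p - 1) * F s)"
    "R > 0 \<Longrightarrow> (LINT s:{0<..<R}|lborel. s ^ (p - 1) * F s) = A R"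
  using W_tail[of p R] p_ge by (auto simp: A_def field_simps)

lemma B_tail: "R > 0 \<Longrightarrow> set_integrable lborel {0<..<R} (\<lambda>s. s ^ (p - 3) * F s)"
    "R > 0 \<Longrightarrow> (LINT s:{0<..<R}|lborel. s ^ (p - 3) * F s) = B R"
proof -
  have e: "p - 2 - 1 = p - 3" "real (p - 2) = real p - 2" "real p - 2 \<noteq> 0" using p_ge by auto
  assume R: "R > 0"
  show "set_integrable lborel {0<..<R} (\<lambda>s. s ^ (p - 3) * F s)"
    using W_tail(1)[of "p - 2" R] R unfolding e by simp
  show "(LINT s:{0<..<R}|lborel. s ^ (p - 3) * F s) = B R"
    using W_tail(2)[of "p - 2" R] R e(3) unfolding e(1,2) B_def by (simp add: eq_divide_eq mult.commute)
qed

lemma L_nonneg: "R > 0 \<Longrightarrow> L k R \<ge> 0"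
  unfolding L_def by (rule set_integral_f_nonneg) auto

lemma L_le:
  assumes R: "R > 0"
  shows "L p R \<le> R\<^sup>2 * L (p - 2) R"
proof -
  have "L p R \<le> (LINT t:{0<..<R}|lborel. R\<^sup>2 * (t ^ (p - 2 + 1) * f t))"
    unfolding L_def
  proof (rule set_integral_mono)
    fix t assume "t \<in> {0<..<R}"
    hence t: "0 < t" "t < R" by auto
    have "t ^ (p + 1) = t\<^sup>2 * t ^ (p - 2 + 1)" using p_ge by (intro power_split) simp
    also have "\<dots> \<le> R\<^sup>2 * t ^ (p - 2 + 1)" using t by (intro mult_right_mono power_mono) auto
    finally have "t ^ (p + 1) * f t \<le> R\<^sup>2 * t ^ (p - 2 + 1) * f t"
      using t f_nonneg[of t] by (intro mult_right_mono) auto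
    thus "t ^ (p + 1) * f t \<le> R\<^sup>2 * (t ^ (p - 2 + 1) * f t)" by (simp only: mult.assoc)
  qed (use L_int R in auto)
  thus ?thesis unfolding L_def by simp
qed

end

text \<open>Monotonicity of t^(-2) F / f cleared of denominators, so that it makes sense where f or
  F vanishes.\<close>

locale radial_profile_ratio = radial_profile +
  assumes ratio: "\<And>s t. 0 < s \<Longrightarrow> s < t \<Longrightarrow> s\<^sup>2 * f s * F t \<le> t\<^sup>2 * f t * F s"
begin

text \<open>For t < r the ratio condition reads t^2 f t \<le> k F t with k = r^2 f r / F r;
  integrating against t^(p-1) gives \<open>K2 \<le> k\<close> of
  \<open>kappa_key_inequality\<close>.\<close>

lemma L_le_A:
  assumes r: "r > 0" and Fr: "F r > 0"
  shows "L p r \<le> r\<^sup>2 * f r / F r * A r"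
proof -
  have "L p r \<le> (LINT t:{0<..<r}|lborel. r\<^sup>2 * f r / F r * (t ^ (p - 1) * F t))"
    unfolding L_def
  proof (rule set_integral_mono)
    fix t assume "t \<in> {0<..<r}"
    hence t: "0 < t" "t < r" by auto
    have "t\<^sup>2 * f t \<le> r\<^sup>2 * f r / F r * F t" using ratio[OF t] Fr by (simp add: field_simps)
    hence "t ^ (p - 1) * (t\<^sup>2 * f t) \<le> t ^ (p - 1) * (r\<^sup>2 * f r / F r * F t)"
      using t by (intro mult_left_mono) auto
    moreover have "t ^ (p + 1) = t ^ (p - 1) * t\<^sup>2" using p_ge by (intro power_split) simp
    ultimately show "t ^ (p + 1) * f t \<le> r\<^sup>2 * f r / F r * (t ^ (p - 1) * F t)" by (simp only: mult_ac)
  next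
    show "set_integrable lborel {0<..<r} (\<lambda>t. r\<^sup>2 * f r / F r * (t ^ (p - 1) * F t))"
      using A_tail(1)[OF r] by (rule set_integrable_mult_right)
  qed (use L_int r in auto)
  thus ?thesis using A_tail(2)[OF r] by simp
qed

text \<open>Chebyshev with weights s^(p-3) F and s^(p-1) f, whose quotient s^2 f / F is
  nondecreasing by the ratio condition, against the function s^2. In the notation of
  \<open>kappa_key_inequality\<close> it says \<open>K1 \<le> K2\<close>.\<close>

lemma L_A_le_L_B:
  assumes r: "r > 0"
  shows "L (p - 2) r * A r \<le> L p r * B r"
proof -
  let ?a = "\<lambda>s. indicator {0<..<r} s *\<^sub>R (s ^ (p - 3) * F s)"
  let ?b = "\<lambda>s. indicator {0<..<r} s *\<^sub>R (s ^ (p - 2 + 1) * f s)"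
  have ea: "?a s * s\<^sup>2 = indicator {0<..<r} s *\<^sub>R (s ^ (p - 1) * F s)" for s
  proof -
    have "s ^ (p - 1) = s ^ (p - 3) * s\<^sup>2" using p_ge by (intro power_split) simp
    thus ?thesis by (simp only: mult_ac real_scaleR_def)
  qed
  have eb: "?b s * s\<^sup>2 = indicator {0<..<r} s *\<^sub>R (s ^ (p + 1) * f s)" for s
  proof -
    have "s ^ (p + 1) = s ^ (p - 2 + 1) * s\<^sup>2" using p_ge by (intro power_split) simp
    thus ?thesis by (simp only: mult_ac real_scaleR_def)
  qed
  have "(\<integral>x. ?b x \<partial>lborel) * (\<integral>x. ?a x * x\<^sup>2 \<partial>lborel) \<le> (\<integral>x. ?b x * x\<^sup>2 \<partial>lborel) * (\<integral>x. ?a x \<partial>lborel)"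
  proof (rule chebyshev_integral_inequality)
    show "integrable lborel ?a" using B_tail(1)[OF r] unfolding set_integrable_def .
    show "integrable lborel ?b" using L_int[of "p - 2" r] r unfolding set_integrable_def by simp
    show "integrable lborel (\<lambda>x. ?a x * x\<^sup>2)" using A_tail(1)[OF r] unfolding set_integrable_def ea .
    show "integrable lborel (\<lambda>x. ?b x * x\<^sup>2)" using L_int[of p r] r unfolding set_integrable_def eb by simp
    fix s t :: real
    show "0 \<le> (?b s * ?a t - ?b t * ?a s) * (s\<^sup>2 - t\<^sup>2)"
    proof (cases "s \<in> {0<..<r} \<and> t \<in> {0<..<r}")
      case True
      have e: "x ^ (p - 2 + 1) = x ^ (p - 3) * x\<^sup>2" for x :: real using p_ge by (intro power_split) simp
      have "(?b s * ?a t - ?b t * ?a s) * (s\<^sup>2 - t\<^sup>2) = (s ^ (p - 3) * t ^ (p - 3)) * ((s\<^sup>2 * f s * F t - t\<^sup>2 * f t * F s) * (s\<^sup>2 - t\<^sup>2))"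
        unfolding e using True by (simp add: algebra_simps)
      moreover have "0 \<le> (s\<^sup>2 * f s * F t - t\<^sup>2 * f t * F s) * (s\<^sup>2 - t\<^sup>2)"
      proof (cases s t rule: linorder_cases)
        case less
        hence "s\<^sup>2 \<le> t\<^sup>2" using True by (intro power_mono) auto
        thus ?thesis using ratio[of s t] less True by (intro mult_nonpos_nonpos) auto
      next
        case greater
        hence "t\<^sup>2 \<le> s\<^sup>2" using True by (intro power_mono) auto
        thus ?thesis using ratio[of t s] greater True by (intro mult_nonneg_nonneg) auto
      qed simp
      ultimately show ?thesis using True by (simp only: mult_nonneg_nonneg zero_le_power greaterThanLessThan_iff less_imp_le)
    qed auto
  qed
  thus ?thesis unfolding ea eb using A_tail(2)[OF r] B_tail(2)[OF r]
    by (simp only: L_def set_lebesgue_integral_def)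
qed

text \<open>On [r, s] the ratio condition gives x f x \<ge> k F x / x \<ge> k F s / s, and
  integrating bounds F r - F s. The result is a majorant of F to the right of r that touches F at r
  and is differentiable there.\<close>

lemma F_upper:
  assumes r: "r > 0" and Fr: "F r > 0" and s: "s \<ge> r"
  shows "F s * (1 + r\<^sup>2 * f r / F r * (s - r) / s) \<le> F r"
proof -
  let ?k = "r\<^sup>2 * f r / F r"
  have k: "?k \<ge> 0" using f_nonneg[of r] r Fr by simp
  have "(LINT x:{r..<s}|lborel. ?k * F s / s) \<le> (LINT x:{r..<s}|lborel. x * f x)"
  proof (rule set_integral_mono)
    fix x assume "x \<in> {r..<s}"
    hence x: "r \<le> x" "x < s" by auto
    have "r\<^sup>2 * f r * F x \<le> x\<^sup>2 * f x * F r"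
      using ratio[of r x] x r by (cases "x = r") auto
    hence "?k * F x \<le> x\<^sup>2 * f x" using Fr by (simp add: field_simps)
    moreover have "?k * F s \<le> ?k * F x" using F_antimono[of x s] x r k by (intro mult_left_mono) auto
    ultimately have a: "?k * F s \<le> x\<^sup>2 * f x" by linarith
    have "0 \<le> ?k * F s" using x r by (intro mult_nonneg_nonneg k F_nonneg) auto
    hence "?k * F s / s \<le> ?k * F s / x" using x r by (intro divide_left_mono) auto
    also have "\<dots> \<le> x\<^sup>2 * f x / x" using a x r by (intro divide_right_mono) auto
    also have "\<dots> = x * f x" using x r by (simp add: power2_eq_square)
    finally show "?k * F s / s \<le> x * f x" .
  next
    show "set_integrable lborel {r..<s} (\<lambda>x. x * f x)"
      by (rule set_integrable_subset[OF F_int[OF r]]) auto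
    show "set_integrable lborel {r..<s} (\<lambda>x. ?k * F s / s)"
      unfolding set_integrable_def using s by (intro integrable_scaleR_left integrable_real_indicator) (auto simp: emeasure_lborel_Ico)
  qed
  also have "\<dots> = F r - F s" using F_diff[OF r s] by simp
  also have "(LINT x:{r..<s}|lborel. ?k * F s / s) = (s - r) * (?k * F s / s)"
    using s by (simp add: set_lebesgue_integral_def)
  finally show ?thesis by (simp add: algebra_simps)
qed

lemma kappa_mono:
  assumes "0 < x" "x \<le> y"
  shows "\<kappa> x \<le> \<kappa> y"
proof (rule dini_mono[OF continuous_on_kappa _ assms])
  fix r :: real assume r: "r > 0"
  define n where "n = p - 4"
  have n: "p - 4 = n" "p - 3 = n + 1" "p - 2 = n + 2" "real p = real n + 4" using p_ge by (auto simp: n_def)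
  have pn: "p = n + 4" using p_ge by (simp add: n_def)
  have kap: "\<kappa> = (\<lambda>s. s ^ n * (2 * \<phi> s - s ^ (n + 2) * F s * (s\<^sup>2 - \<phi> s) / B s))"
    unfolding \<kappa>_def n ..
  have dn: "((\<lambda>s. s ^ j) has_real_derivative real j * r ^ j / r) (at r)" for j
  proof (cases j)
    case (Suc i)
    thus ?thesis using DERIV_pow[of j r UNIV] r by simp
  qed simp
  have phi: "\<phi> r > 0" "\<phi> r \<le> r\<^sup>2" and B: "B r > 0" and A: "A r > 0" using phi_pos phi_le B_pos A_pos r by auto
  show "\<exists>g d. g r = \<kappa> r \<and> (\<forall>s\<ge>r. g s \<le> \<kappa> s) \<and> (g has_real_derivative d) (at r) \<and> 0 \<le> d"
  proof (cases "F r = 0")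
    \<comment> \<open>\<open>F\<close> then vanishes beyond \<open>r\<close>, and
      \<open>\<kappa>\<close> is there a product of nondecreasing functions.\<close>
    case True
    have F0: "F s = 0" if "s \<ge> r" for s using F_antimono[OF r that] F_nonneg[of s] r that True by simp
    have d: "((\<lambda>s. s ^ n * (2 * \<phi> s)) has_real_derivative (real n * r ^ n / r * (2 * \<phi> r) + (2 * \<phi>' r) * r ^ n)) (at r)"
      by (rule DERIV_mult[OF dn DERIV_cmult[OF has_real_derivative_phi[OF r]]])
    show ?thesis
      by (rule exI[of _ "\<lambda>s. s ^ n * (2 * \<phi> s)"], rule exI, intro conjI, simp add: kap True,
          simp add: kap F0, rule d) (use r phi phi'_nonneg[OF r] in auto)
  next
    case False
    hence Fr: "F r > 0" using F_nonneg[OF r] by simp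
    define k where "k = r\<^sup>2 * f r / F r"
    have k: "k \<ge> 0" using f_nonneg[of r] r Fr by (simp add: k_def)
    \<comment> \<open>The majorant of \<open>F\<close> from \<open>F_upper\<close>. As
      \<open>F\<close> enters \<open>\<kappa>\<close> with a nonpositive coefficient, substituting
      \<open>Ft\<close> gives the minorant \<open>g\<close> that \<open>dini_mono\<close> asks
      for.\<close>
    define Ft where "Ft = (\<lambda>s. F r / (1 + k * (s - r) / s))"
    \<comment> \<open>\<open>b\<close> is r B' / B at r. The derivatives of \<open>B\<close>,
      \<open>\<phi>\<close> and \<open>C\<close> are simple multiples of it, so that no power of r
      is left in the sign question.\<close>
    define b where "b = r ^ (n + 2) * F r / B r"
    define C where "C = (\<lambda>s. s ^ (n + 2) * Ft s / B s)"
    define g where "g = (\<lambda>s. s ^ n * (2 * \<phi> s - C s * (s\<^sup>2 - \<phi> s)))"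
    have Ftr: "Ft r = F r" by (simp add: Ft_def)
    have Cr: "C r = b" by (simp add: C_def Ftr b_def)
    have le: "F s \<le> Ft s" if "s \<ge> r" for s
    proof -
      have "1 + k * (s - r) / s > 0" using k that r by (intro add_pos_nonneg divide_nonneg_nonneg mult_nonneg_nonneg) auto
      thus ?thesis using F_upper[OF r Fr that] unfolding Ft_def k_def by (simp add: le_divide_eq)
    qed
    have dFt: "(Ft has_real_derivative - k * F r / r) (at r)"
      unfolding Ft_def using r by (auto intro!: derivative_eq_intros simp: field_simps power2_eq_square)
    have dB: "(B has_real_derivative b * B r / r) (at r)"
    proof -
      have "r ^ (p - 3) * F r = b * B r / r" unfolding b_def n using r B by (simp add: field_simps)
      thus ?thesis using has_real_derivative_B[OF r] by simp
    qed
    have dphi: "(\<phi> has_real_derivative b * (r\<^sup>2 - \<phi> r) / r) (at r)"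
    proof -
      have "\<phi>' r = b * (r\<^sup>2 - \<phi> r) / r" unfolding \<phi>'_def b_def n using r B by (simp add: field_simps)
      thus ?thesis using has_real_derivative_phi[OF r] by simp
    qed
    have dC: "(C has_real_derivative b * (real n + 2 - k - b) / r) (at r)"
    proof -
      have "(C has_real_derivative ((real (n + 2) * r ^ (n + 2) / r * Ft r + (- k * F r / r) * r ^ (n + 2)) * B r - (r ^ (n + 2) * Ft r) * (b * B r / r)) / (B r * B r)) (at r)"
        unfolding C_def by (rule DERIV_divide[OF DERIV_mult[OF dn dFt] dB]) (use B in auto)
      also have "((real (n + 2) * r ^ (n + 2) / r * Ft r + (- k * F r / r) * r ^ (n + 2)) * B r - (r ^ (n + 2) * Ft r) * (b * B r / r)) / (B r * B r)
         = (r ^ (n + 2) * F r / B r) * (real n + 2 - k - b) / r"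
        unfolding Ftr using r B by (simp add: field_simps)
      finally show ?thesis unfolding b_def[symmetric] .
    qed
    define X where "X = r\<^sup>2 - \<phi> r"
    have dg: "(g has_real_derivative real n * r ^ n / r * (2 * \<phi> r - C r * (r\<^sup>2 - \<phi> r)) +
        (2 * (b * (r\<^sup>2 - \<phi> r) / r) - (b * (real n + 2 - k - b) / r * (r\<^sup>2 - \<phi> r) + (real 2 * r ^ 2 / r - b * (r\<^sup>2 - \<phi> r) / r) * C r)) * r ^ n) (at r)"
      unfolding g_def
      by (rule DERIV_mult[OF dn DERIV_diff[OF DERIV_cmult[OF dphi] DERIV_mult[OF dC DERIV_diff[OF dn dphi]]]])
    \<comment> \<open>By \<open>W_eq_L\<close> these quotients are affine in \<open>b\<close>: K1 =
      n + 2 - b and K2 = n + 4 - b r^2 / \<phi>.\<close>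
    define K1 where "K1 = L (p - 2) r / B r"
    define K2 where "K2 = L p r / A r"
    have K1: "K1 = real n + 2 - b"
    proof -
      have "(real p - 2) * B r = L (p - 2) r + r ^ (p - 2) * F r"
        using W_eq_L[of "p - 2" r] r p_ge by (simp add: B_def)
      hence "L (p - 2) r = (real n + 2) * B r - r ^ (n + 2) * F r" unfolding n by (simp add: algebra_simps)
      thus ?thesis unfolding K1_def b_def using B by (simp add: diff_divide_distrib n)
    qed
    have K2: "K2 = real n + 4 - b * r\<^sup>2 / \<phi> r"
    proof -
      have "real p * A r = L p r + r ^ p * F r" using W_eq_L[of p r] r p_ge by (simp add: A_def)
      hence "L p r = (real n + 4) * A r - r ^ p * F r" unfolding n by simp
      hence "L p r = (real n + 4) * A r - r ^ (n + 4) * F r" using pn by (simp only:)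
      hence "K2 = real n + 4 - r ^ (n + 4) * F r / A r" unfolding K2_def using A by (simp add: diff_divide_distrib)
      also have "r ^ (n + 4) * F r / A r = b * r\<^sup>2 / \<phi> r"
        unfolding b_def \<phi>_def using A B by (simp add: field_simps power_add power2_eq_square numeral_eq_Suc)
      finally show ?thesis .
    qed
    have b: "b > 0" unfolding b_def using r Fr B by simp
    have e: "\<phi> r * (K2 - K1) = 2 * \<phi> r - b * X" unfolding K1 K2 X_def using phi by (simp add: field_simps)
    have "0 \<le> (k - K1) * (2 - (K2 - K1)) + (K1 - 2) * (K2 - K1)"
    proof (rule kappa_key_inequality[where n="real n" and q="\<phi> r / r\<^sup>2"])
      show "0 \<le> K1" unfolding K1_def using L_nonneg[OF r] B by simp
      show "K1 \<le> K2" unfolding K1_def K2_def using L_A_le_L_B[OF r] A B by (simp add: divide_le_eq le_divide_eq mult_ac)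
      have "b * \<phi> r \<le> b * r\<^sup>2" using phi b by (intro mult_left_mono) auto
      hence "b \<le> b * r\<^sup>2 / \<phi> r" using phi by (simp add: le_divide_eq)
      thus "K2 - K1 \<le> 2" unfolding K1 K2 by simp
      show "K2 \<le> k" unfolding K2_def k_def using L_le_A[OF r Fr] A by (simp add: divide_le_eq)
      show "K2 * (\<phi> r / r\<^sup>2) \<le> K1"
        unfolding K2_def K1_def \<phi>_def using L_le[OF r] A B r by (simp add: field_simps)
      show "\<phi> r / r\<^sup>2 * (real n + 4 - K2) = real n + 2 - K1" unfolding K1 K2 using phi r by (simp add: field_simps)
      show "real n + 4 - K2 > 0" unfolding K2 using phi r b by simp
    qed simp
    \<comment> \<open>Since \<phi> (K2 - K1) = 2 \<phi> - b X, multiplying by \<phi> turns the key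
      inequality into the derivative of \<open>g\<close>, up to the factor r^n / r.\<close>
    hence "0 \<le> \<phi> r * ((k - K1) * (2 - (K2 - K1)) + (K1 - 2) * (K2 - K1))" using phi by simp
    also have "\<dots> = (k - K1) * (2 * \<phi> r - \<phi> r * (K2 - K1)) + (K1 - 2) * (\<phi> r * (K2 - K1))"
      by (simp add: algebra_simps)
    also have "\<dots> = (k - (real n + 2 - b)) * (b * X) + (real n - b) * (2 * \<phi> r - b * X)"
      unfolding e by (simp add: K1)
    finally have "0 \<le> r ^ n / r * ((k - (real n + 2 - b)) * (b * X) + (real n - b) * (2 * \<phi> r - b * X))"
      using r by (intro mult_nonneg_nonneg) auto
    also have "\<dots> = real n * r ^ n / r * (2 * \<phi> r - C r * (r\<^sup>2 - \<phi> r)) +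
        (2 * (b * (r\<^sup>2 - \<phi> r) / r) - (b * (real n + 2 - k - b) / r * (r\<^sup>2 - \<phi> r) + (real 2 * r ^ 2 / r - b * (r\<^sup>2 - \<phi> r) / r) * C r)) * r ^ n"
      unfolding Cr X_def using r by (simp add: field_simps)
    finally have d0: "0 \<le> real n * r ^ n / r * (2 * \<phi> r - C r * (r\<^sup>2 - \<phi> r)) +
        (2 * (b * (r\<^sup>2 - \<phi> r) / r) - (b * (real n + 2 - k - b) / r * (r\<^sup>2 - \<phi> r) + (real 2 * r ^ 2 / r - b * (r\<^sup>2 - \<phi> r) / r) * C r)) * r ^ n" .
    have gle: "g s \<le> \<kappa> s" if s: "s \<ge> r" for s
    proof -
      have s0: "s > 0" using s r by simp
      have "s ^ (n + 2) * F s * (s\<^sup>2 - \<phi> s) / B s \<le> C s * (s\<^sup>2 - \<phi> s)"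
      proof -
        have "s ^ (n + 2) * F s / B s \<le> C s" unfolding C_def using le[OF s] s0 B_pos[OF s0]
          by (intro divide_right_mono mult_left_mono) auto
        hence "s ^ (n + 2) * F s / B s * (s\<^sup>2 - \<phi> s) \<le> C s * (s\<^sup>2 - \<phi> s)"
          using phi_le[OF s0] by (intro mult_right_mono) auto
        thus ?thesis by simp
      qed
      thus ?thesis unfolding g_def kap using s0 by (intro mult_left_mono) auto
    qed
    have gr: "g r = \<kappa> r" unfolding g_def kap Cr b_def by simp
    show ?thesis using gr gle dg d0 by blast
  qed
qed

text \<open>With K1 and K2 as in \<open>kappa_mono\<close>, \<kappa> r equals r^(p-4) \<phi> r (K2 -
  K1), so this is \<open>L_A_le_L_B\<close> rewritten by \<open>W_eq_L\<close>.\<close>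

lemma kappa_nonneg:
  assumes r: "r > 0"
  shows "\<kappa> r \<ge> 0"
proof -
  have B: "B r > 0" by (rule B_pos[OF r])
  have "(real p - 2) * B r = L (p - 2) r + r ^ (p - 2) * F r"
    using W_eq_L[of "p - 2" r] r p_ge by (simp add: B_def)
  moreover have "real p * A r = L p r + r ^ p * F r" using W_eq_L[of p r] r p_ge by (simp add: A_def)
  ultimately have "((real p - 2) * B r - r ^ (p - 2) * F r) * A r \<le> (real p * A r - r ^ p * F r) * B r"
    using L_A_le_L_B[OF r] by simp
  hence "r ^ p * F r * B r - r ^ (p - 2) * F r * A r \<le> 2 * A r * B r" by (simp add: algebra_simps)
  moreover have "r ^ p = r ^ (p - 2) * r\<^sup>2" using p_ge by (intro power_split) simp
  ultimately have "r ^ (p - 2) * F r * (r\<^sup>2 * B r - A r) \<le> 2 * A r * B r" by (simp add: algebra_simps)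
  hence "r ^ (p - 2) * F r * (r\<^sup>2 * B r - A r) / (B r * B r) \<le> 2 * A r * B r / (B r * B r)"
    using B by (intro divide_right_mono) auto
  hence "r ^ (p - 2) * F r * (r\<^sup>2 - \<phi> r) / B r \<le> 2 * \<phi> r"
    unfolding \<phi>_def using B by (simp add: field_simps)
  thus ?thesis unfolding \<kappa>_def using r by simp
qed

end

section \<open>The one-dimensional inequality\<close>

text \<open>\<open>h\<close> stands for the spherical means of \<psi> around a parameter. Up to the
  area constant, \<open>I\<close>, \<open>I2\<close> and \<open>Im2\<close> below are the total mass
  and the moments of order 2 and -2, and \<open>S t\<close> is the integral of \<psi> over a ball of
  radius t.\<close>

locale radial_mean = radial_profile +
  fixes h :: "real \<Rightarrow> real"
  assumes h_meas [measurable]: "h \<in> borel_measurable borel"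
    and h_nonneg: "\<And>t. 0 \<le> h t" and h_le: "\<And>t. h t \<le> 1"
    and int2: "set_integrable lborel {0<..} (\<lambda>t. t ^ (p + 1) * f t)"
begin

definition "I = (LINT t:{0<..}|lborel. t ^ (p - 1) * f t)"
definition "I2 = (LINT t:{0<..}|lborel. t ^ (p + 1) * f t)"
definition "Im2 = (LINT t:{0<..}|lborel. t ^ (p - 3) * f t)"
definition "Hh = (LINT t:{0<..}|lborel. t ^ (p - 1) * f t * h t)"
definition S :: "real \<Rightarrow> real" where "S t = (LINT s:{0<..<t}|lborel. s ^ (p - 1) * h s)"
definition "HF = (LINT t:{0<..}|lborel. t * f t * S t)"

lemma I_pos: "I > 0" using mass_pos by (simp add: I_def)

lemma I2_nonneg: "I2 \<ge> 0"
  unfolding I2_def by (rule set_integral_f_nonneg) auto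

lemma Hh_int: "set_integrable lborel {0<..} (\<lambda>t. t ^ (p - 1) * f t * h t)"
proof (rule set_integrable_bounded_by_mass[where c=1])
  fix t :: real assume t: "t \<in> {0<..}"
  hence "0 \<le> t ^ (p - 1) * f t" using f_nonneg[of t] by simp
  hence "\<bar>t ^ (p - 1) * f t * h t\<bar> = (t ^ (p - 1) * f t) * h t" by (intro abs_of_nonneg mult_nonneg_nonneg[OF _ h_nonneg])
  also have "\<dots> \<le> t ^ (p - 1) * f t" using \<open>0 \<le> t ^ (p - 1) * f t\<close> h_le[of t] by (intro mult_left_le)
  finally show "\<bar>t ^ (p - 1) * f t * h t\<bar> \<le> 1 * (t ^ (p - 1) * f t)" by simp
qed auto

lemma Hh_nonneg: "Hh \<ge> 0"
  unfolding Hh_def set_lebesgue_integral_def using f_nonneg h_nonneg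
  by (intro Bochner_Integration.integral_nonneg) (auto simp: indicator_def)

lemma S_int: "set_integrable lborel {0<..<t} (\<lambda>s. s ^ (p - 1) * h s)"
  unfolding set_integrable_def
proof (rule integrableI_bounded_set_indicator[where B="t ^ (p - 1)"])
  show "AE x in lborel. x \<in> {0<..<t} \<longrightarrow> norm (x ^ (p - 1) * h x) \<le> t ^ (p - 1)"
  proof (intro AE_I2 impI)
    fix x assume x: "x \<in> {0<..<t}"
    have "x ^ (p - 1) * h x \<le> t ^ (p - 1) * 1"
      using x h_nonneg[of x] h_le[of x] by (intro mult_mono power_mono) auto
    thus "norm (x ^ (p - 1) * h x) \<le> t ^ (p - 1)" using x h_nonneg[of x] by (simp add: abs_mult)
  qed
  show "emeasure lborel {0<..<t} < \<infinity>" by (cases "0 \<le> t") auto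
qed auto

lemma S_nonneg: "S t \<ge> 0"
  unfolding S_def set_lebesgue_integral_def using h_nonneg
  by (intro Bochner_Integration.integral_nonneg) (auto simp: indicator_def)

lemma S_le: assumes "t \<ge> 0" shows "S t \<le> t ^ p"
proof -
  have "S t \<le> (LINT s:{0<..<t}|lborel. t ^ (p - 1))"
    unfolding S_def
  proof (rule set_integral_mono[OF S_int])
    show "set_integrable lborel {0<..<t} (\<lambda>s. t ^ (p - 1))"
      unfolding set_integrable_def using assms by (intro integrable_scaleR_left integrable_real_indicator) auto
    fix x assume x: "x \<in> {0<..<t}"
    have "x ^ (p - 1) * h x \<le> t ^ (p - 1) * 1"
      using x h_nonneg[of x] h_le[of x] by (intro mult_mono power_mono) auto
    thus "x ^ (p - 1) * h x \<le> t ^ (p - 1)" by simp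
  qed
  also have "\<dots> = t * t ^ (p - 1)" using assms by (simp add: set_lebesgue_integral_def)
  also have "\<dots> = t ^ p" using p_ge by (simp flip: power_Suc)
  finally show ?thesis .
qed

lemma nn_S: "(\<integral>\<^sup>+s\<in>{0<..<t}. ennreal (s ^ (p - 1) * h s) \<partial>lborel) = ennreal (S t)"
proof -
  have "(\<integral>\<^sup>+s\<in>{0<..<t}. ennreal (s ^ (p - 1) * h s) \<partial>lborel) = (\<integral>\<^sup>+s. ennreal (indicator {0<..<t} s *\<^sub>R (s ^ (p - 1) * h s)) \<partial>lborel)"
    by (intro nn_integral_cong) (auto simp: indicator_def)
  also have "\<dots> = ennreal (S t)"
    unfolding S_def set_lebesgue_integral_def using h_nonneg
    by (intro nn_integral_eq_integral S_int[unfolded set_integrable_def]) (auto simp: indicator_def)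
  finally show ?thesis .
qed

lemma S_meas [measurable]: "S \<in> borel_measurable borel"
proof -
  have e: "(\<lambda>x :: real \<times> real. indicator {0<..<fst x} (snd x) :: real) = (\<lambda>x. if 0 < snd x \<and> snd x < fst x then 1 else 0)"
    by (auto simp: fun_eq_iff indicator_def)
  have [measurable]: "(\<lambda>x :: real \<times> real. indicator {0<..<fst x} (snd x) :: real) \<in> borel_measurable (borel \<Otimes>\<^sub>M lborel)"
    unfolding e by measurable
  have "(\<lambda>(t, s). indicator {0<..<t} s *\<^sub>R (s ^ (p - 1) * h s)) \<in> borel_measurable (borel \<Otimes>\<^sub>M lborel)"
    unfolding case_prod_beta by measurable
  thus ?thesis unfolding S_def[abs_def] set_lebesgue_integral_def
    by (rule lborel.borel_measurable_lebesgue_integral)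
qed

lemma HF_int: "set_integrable lborel {0<..} (\<lambda>t. t * f t * S t)"
proof (rule set_integrable_bound[OF int2])
  show "set_borel_measurable lborel {0<..} (\<lambda>t. t * f t * S t)" unfolding set_borel_measurable_def by measurable
  show "AE t in lborel. t \<in> {0<..} \<longrightarrow> norm (t * f t * S t) \<le> norm (t ^ (p + 1) * f t)"
  proof (intro AE_I2 impI)
    fix t :: real assume "t \<in> {0<..}"
    hence t: "t > 0" by simp
    have "t * f t * S t \<le> t * f t * t ^ p" using t f_nonneg[of t] S_le[of t] by (intro mult_left_mono) auto
    thus "norm (t * f t * S t) \<le> norm (t ^ (p + 1) * f t)"
      using t f_nonneg[of t] S_nonneg[of t] by (simp add: abs_mult mult_ac)
  qed
qed

lemma HF_nonneg: "HF \<ge> 0"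
  unfolding HF_def set_lebesgue_integral_def using f_nonneg S_nonneg
  by (intro Bochner_Integration.integral_nonneg) (auto simp: indicator_def)

text \<open>\<open>S\<close> is an integral over s < t, so Tonelli moves the weight from t f t to F;
  the second moment makes everything finite.\<close>

lemma HF_tail:
  "set_integrable lborel {0<..} (\<lambda>s. s ^ (p - 1) * h s * F s)"
  "(LINT s:{0<..}|lborel. s ^ (p - 1) * h s * F s) = HF"
proof -
  define g where "g = (\<lambda>s. ennreal (s ^ (p - 1) * h s))"
  have m: "(\<lambda>s. indicator {0<..} s *\<^sub>R (s ^ (p - 1) * h s * F s)) \<in> borel_measurable lborel"
  proof -
    have [measurable]: "(\<lambda>s. indicator {0<..} s * F s) \<in> borel_measurable borel" by (rule F_measurable_on)
    have "(\<lambda>s. s ^ (p - 1) * h s * (indicator {0<..} s * F s)) \<in> borel_measurable lborel"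
      by measurable
    also have "(\<lambda>s. s ^ (p - 1) * h s * (indicator {0<..} s * F s)) = (\<lambda>s. indicator {0<..} s *\<^sub>R (s ^ (p - 1) * h s * F s))"
      by (auto simp: indicator_def)
    finally show ?thesis .
  qed
  have "(\<integral>\<^sup>+ s. ennreal (indicator {0<..} s *\<^sub>R (s ^ (p - 1) * h s * F s)) \<partial>lborel) = (\<integral>\<^sup>+s\<in>{0<..}. g s * tail_int f s \<partial>lborel)"
  proof (intro nn_integral_cong)
    fix s :: real
    show "ennreal (indicator {0<..} s *\<^sub>R (s ^ (p - 1) * h s * F s)) = g s * tail_int f s * indicator {0<..} s"
    proof (cases "s > 0")
      case True
      thus ?thesis using h_nonneg[of s] F_nonneg[OF True] by (simp add: g_def tail_int_eq ennreal_mult)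
    qed simp
  qed
  also have "\<dots> = (\<integral>\<^sup>+t\<in>{0<..}. ennreal (t * f t) * (\<integral>\<^sup>+s\<in>{0<..t}. g s \<partial>lborel) \<partial>lborel)"
    by (rule nn_integral_tail_int[symmetric]) (auto simp: g_def)
  also have "\<dots> = (\<integral>\<^sup>+t. ennreal (indicator {0<..} t *\<^sub>R (t * f t * S t)) \<partial>lborel)"
  proof (intro nn_integral_cong)
    fix t :: real
    have "(\<integral>\<^sup>+s\<in>{0<..t}. g s \<partial>lborel) = (\<integral>\<^sup>+s\<in>{0<..<t}. g s \<partial>lborel)"
      using AE_lborel_singleton[of t] by (intro nn_integral_cong_AE) (auto simp: indicator_def)
    also have "\<dots> = ennreal (S t)" unfolding g_def by (rule nn_S)
    finally have e: "(\<integral>\<^sup>+s\<in>{0<..t}. g s \<partial>lborel) = ennreal (S t)" .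
    show "ennreal (t * f t) * (\<integral>\<^sup>+s\<in>{0<..t}. g s \<partial>lborel) * indicator {0<..} t = ennreal (indicator {0<..} t *\<^sub>R (t * f t * S t))"
    proof (cases "t > 0")
      case True
      thus ?thesis unfolding e using f_nonneg[of t] S_nonneg[of t] by (simp add: ennreal_mult)
    qed simp
  qed
  also have "\<dots> = ennreal HF"
    unfolding HF_def set_lebesgue_integral_def using f_nonneg S_nonneg
    by (intro nn_integral_eq_integral HF_int[unfolded set_integrable_def]) (auto simp: indicator_def)
  finally have "has_bochner_integral lborel (\<lambda>s. indicator {0<..} s *\<^sub>R (s ^ (p - 1) * h s * F s)) HF"
    using HF_nonneg F_nonneg h_nonneg by (intro has_bochner_integral_nn_integral m) (auto simp: indicator_def)
  note hb = this[unfolded has_bochner_integral_iff]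
  show "set_integrable lborel {0<..} (\<lambda>s. s ^ (p - 1) * h s * F s)"
    using hb unfolding set_integrable_def by (rule conjunct1)
  show "(LINT s:{0<..}|lborel. s ^ (p - 1) * h s * F s) = HF"
    using hb unfolding set_lebesgue_integral_def by (rule conjunct2)
qed

text \<open>The source of the factor p - 2 in the criterion with monotone F / f: the inner integral
  of s^(p-3) is t^(p-2) / (p - 2).\<close>

lemma power_F_tail:
  "integrable lborel (\<lambda>t. indicator {0<..} t *\<^sub>R (t ^ (p - 3) * F t))"
  "(\<integral>t. indicator {0<..} t *\<^sub>R (t ^ (p - 3) * F t) \<partial>lborel) = I / (real p - 2)"
proof -
  have p3: "p - 3 = p - 2 - 1" "real (p - 2) = real p - 2" "p - 2 > 0" using p_ge by auto
  define g where "g = (\<lambda>s. ennreal (1 / real (p - 2) * real (p - 2) * s ^ (p - 2 - 1)))"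
  have inner: "(\<integral>\<^sup>+s\<in>{0<..t}. g s \<partial>lborel) = ennreal (t ^ (p - 2) / (real p - 2))" if t: "t > 0" for t
  proof -
    have "(\<integral>\<^sup>+s\<in>{0<..t}. g s \<partial>lborel) = (\<integral>\<^sup>+ s. ennreal (1 / real (p - 2) * real (p - 2) * s ^ (p - 2 - 1)) * indicator {0..t} s \<partial>lborel)"
      using AE_lborel_singleton[of "0::real"] by (intro nn_integral_cong_AE) (auto simp: g_def indicator_def)
    also have "\<dots> = ennreal (1 / real (p - 2) * t ^ (p - 2))" using t p3 by (intro nn_integral_power_Icc) auto
    finally show ?thesis using p3 by simp
  qed
  have m: "(\<lambda>s. indicator {0<..} s *\<^sub>R (s ^ (p - 3) * F s)) \<in> borel_measurable lborel"
  proof -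
    have [measurable]: "(\<lambda>s. indicator {0<..} s * F s) \<in> borel_measurable borel" by (rule F_measurable_on)
    have "(\<lambda>s. s ^ (p - 3) * (indicator {0<..} s * F s)) \<in> borel_measurable lborel" by measurable
    thus ?thesis by (simp add: mult_ac)
  qed
  have "(\<integral>\<^sup>+ s. ennreal (indicator {0<..} s *\<^sub>R (s ^ (p - 3) * F s)) \<partial>lborel) = (\<integral>\<^sup>+s\<in>{0<..}. g s * tail_int f s \<partial>lborel)"
  proof (intro nn_integral_cong)
    fix s :: real
    show "ennreal (indicator {0<..} s *\<^sub>R (s ^ (p - 3) * F s)) = g s * tail_int f s * indicator {0<..} s"
    proof (cases "s > 0")
      case True
      thus ?thesis using F_nonneg[OF True] p3 by (simp add: g_def tail_int_eq ennreal_mult)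
    qed simp
  qed
  also have "\<dots> = (\<integral>\<^sup>+t\<in>{0<..}. ennreal (t * f t) * (\<integral>\<^sup>+s\<in>{0<..t}. g s \<partial>lborel) \<partial>lborel)"
    by (rule nn_integral_tail_int[symmetric]) (auto simp: g_def)
  also have "\<dots> = (\<integral>\<^sup>+t. ennreal (1 / (real p - 2) * (indicator {0<..} t *\<^sub>R (t ^ (p - 1) * f t))) \<partial>lborel)"
  proof (intro nn_integral_cong)
    fix t :: real
    show "ennreal (t * f t) * (\<integral>\<^sup>+s\<in>{0<..t}. g s \<partial>lborel) * indicator {0<..} t = ennreal (1 / (real p - 2) * (indicator {0<..} t *\<^sub>R (t ^ (p - 1) * f t)))"
    proof (cases "t > 0")
      case True
      have "t ^ (p - 1) = t ^ 1 * t ^ (p - 2)" using p_ge by (intro power_split) simp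
      thus ?thesis using True f_nonneg[of t] p_ge by (simp add: inner ennreal_mult[symmetric] mult_ac)
    qed simp
  qed
  also have "\<dots> = ennreal (1 / (real p - 2) * I)"
    unfolding I_def set_lebesgue_integral_def using f_nonneg p_ge mass_int
    by (subst nn_integral_eq_integral) (auto simp: set_integrable_def indicator_def)
  finally have "has_bochner_integral lborel (\<lambda>s. indicator {0<..} s *\<^sub>R (s ^ (p - 3) * F s)) (1 / (real p - 2) * I)"
    using I_pos F_nonneg p_ge by (intro has_bochner_integral_nn_integral m) (auto simp: indicator_def)
  thus "integrable lborel (\<lambda>t. indicator {0<..} t *\<^sub>R (t ^ (p - 3) * F t))"
    "(\<integral>t. indicator {0<..} t *\<^sub>R (t ^ (p - 3) * F t) \<partial>lborel) = I / (real p - 2)"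
    by (simp_all only: has_bochner_integral_iff times_divide_eq_left mult_1)
qed

lemma star_ratio_bounded_below:
  assumes c: "c \<ge> 0" "\<And>s. s > 0 \<Longrightarrow> c * f s \<le> F s" and m: "I2 \<le> 2 * real p * c * I"
  shows "I2 * Hh \<le> 2 * real p * I * HF"
proof -
  have "c * Hh = (LINT t:{0<..}|lborel. c * (t ^ (p - 1) * f t * h t))" by (simp add: Hh_def)
  also have "\<dots> \<le> (LINT s:{0<..}|lborel. s ^ (p - 1) * h s * F s)"
  proof (rule set_integral_mono)
    fix t :: real assume "t \<in> {0<..}"
    hence t: "t > 0" by simp
    have "t ^ (p - 1) * h t * (c * f t) \<le> t ^ (p - 1) * h t * F t"
      using c(2)[OF t] t h_nonneg[of t] by (intro mult_left_mono) auto
    thus "c * (t ^ (p - 1) * f t * h t) \<le> t ^ (p - 1) * h t * F t" by (simp only: mult_ac)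
  qed (use Hh_int HF_tail in auto)
  finally have "c * Hh \<le> HF" using HF_tail by simp
  have "I2 * Hh \<le> 2 * real p * c * I * Hh" using m Hh_nonneg by (intro mult_right_mono) auto
  also have "\<dots> = 2 * real p * I * (c * Hh)" by (simp add: mult_ac)
  also have "\<dots> \<le> 2 * real p * I * HF" using \<open>c * Hh \<le> HF\<close> I_pos by (intro mult_left_mono) auto
  finally show ?thesis .
qed

end

text \<open>What superharmonicity of \<psi> leaves in one dimension: h decreases, but no faster than
  t^(-2).\<close>

locale radial_mean_monotone = radial_mean +
  assumes intm2: "set_integrable lborel {0<..} (\<lambda>t. t ^ (p - 3) * f t)"
    and h_antimono: "\<And>s t. 0 < s \<Longrightarrow> s \<le> t \<Longrightarrow> h t \<le> h s"
    and sq_mono: "\<And>s t. 0 < s \<Longrightarrow> s \<le> t \<Longrightarrow> s\<^sup>2 * h s \<le> t\<^sup>2 * h t"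
begin

lemma Im2_nonneg: "Im2 \<ge> 0"
  unfolding Im2_def by (rule set_integral_f_nonneg) auto

text \<open>After the substitution s \<mapsto> l s, monotonicity of h gives the upper bound and that
  of t^2 h the lower one. Thus S / t^p is nonincreasing and S / t^(p-2) nondecreasing.\<close>

lemma S_scale:
  assumes s: "0 < s" and l: "l \<ge> 1"
  shows "S (l * s) \<le> l ^ p * S s" "l ^ (p - 2) * S s \<le> S (l * s)"
proof -
  have "S (l * s) = \<bar>l\<bar> * (LINT x|lborel. indicator {0<..<l * s} (0 + l * x) *\<^sub>R ((0 + l * x) ^ (p - 1) * h (0 + l * x)))"
    unfolding S_def set_lebesgue_integral_def using l by (subst lborel_integral_real_affine[of l _ 0]) auto
  also have "(\<lambda>x. indicator {0<..<l * s} (0 + l * x) *\<^sub>R ((0 + l * x) ^ (p - 1) * h (0 + l * x))) =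
      (\<lambda>x. indicator {0<..<s} x *\<^sub>R (l ^ (p - 1) * (x ^ (p - 1) * h (l * x))))"
    using l by (auto simp: indicator_def power_mult_distrib zero_less_mult_iff)
  finally have e: "S (l * s) = l * (LINT x:{0<..<s}|lborel. l ^ (p - 1) * (x ^ (p - 1) * h (l * x)))"
    using l unfolding set_lebesgue_integral_def by simp
  have i: "set_integrable lborel {0<..<s} (\<lambda>x. l ^ (p - 1) * (x ^ (p - 1) * h (l * x)))"
    unfolding set_integrable_def
  proof (rule integrableI_bounded_set_indicator[where B="l ^ (p - 1) * s ^ (p - 1)"])
    show "AE x in lborel. x \<in> {0<..<s} \<longrightarrow> norm (l ^ (p - 1) * (x ^ (p - 1) * h (l * x))) \<le> l ^ (p - 1) * s ^ (p - 1)"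
    proof (intro AE_I2 impI)
      fix x assume x: "x \<in> {0<..<s}"
      have "x ^ (p - 1) * h (l * x) \<le> s ^ (p - 1) * 1"
        using x h_nonneg[of "l * x"] h_le[of "l * x"] by (intro mult_mono power_mono) auto
      thus "norm (l ^ (p - 1) * (x ^ (p - 1) * h (l * x))) \<le> l ^ (p - 1) * s ^ (p - 1)"
        using x l h_nonneg[of "l * x"] by (simp add: abs_mult)
    qed
    show "emeasure lborel {0<..<s} < \<infinity>" using s by simp
  qed auto
  have "l * (LINT x:{0<..<s}|lborel. l ^ (p - 1) * (x ^ (p - 1) * h (l * x))) \<le> l * (LINT x:{0<..<s}|lborel. l ^ (p - 1) * (x ^ (p - 1) * h x))"
  proof (intro mult_left_mono set_integral_mono i)
    show "set_integrable lborel {0<..<s} (\<lambda>x. l ^ (p - 1) * (x ^ (p - 1) * h x))"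
      using S_int[of s] by (rule set_integrable_mult_right)
    fix x assume x: "x \<in> {0<..<s}"
    show "h (l * x) \<le> h x" using x l by (intro h_antimono) auto
  qed (use l in auto)
  also have "\<dots> = (l * l ^ (p - 1)) * S s" by (simp add: S_def)
  also have "l * l ^ (p - 1) = l ^ p" using p_ge by (simp flip: power_Suc)
  finally show "S (l * s) \<le> l ^ p * S s" unfolding e .
  have "l ^ (p - 2) * S s = l * (LINT x:{0<..<s}|lborel. l ^ (p - 3) * (x ^ (p - 1) * h x))"
  proof -
    have "p - 2 = Suc (p - 3)" using p_ge by simp
    thus ?thesis by (simp add: S_def)
  qed
  also have "\<dots> \<le> l * (LINT x:{0<..<s}|lborel. l ^ (p - 1) * (x ^ (p - 1) * h (l * x)))"
  proof (intro mult_left_mono set_integral_mono i)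
    show "set_integrable lborel {0<..<s} (\<lambda>x. l ^ (p - 3) * (x ^ (p - 1) * h x))"
      using S_int[of s] by (rule set_integrable_mult_right)
    fix x assume x: "x \<in> {0<..<s}"
    have "x\<^sup>2 * h x \<le> (l * x)\<^sup>2 * h (l * x)" using x l by (intro sq_mono) auto
    hence "x\<^sup>2 * h x \<le> x\<^sup>2 * (l\<^sup>2 * h (l * x))" by (simp add: power_mult_distrib mult_ac)
    hence "h x \<le> l\<^sup>2 * h (l * x)" using x by simp
    hence "(l ^ (p - 3) * x ^ (p - 1)) * h x \<le> (l ^ (p - 3) * x ^ (p - 1)) * (l\<^sup>2 * h (l * x))"
      using x l by (intro mult_left_mono) auto
    moreover have "l ^ (p - 1) = l ^ (p - 3) * l\<^sup>2" using p_ge by (intro power_split) simp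
    ultimately show "l ^ (p - 3) * (x ^ (p - 1) * h x) \<le> l ^ (p - 1) * (x ^ (p - 1) * h (l * x))"
      by (simp only: mult_ac)
  qed (use l in auto)
  finally show "l ^ (p - 2) * S s \<le> S (l * s)" unfolding e .
qed

lemma S_power_antimono:
  assumes "0 < s" "s \<le> t" shows "S t * s ^ p \<le> S s * t ^ p"
  using S_scale(1)[of s "t / s"] assms by (simp add: power_divide field_simps)

lemma S_power_mono:
  assumes "0 < s" "s \<le> t" shows "S s * t ^ (p - 2) \<le> S t * s ^ (p - 2)"
  using S_scale(2)[of s "t / s"] assms by (simp add: power_divide field_simps)

text \<open>A nonincreasing h is at t at most its average over the ball of radius t, and that
  average is p S t / t^p.\<close>

lemma h_le_S:
  assumes t: "t > 0" shows "h t * t ^ p / real p \<le> S t"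
proof -
  have "ennreal (h t / real p * t ^ p) = (\<integral>\<^sup>+ s. ennreal (h t / real p * real p * s ^ (p - 1)) * indicator {0..t} s \<partial>lborel)"
    using t h_nonneg[of t] p_ge by (intro nn_integral_power_Icc[symmetric]) auto
  also have "\<dots> \<le> (\<integral>\<^sup>+s\<in>{0<..<t}. ennreal (s ^ (p - 1) * h s) \<partial>lborel)"
  proof (rule nn_integral_mono_AE)
    show "AE s in lborel. ennreal (h t / real p * real p * s ^ (p - 1)) * indicator {0..t} s \<le> ennreal (s ^ (p - 1) * h s) * indicator {0<..<t} s"
      using AE_lborel_singleton[of "0::real"] AE_lborel_singleton[of t]
    proof eventually_elim
      case (elim s)
      show ?case
      proof (cases "s \<in> {0<..<t}")
        case True
        have "s ^ (p - 1) * h t \<le> s ^ (p - 1) * h s" using True h_antimono[of s t] by (intro mult_left_mono) auto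
        thus ?thesis using True p_ge by (auto intro!: ennreal_leI simp: mult_ac)
      qed (use elim in auto)
    qed
  qed
  finally have "ennreal (h t / real p * t ^ p) \<le> ennreal (S t)" by (simp only: nn_S)
  thus ?thesis using S_nonneg by (simp add: ennreal_le_iff)
qed

text \<open>Chebyshev with weights t^(p-3) f and t^(p-1) f against t^2 h gives I Hh \<le> X Im2 with
  X the integral of t^(p+1) f h, and \<open>h_le_S\<close> bounds X by p HF.\<close>

lemma star_general:
  assumes m: "I2 * Im2 \<le> 2 * I\<^sup>2"
  shows "I2 * Hh \<le> 2 * real p * I * HF"
proof -
  let ?X = "LINT t:{0<..}|lborel. t ^ (p + 1) * f t * h t"
  have iX: "set_integrable lborel {0<..} (\<lambda>t. t ^ (p + 1) * f t * h t)"
  proof (rule set_integrable_bound[OF int2])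
    show "set_borel_measurable lborel {0<..} (\<lambda>t. t ^ (p + 1) * f t * h t)" unfolding set_borel_measurable_def by measurable
    show "AE t in lborel. t \<in> {0<..} \<longrightarrow> norm (t ^ (p + 1) * f t * h t) \<le> norm (t ^ (p + 1) * f t)"
      using h_nonneg h_le by (intro AE_I2) (simp add: abs_mult mult_left_le)
  qed
  have X0: "?X \<ge> 0" unfolding set_lebesgue_integral_def using f_nonneg h_nonneg
    by (intro Bochner_Integration.integral_nonneg) (auto simp: indicator_def)
  let ?a = "\<lambda>t. indicator {0<..} t *\<^sub>R (t ^ (p - 3) * f t)"
  let ?b = "\<lambda>t. indicator {0<..} t *\<^sub>R (t ^ (p - 1) * f t)"
  have ea: "?a t * (t\<^sup>2 * h t) = indicator {0<..} t *\<^sub>R (t ^ (p - 1) * f t * h t)" for t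
  proof -
    have "t ^ (p - 1) = t ^ (p - 3) * t\<^sup>2" using p_ge by (intro power_split) simp
    thus ?thesis by (simp only: mult_ac real_scaleR_def)
  qed
  have eb: "?b t * (t\<^sup>2 * h t) = indicator {0<..} t *\<^sub>R (t ^ (p + 1) * f t * h t)" for t
  proof -
    have "t ^ (p + 1) = t ^ (p - 1) * t\<^sup>2" using p_ge by (intro power_split) simp
    thus ?thesis by (simp only: mult_ac real_scaleR_def)
  qed
  have "(\<integral>t. ?b t \<partial>lborel) * (\<integral>t. ?a t * (t\<^sup>2 * h t) \<partial>lborel) \<le> (\<integral>t. ?b t * (t\<^sup>2 * h t) \<partial>lborel) * (\<integral>t. ?a t \<partial>lborel)"
  proof (rule chebyshev_integral_inequality)
    show "integrable lborel ?a" using intm2 unfolding set_integrable_def .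
    show "integrable lborel ?b" using mass_int unfolding set_integrable_def .
    show "integrable lborel (\<lambda>t. ?a t * (t\<^sup>2 * h t))" using Hh_int unfolding set_integrable_def ea .
    show "integrable lborel (\<lambda>t. ?b t * (t\<^sup>2 * h t))" using iX unfolding set_integrable_def eb .
    fix s t :: real
    show "0 \<le> (?b s * ?a t - ?b t * ?a s) * (s\<^sup>2 * h s - t\<^sup>2 * h t)"
    proof (cases "s > 0 \<and> t > 0")
      case True
      have e: "x ^ (p - 1) = x ^ (p - 3) * x\<^sup>2" for x :: real using p_ge by (intro power_split) simp
      have "(?b s * ?a t - ?b t * ?a s) * (s\<^sup>2 * h s - t\<^sup>2 * h t) =
         (s ^ (p - 3) * t ^ (p - 3) * f s * f t) * ((s\<^sup>2 - t\<^sup>2) * (s\<^sup>2 * h s - t\<^sup>2 * h t))"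
        unfolding e using True by (simp add: algebra_simps)
      moreover have "0 \<le> (s\<^sup>2 - t\<^sup>2) * (s\<^sup>2 * h s - t\<^sup>2 * h t)"
      proof (cases "s \<le> t")
        case le: True
        hence "s\<^sup>2 \<le> t\<^sup>2" using True by (intro power_mono) auto
        thus ?thesis using sq_mono[of s t] le True by (intro mult_nonpos_nonpos) auto
      next
        case False
        hence "t\<^sup>2 \<le> s\<^sup>2" using True by (intro power_mono) auto
        thus ?thesis using sq_mono[of t s] False True by (intro mult_nonneg_nonneg) auto
      qed
      moreover have "0 \<le> s ^ (p - 3) * t ^ (p - 3) * f s * f t" using True f_nonneg by simp
      ultimately show ?thesis by (simp only: mult_nonneg_nonneg)
    qed auto
  qed
  hence "I * Hh \<le> ?X * Im2" unfolding ea eb I_def Hh_def Im2_def set_lebesgue_integral_def .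
  hence "I2 * (I * Hh) \<le> I2 * (?X * Im2)" using I2_nonneg by (rule mult_left_mono)
  also have "\<dots> = (I2 * Im2) * ?X" by (simp add: mult_ac)
  also have "\<dots> \<le> 2 * I\<^sup>2 * ?X" using m X0 by (rule mult_right_mono)
  finally have "I * (I2 * Hh) \<le> I * (2 * I * ?X)" by (simp add: power2_eq_square mult_ac)
  hence a: "I2 * Hh \<le> 2 * I * ?X" using I_pos by simp
  have "?X \<le> (LINT t:{0<..}|lborel. real p * (t * f t * S t))"
  proof (rule set_integral_mono[OF iX])
    show "set_integrable lborel {0<..} (\<lambda>t. real p * (t * f t * S t))" using HF_int by (rule set_integrable_mult_right)
    fix t :: real assume "t \<in> {0<..}"
    hence t: "t > 0" by simp
    have "h t * t ^ p \<le> real p * S t" using h_le_S[OF t] p_ge by (simp add: divide_le_eq mult.commute)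
    hence "t * f t * (h t * t ^ p) \<le> t * f t * (real p * S t)" using t f_nonneg[of t] by (intro mult_left_mono) auto
    thus "t ^ (p + 1) * f t * h t \<le> real p * (t * f t * S t)" by (simp add: mult_ac)
  qed
  also have "\<dots> = real p * HF" by (simp add: HF_def)
  finally have "2 * I * ?X \<le> 2 * I * (real p * HF)" using I_pos by (intro mult_left_mono) auto
  thus ?thesis using a by (simp add: mult_ac)
qed

text \<open>At the least positive zero R of F the tail integral vanishes, so f is 0 almost
  everywhere beyond R.\<close>

lemma f_eq_0_AE: "AE t in lborel. 0 < t \<longrightarrow> F t = 0 \<longrightarrow> f t = 0"
proof -
  have ex: "\<exists>r>0. F r > 0"
  proof (rule ccontr)
    assume a: "\<not> ?thesis"
    have z: "indicator {0<..<1} s *\<^sub>R (s ^ (p - 3) * F s) = 0" for s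
    proof (cases "s > 0")
      case True
      hence "\<not> F s > 0" using a by blast
      hence "F s = 0" using F_nonneg[OF True] by simp
      thus ?thesis by simp
    qed simp
    have "B 1 = (LINT s:{0<..<1}|lborel. s ^ (p - 3) * F s)" using B_tail[of 1] by simp
    also have "\<dots> = 0" unfolding set_lebesgue_integral_def z by simp
    finally show False using B_pos[of 1] by simp
  qed
  then obtain r where r: "r > 0" "F r > 0" by auto
  show ?thesis
  proof (cases "\<exists>t>0. F t = 0")
    case False
    thus ?thesis by auto
  next
    case True
    \<comment> \<open>Starting at a point \<open>r\<close> with \<open>F r > 0\<close> keeps the
      infimum of the zero set positive, and continuity of \<open>F\<close> makes it a zero.\<close>
    define Z where "Z = {x \<in> {r..}. F x = 0}"
    have tr: "t \<ge> r" if "t > 0" "F t = 0" for t using F_antimono[of t r] that r by (cases "t \<ge> r") auto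
    have "{r..} \<subseteq> {0<..}" using r by auto
    from continuous_closed_preimage_constant[OF continuous_on_subset[OF F_continuous this] closed_atLeast, of 0]
    have "closed Z" by (simp add: Z_def)
    moreover have "Z \<noteq> {}" using True tr by (auto simp: Z_def)
    moreover have bdd: "bdd_below Z" by (auto simp: Z_def bdd_below_def)
    ultimately have "Inf Z \<in> Z" by (intro closed_contains_Inf)
    define R where "R = Inf Z"
    have R: "R > 0" "F R = 0" using \<open>Inf Z \<in> Z\<close> r by (auto simp: Z_def R_def)
    have "AE s in lborel. indicator {R..} s *\<^sub>R (s * f s) = 0"
      using R F_int[OF R(1)] f_nonneg
      by (subst integral_nonneg_eq_0_iff_AE[symmetric]) (auto simp: F_def set_lebesgue_integral_def set_integrable_def indicator_def)
    thus ?thesis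
    proof eventually_elim
      case (elim t)
      show ?case
      proof (intro impI)
        assume t: "0 < t" "F t = 0"
        hence "t \<in> Z" using tr by (simp add: Z_def)
        hence "R \<le> t" unfolding R_def using bdd by (rule cInf_lower)
        thus "f t = 0" using elim t by simp
      qed
    qed
  qed
qed

text \<open>Chebyshev with weights t^(p-3) f and t^(p-3) F, whose quotient F / f is now
  nondecreasing, against t^2 h. It reaches \<open>HF\<close> directly, and
  \<open>power_F_tail\<close> supplies the total weight.\<close>

lemma star_ratio_mono:
  assumes rat: "\<And>s t. 0 < s \<Longrightarrow> s < t \<Longrightarrow> F t > 0 \<Longrightarrow> F s * f t \<le> F t * f s"
    and m: "(real p - 2) * (I2 * Im2) \<le> 2 * real p * I\<^sup>2"
  shows "I2 * Hh \<le> 2 * real p * I * HF"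
proof -
  \<comment> \<open>The ratio hypothesis is silent where \<open>F\<close> vanishes. Setting
    \<open>f\<close> to 0 there alters it on a null set of positive t and makes the pairwise
    inequality hold everywhere.\<close>
  define f0 where "f0 = (\<lambda>t. if F t = 0 then 0 else f t)"
  let ?a = "\<lambda>t. indicator {0<..} t *\<^sub>R (t ^ (p - 3) * f0 t)"
  let ?b = "\<lambda>t. indicator {0<..} t *\<^sub>R (t ^ (p - 3) * F t)"
  have e: "x ^ (p - 1) = x ^ (p - 3) * x\<^sup>2" for x :: real using p_ge by (intro power_split) simp
  have eb: "?b t * (t\<^sup>2 * h t) = indicator {0<..} t *\<^sub>R (t ^ (p - 1) * h t * F t)" for t
    unfolding e by (simp only: mult_ac real_scaleR_def)
  have ea: "?a t * (t\<^sup>2 * h t) = indicator {0<..} t *\<^sub>R (t ^ (p - 1) * f0 t * h t)" for t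
    unfolding e by (simp only: mult_ac real_scaleR_def)
  have Fm [measurable]: "(\<lambda>s. indicator {0<..} s * F s) \<in> borel_measurable borel" by (rule F_measurable_on)
  have fm: "(\<lambda>t. indicator {0<..} t * f0 t) \<in> borel_measurable borel"
  proof -
    have "(\<lambda>t. indicator {0<..} t * (if indicator {0<..} t * F t = 0 then 0 else f t)) \<in> borel_measurable borel" by measurable
    also have "(\<lambda>t. indicator {0<..} t * (if indicator {0<..} t * F t = 0 then 0 else f t)) = (\<lambda>t. indicator {0<..} t * f0 t)"
      by (auto simp: f0_def indicator_def)
    finally show ?thesis .
  qed
  have m1: "(\<lambda>t. indicator {0<..} t *\<^sub>R (g t * f0 t)) \<in> borel_measurable lborel" if [measurable]: "g \<in> borel_measurable borel" for g :: "real \<Rightarrow> real"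
  proof -
    note [measurable] = fm
    have "(\<lambda>t. g t * (indicator {0<..} t * f0 t)) \<in> borel_measurable lborel" by measurable
    thus ?thesis by (simp add: mult_ac)
  qed
  have ae: "AE t in lborel. indicator {0<..} t *\<^sub>R (g t * f0 t) = indicator {0<..} t *\<^sub>R (g t * f t)" for g :: "real \<Rightarrow> real"
    using f_eq_0_AE by eventually_elim (auto simp: f0_def indicator_def)
  have a1: "integrable lborel ?a" "(\<integral>t. ?a t \<partial>lborel) = Im2"
    using intm2 ae[of "\<lambda>t. t ^ (p - 3)"] m1[of "\<lambda>t. t ^ (p - 3)"] unfolding set_integrable_def Im2_def set_lebesgue_integral_def
    by (auto intro: integrable_cong_AE_imp integral_cong_AE elim: eventually_mono)
  have e3: "t ^ (p - 1) * f0 t * h t = (t ^ (p - 1) * h t) * f0 t" "t ^ (p - 1) * f t * h t = (t ^ (p - 1) * h t) * f t" for t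
    by (simp_all add: mult_ac)
  have a2: "integrable lborel (\<lambda>t. ?a t * (t\<^sup>2 * h t))" "(\<integral>t. ?a t * (t\<^sup>2 * h t) \<partial>lborel) = Hh"
    using Hh_int ae[of "\<lambda>t. t ^ (p - 1) * h t"] m1[of "\<lambda>t. t ^ (p - 1) * h t"]
    unfolding set_integrable_def Hh_def set_lebesgue_integral_def ea e3
    by (auto intro: integrable_cong_AE_imp integral_cong_AE elim: eventually_mono)
  note b1 = power_F_tail
  have "(\<integral>t. ?b t \<partial>lborel) * (\<integral>t. ?a t * (t\<^sup>2 * h t) \<partial>lborel) \<le> (\<integral>t. ?b t * (t\<^sup>2 * h t) \<partial>lborel) * (\<integral>t. ?a t \<partial>lborel)"
  proof (rule chebyshev_integral_inequality[OF a1(1) b1(1) a2(1)])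
    show "integrable lborel (\<lambda>t. ?b t * (t\<^sup>2 * h t))" using HF_tail(1) unfolding set_integrable_def eb .
    fix s t :: real
    have key: "F s * f0 t \<le> F t * f0 s" if "0 < s" "s < t" for s t
    proof (cases "F t = 0")
      case True
      thus ?thesis by (simp add: f0_def)
    next
      case False
      hence "F t > 0" using F_nonneg[of t] that by simp
      moreover have "F s > 0" using F_antimono[of s t] that \<open>F t > 0\<close> by simp
      ultimately show ?thesis using rat[OF that] by (simp add: f0_def)
    qed
    show "0 \<le> (?b s * ?a t - ?b t * ?a s) * (s\<^sup>2 * h s - t\<^sup>2 * h t)"
    proof (cases "s > 0 \<and> t > 0")
      case True
      have "(?b s * ?a t - ?b t * ?a s) * (s\<^sup>2 * h s - t\<^sup>2 * h t) =
         (s ^ (p - 3) * t ^ (p - 3)) * ((F s * f0 t - F t * f0 s) * (s\<^sup>2 * h s - t\<^sup>2 * h t))" (is "?lhs = _")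
        using True by (simp add: algebra_simps)
      moreover have nn: "0 \<le> (F s * f0 t - F t * f0 s) * (s\<^sup>2 * h s - t\<^sup>2 * h t)"
      proof (cases s t rule: linorder_cases)
        case less
        thus ?thesis using sq_mono[of s t] key[of s t] True by (intro mult_nonpos_nonpos) auto
      next
        case greater
        thus ?thesis using sq_mono[of t s] key[of t s] True by (intro mult_nonneg_nonneg) auto
      qed simp
      moreover have "0 \<le> s ^ (p - 3) * t ^ (p - 3)" using True by simp
      ultimately show "0 \<le> ?lhs" by (simp only: mult_nonneg_nonneg)
    qed auto
  qed
  hence "I / (real p - 2) * Hh \<le> HF * Im2"
    unfolding a1(2) a2(2) b1(2) eb using HF_tail(2) by (simp only: set_lebesgue_integral_def)
  hence "I * Hh \<le> (real p - 2) * (HF * Im2)" using p_ge by (simp add: field_simps)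
  hence "I2 * (I * Hh) \<le> I2 * ((real p - 2) * (HF * Im2))" using I2_nonneg by (rule mult_left_mono)
  also have "\<dots> = (real p - 2) * (I2 * Im2) * HF" by (simp add: mult_ac)
  also have "\<dots> \<le> 2 * real p * I\<^sup>2 * HF" using m HF_nonneg by (rule mult_right_mono)
  finally have "I * (I2 * Hh) \<le> I * (2 * real p * I * HF)" by (simp add: power2_eq_square mult_ac)
  thus ?thesis using I_pos by simp
qed

context
  assumes f_antimono: "\<And>s t. 0 < s \<Longrightarrow> s \<le> t \<Longrightarrow> f t \<le> f s"
begin

definition c :: "real \<Rightarrow> real" where "c y = measure lborel {t. 0 < t \<and> y < f t}"

text \<open>
  Since \<open>f\<close> is a mixture of indicators of the intervals \<open>(0, c y)\<close>, the law with density \<open>f\<close> is a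
  mixture of uniform laws on balls.
\<close>
lemma superlevel_interval:
  assumes y: "y > 0"
  shows "{0<..<c y} \<subseteq> {t. 0 < t \<and> y < f t}" "{t. 0 < t \<and> y < f t} \<subseteq> {0<..c y}"
proof -
  let ?N = "{t. 0 < t \<and> y < f t}"
  \<comment> \<open>If f exceeds y at t, it does so on all of (0, t), which costs mass y t^p / p;
    hence the superlevel set is bounded and \<open>c y\<close> is finite.\<close>
  have bd: "t \<le> max 1 (real p * I / y)" if t: "t \<in> ?N" for t
  proof (cases "t \<le> 1")
    case False
    have "(\<integral>\<^sup>+ s. ennreal (y / real p * real p * s ^ (p - 1)) * indicator {0..t} s \<partial>lborel) = ennreal (y / real p * t ^ p)"
      using t y p_ge by (intro nn_integral_power_Icc) auto
    hence "ennreal (y / real p * t ^ p) = (\<integral>\<^sup>+ s. ennreal (y / real p * real p * s ^ (p - 1)) * indicator {0..t} s \<partial>lborel)" ..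
    also have "\<dots> \<le> (\<integral>\<^sup>+s. ennreal (indicator {0<..} s *\<^sub>R (s ^ (p - 1) * f s)) \<partial>lborel)"
    proof (rule nn_integral_mono_AE)
      show "AE s in lborel. ennreal (y / real p * real p * s ^ (p - 1)) * indicator {0..t} s \<le> ennreal (indicator {0<..} s *\<^sub>R (s ^ (p - 1) * f s))"
        using AE_lborel_singleton[of "0::real"]
      proof eventually_elim
        case (elim s)
        show ?case
        proof (cases "s \<in> {0..t}")
          case True
          hence "y \<le> f s" using f_antimono[of s t] t elim by auto
          hence "s ^ (p - 1) * y \<le> s ^ (p - 1) * f s" using True by (intro mult_left_mono) auto
          thus ?thesis using True elim p_ge by (auto intro!: ennreal_leI simp: mult_ac)
        qed simp
      qed
    qed
    also have "\<dots> = ennreal I" unfolding I_def set_lebesgue_integral_def using f_nonneg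
      by (intro nn_integral_eq_integral mass_int[unfolded set_integrable_def]) (auto simp: indicator_def)
    finally have "y / real p * t ^ p \<le> I" using I_pos by (simp add: ennreal_le_iff)
    moreover have "t ^ 1 \<le> t ^ p" using False p_ge by (intro power_increasing) auto
    ultimately have "y / real p * t ^ 1 \<le> I" using y by (intro order_trans[OF mult_left_mono \<open>y / real p * t ^ p \<le> I\<close>]) auto
    hence "t \<le> real p * I / y" using y p_ge by (simp add: field_simps)
    thus ?thesis by simp
  qed simp
  define s where "s = Sup (insert 0 ?N)"
  have bdd: "bdd_above (insert 0 ?N)"
    using bd by (intro bdd_aboveI[of _ "max 1 (real p * I / y)"]) auto
  have s0: "s \<ge> 0" unfolding s_def using bdd by (intro cSup_upper) auto
  have up: "?N \<subseteq> {0<..s}" using bdd by (auto simp: s_def intro!: cSup_upper)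
  have lo: "{0<..<s} \<subseteq> ?N"
  proof
    fix t assume t: "t \<in> {0<..<s}"
    hence "\<exists>x\<in>insert 0 ?N. t < x" unfolding s_def using bdd by (subst less_cSup_iff[symmetric]) auto
    then obtain x where "x \<in> ?N" "t < x" using t by auto
    thus "t \<in> ?N" using f_antimono[of t x] t by auto
  qed
  have [measurable]: "?N \<in> sets borel" by measurable
  have "emeasure lborel {0<..<s} \<le> emeasure lborel ?N" using lo by (intro emeasure_mono) auto
  moreover have "emeasure lborel ?N \<le> emeasure lborel {0<..s}" using up by (intro emeasure_mono) auto
  ultimately have "emeasure lborel ?N = ennreal s" using s0 by simp
  hence "c y = s" using s0 by (simp add: c_def measure_def)
  thus "{0<..<c y} \<subseteq> ?N" "?N \<subseteq> {0<..c y}" using lo up by auto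
qed

lemma c_nonneg: "c y \<ge> 0" by (simp add: c_def)

lemma superlevel_measurable [measurable]:
  "(\<lambda>x. indicator {t. 0 < t \<and> fst x < f t} (snd x) :: ennreal) \<in> borel_measurable (borel \<Otimes>\<^sub>M borel)"
proof -
  have "(\<lambda>x. indicator {t. 0 < t \<and> fst x < f t} (snd x) :: ennreal) = (\<lambda>x :: real \<times> real. if 0 < snd x \<and> fst x < f (snd x) then 1 else 0)"
    by (auto simp: fun_eq_iff indicator_def)
  thus ?thesis by simp
qed

lemma c_measurable [measurable]: "c \<in> borel_measurable borel"
proof -
  have "(\<lambda>y. \<integral>\<^sup>+t. indicator {t. 0 < t \<and> y < f t} t \<partial>lborel) \<in> borel_measurable borel"
    using superlevel_measurable by (intro lborel.borel_measurable_nn_integral) (simp add: case_prod_beta)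
  hence "(\<lambda>y. enn2real (\<integral>\<^sup>+t. indicator {t. 0 < t \<and> y < f t} t \<partial>lborel)) \<in> borel_measurable borel"
    by measurable
  also have "(\<lambda>y. enn2real (\<integral>\<^sup>+t. indicator {t. 0 < t \<and> y < f t} t \<partial>lborel)) = c"
    unfolding c_def measure_def by (subst nn_integral_indicator) auto
  finally show ?thesis .
qed

lemma layer_cake:
  assumes [measurable]: "g \<in> borel_measurable borel"
  shows "(\<integral>\<^sup>+t\<in>{0<..}. g t * ennreal (f t) \<partial>lborel) = (\<integral>\<^sup>+y\<in>{0<..}. (\<integral>\<^sup>+t\<in>{0<..<c y}. g t \<partial>lborel) \<partial>lborel)"
proof -
  have "(\<integral>\<^sup>+t\<in>{0<..}. g t * ennreal (f t) \<partial>lborel) =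
    (\<integral>\<^sup>+t. (\<integral>\<^sup>+y. g t * (indicator {t. 0 < t \<and> y < f t} t * indicator {0<..} y) \<partial>lborel) \<partial>lborel)"
  proof (intro nn_integral_cong)
    fix t
    have "(\<integral>\<^sup>+y. g t * (indicator {t. 0 < t \<and> y < f t} t * indicator {0<..} y) \<partial>lborel) =
       (\<integral>\<^sup>+y. (g t * indicator {0<..} t) * indicator {0<..<f t} y \<partial>lborel)"
      by (intro nn_integral_cong) (auto simp: indicator_def)
    also have "\<dots> = g t * ennreal (f t) * indicator {0<..} t"
      using f_nonneg[of t] by (subst nn_integral_cmult_indicator) (auto simp: indicator_def)
    finally show "g t * ennreal (f t) * indicator {0<..} t = (\<integral>\<^sup>+y. g t * (indicator {t. 0 < t \<and> y < f t} t * indicator {0<..} y) \<partial>lborel)" ..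
  qed
  also have "\<dots> = (\<integral>\<^sup>+y. (\<integral>\<^sup>+t. g t * (indicator {t. 0 < t \<and> y < f t} t * indicator {0<..} y) \<partial>lborel) \<partial>lborel)"
  proof (intro lborel_pair.Fubini')
    show "(\<lambda>(y, t). g t * (indicator {t. 0 < t \<and> y < f t} t * indicator {0<..} y)) \<in> borel_measurable (lborel \<Otimes>\<^sub>M lborel)"
      unfolding case_prod_beta using superlevel_measurable by measurable
  qed
  also have "\<dots> = (\<integral>\<^sup>+y\<in>{0<..}. (\<integral>\<^sup>+t\<in>{0<..<c y}. g t \<partial>lborel) \<partial>lborel)"
  proof (intro nn_integral_cong)
    fix y :: real
    show "(\<integral>\<^sup>+t. g t * (indicator {t. 0 < t \<and> y < f t} t * indicator {0<..} y) \<partial>lborel) = (\<integral>\<^sup>+t\<in>{0<..<c y}. g t \<partial>lborel) * indicator {0<..} y"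
    proof (cases "y > 0")
      case True
      have "(\<integral>\<^sup>+t. g t * (indicator {t. 0 < t \<and> y < f t} t * indicator {0<..} y) \<partial>lborel) = (\<integral>\<^sup>+t\<in>{0<..<c y}. g t \<partial>lborel)"
        using AE_lborel_singleton[of "c y"]
      proof (intro nn_integral_cong_AE, eventually_elim)
        case (elim t)
        have "t \<in> {t. 0 < t \<and> y < f t} \<longleftrightarrow> t \<in> {0<..<c y}"
          using superlevel_interval[OF True] elim by fastforce
        thus ?case using True by (simp only: indicator_def greaterThan_iff of_bool_eq mult_1_right)
      qed
      thus ?thesis using True by simp
    qed simp
  qed
  finally show ?thesis .
qed

text \<open>An integral against f is a superposition over the levels y of integrals over (0, c y);
  \<open>G\<close> supplies their values.\<close>

lemma layer_cake_real:
  fixes g G :: "real \<Rightarrow> real"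
  assumes [measurable]: "g \<in> borel_measurable borel" "G \<in> borel_measurable borel"
    and int: "set_integrable lborel {0<..} (\<lambda>t. g t * f t)"
    and g: "\<And>t. t > 0 \<Longrightarrow> g t \<ge> 0" and G0: "\<And>b. b \<ge> 0 \<Longrightarrow> G b \<ge> 0"
    and G: "\<And>b. b \<ge> 0 \<Longrightarrow> (\<integral>\<^sup>+t\<in>{0<..<b}. ennreal (g t) \<partial>lborel) = ennreal (G b)"
  shows "set_integrable lborel {0<..} (\<lambda>y. G (c y))"
    "(LINT y:{0<..}|lborel. G (c y)) = (LINT t:{0<..}|lborel. g t * f t)"
proof -
  have "(\<integral>\<^sup>+y. ennreal (indicator {0<..} y *\<^sub>R G (c y)) \<partial>lborel) = (\<integral>\<^sup>+y\<in>{0<..}. (\<integral>\<^sup>+t\<in>{0<..<c y}. ennreal (g t) \<partial>lborel) \<partial>lborel)"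
    using G[OF c_nonneg] by (intro nn_integral_cong) (auto simp: indicator_def)
  also have "\<dots> = (\<integral>\<^sup>+t\<in>{0<..}. ennreal (g t) * ennreal (f t) \<partial>lborel)"
    by (rule layer_cake[symmetric]) simp
  also have "\<dots> = (\<integral>\<^sup>+t. ennreal (indicator {0<..} t *\<^sub>R (g t * f t)) \<partial>lborel)"
  proof (intro nn_integral_cong)
    fix t :: real
    show "ennreal (g t) * ennreal (f t) * indicator {0<..} t = ennreal (indicator {0<..} t *\<^sub>R (g t * f t))"
      using g[of t] f_nonneg[of t] by (cases "t > 0") (simp_all add: ennreal_mult)
  qed
  also have "\<dots> = ennreal (LINT t:{0<..}|lborel. g t * f t)"
    unfolding set_lebesgue_integral_def using g f_nonneg
    by (intro nn_integral_eq_integral int[unfolded set_integrable_def]) (auto simp: indicator_def)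
  finally have "has_bochner_integral lborel (\<lambda>y. indicator {0<..} y *\<^sub>R G (c y)) (LINT t:{0<..}|lborel. g t * f t)"
    using set_integral_f_nonneg[of "{0<..}" g] g G0 c_nonneg
    by (intro has_bochner_integral_nn_integral) (auto simp: indicator_def)
  note hb = this[unfolded has_bochner_integral_iff]
  show "set_integrable lborel {0<..} (\<lambda>y. G (c y))"
    using hb unfolding set_integrable_def by (rule conjunct1)
  show "(LINT y:{0<..}|lborel. G (c y)) = (LINT t:{0<..}|lborel. g t * f t)"
    using hb unfolding set_lebesgue_integral_def by (rule conjunct2)
qed

lemma layer_cake_power:
  assumes k: "k > 0" and int: "set_integrable lborel {0<..} (\<lambda>t. t ^ (k - 1) * f t)"
  shows "set_integrable lborel {0<..} (\<lambda>y. c y ^ k)"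
    "(LINT y:{0<..}|lborel. c y ^ k) = real k * (LINT t:{0<..}|lborel. t ^ (k - 1) * f t)"
proof -
  have G: "(\<integral>\<^sup>+t\<in>{0<..<b}. ennreal (t ^ (k - 1)) \<partial>lborel) = ennreal (b ^ k / real k)" if b: "b \<ge> 0" for b
  proof -
    have "(\<integral>\<^sup>+t\<in>{0<..<b}. ennreal (t ^ (k - 1)) \<partial>lborel) = (\<integral>\<^sup>+ s. ennreal (1 / real k * real k * s ^ (k - 1)) * indicator {0..b} s \<partial>lborel)"
      using AE_lborel_singleton[of "0::real"] AE_lborel_singleton[of b] k
      by (intro nn_integral_cong_AE) (auto simp: indicator_def)
    also have "\<dots> = ennreal (1 / real k * b ^ k)" using b k by (intro nn_integral_power_Icc) auto
    finally show ?thesis by simp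
  qed
  note * = layer_cake_real[of "\<lambda>t. t ^ (k - 1)" "\<lambda>b. b ^ k / real k", OF _ _ int _ _ G, simplified]
  show "set_integrable lborel {0<..} (\<lambda>y. c y ^ k)" using *(1) k by simp
  have "(LINT y:{0<..}|lborel. c y ^ k) / real k = (LINT t:{0<..}|lborel. t ^ (k - 1) * f t)"
    using *(2) by simp
  thus "(LINT y:{0<..}|lborel. c y ^ k) = real k * (LINT t:{0<..}|lborel. t ^ (k - 1) * f t)"
    using k by (simp add: field_simps)
qed

text \<open>Chebyshev is applied over the levels y, with weights c^(p-2) and c^p against S(c) /
  c^(p-2), nondecreasing in c by \<open>S_power_mono\<close>. The weights integrate to (p - 2) Im2
  and p I. Comparing the integral of c^2 S(c) with HF costs p + 2, and (p - 2) (p + 2) is the p^2 -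
  4 of the criterion.\<close>

lemma star_antimono:
  assumes m: "((real p)\<^sup>2 - 4) * (I2 * Im2) \<le> 2 * (real p)\<^sup>2 * I\<^sup>2"
  shows "I2 * Hh \<le> 2 * real p * I * HF"
proof -
  let ?a = "\<lambda>y. indicator {0<..} y *\<^sub>R (c y ^ (p - 2))"
  let ?b = "\<lambda>y. indicator {0<..} y *\<^sub>R (c y ^ p)"
  \<comment> \<open>At levels with \<open>c y = 0\<close> the quotient is 0 by convention; since
    \<open>S 0 = 0\<close>, the products with \<open>?a\<close> and \<open>?b\<close> are still the
    intended ones.\<close>
  let ?k = "\<lambda>y. S (c y) / c y ^ (p - 2)"
  let ?Y = "LINT y:{0<..}|lborel. (c y)\<^sup>2 * S (c y)"
  have q: "p - 2 - 1 = p - 3" "real (p - 2) = real p - 2" "p - 2 > 0" "p > 0" "p + 2 - 1 = p + 1" using p_ge by auto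
  have cp: "set_integrable lborel {0<..} (\<lambda>y. c y ^ p)" "(LINT y:{0<..}|lborel. c y ^ p) = real p * I"
    using layer_cake_power[of p] mass_int q by (simp_all add: I_def)
  have cm: "set_integrable lborel {0<..} (\<lambda>y. c y ^ (p - 2))" "(LINT y:{0<..}|lborel. c y ^ (p - 2)) = (real p - 2) * Im2"
    using layer_cake_power[of "p - 2"] intm2 q by (simp_all add: Im2_def)
  have c2: "set_integrable lborel {0<..} (\<lambda>y. c y ^ (p + 2))"
    using layer_cake_power(1)[of "p + 2"] int2 by simp
  have Sc: "set_integrable lborel {0<..} (\<lambda>y. S (c y))" "(LINT y:{0<..}|lborel. S (c y)) = Hh"
  proof -
    have e: "t ^ (p - 1) * h t * f t = t ^ (p - 1) * f t * h t" for t by simp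
    have i: "set_integrable lborel {0<..} (\<lambda>t. t ^ (p - 1) * h t * f t)" using Hh_int by (simp only: e)
    have g: "t ^ (p - 1) * h t \<ge> 0" if "t > 0" for t using that h_nonneg[of t] by simp
    note * = layer_cake_real[of "\<lambda>t. t ^ (p - 1) * h t" S, OF _ _ i g S_nonneg nn_S]
    show "set_integrable lborel {0<..} (\<lambda>y. S (c y))" by (rule *(1)) simp_all
    have "(LINT y:{0<..}|lborel. S (c y)) = (LINT t:{0<..}|lborel. t ^ (p - 1) * h t * f t)" by (rule *(2)) simp_all
    thus "(LINT y:{0<..}|lborel. S (c y)) = Hh" by (simp only: e Hh_def)
  qed
  have S0: "S 0 = 0" by (simp add: S_def set_lebesgue_integral_def)
  have iY: "set_integrable lborel {0<..} (\<lambda>y. (c y)\<^sup>2 * S (c y))"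
  proof (rule set_integrable_bound[OF c2])
    show "set_borel_measurable lborel {0<..} (\<lambda>y. (c y)\<^sup>2 * S (c y))" unfolding set_borel_measurable_def by measurable
    show "AE y in lborel. y \<in> {0<..} \<longrightarrow> norm ((c y)\<^sup>2 * S (c y)) \<le> norm (c y ^ (p + 2))"
    proof (intro AE_I2 impI)
      fix y
      have "(c y)\<^sup>2 * S (c y) \<le> (c y)\<^sup>2 * c y ^ p" using S_le[OF c_nonneg] by (intro mult_left_mono) auto
      also have "\<dots> = c y ^ (p + 2)" by (intro power_split[symmetric]) simp
      finally show "norm ((c y)\<^sup>2 * S (c y)) \<le> norm (c y ^ (p + 2))"
        using c_nonneg[of y] S_nonneg[of "c y"] by (simp add: abs_mult del: power_add)
    qed
  qed
  have ak: "?a y * ?k y = indicator {0<..} y *\<^sub>R S (c y)" for y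
    using p_ge by (cases "c y = 0") (auto simp: S0 zero_power)
  have bk: "?b y * ?k y = indicator {0<..} y *\<^sub>R ((c y)\<^sup>2 * S (c y))" for y
  proof (cases "c y = 0")
    case False
    have "c y ^ p = (c y)\<^sup>2 * c y ^ (p - 2)" using p_ge by (intro power_split) simp
    thus ?thesis using False by simp
  qed (use p_ge in \<open>simp add: zero_power\<close>)
  have "(\<integral>y. ?b y \<partial>lborel) * (\<integral>y. ?a y * ?k y \<partial>lborel) \<le> (\<integral>y. ?b y * ?k y \<partial>lborel) * (\<integral>y. ?a y \<partial>lborel)"
  proof (rule chebyshev_integral_inequality)
    show "integrable lborel ?a" using cm(1) unfolding set_integrable_def .
    show "integrable lborel ?b" using cp(1) unfolding set_integrable_def .
    show "integrable lborel (\<lambda>y. ?a y * ?k y)" using Sc(1) unfolding set_integrable_def ak .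
    show "integrable lborel (\<lambda>y. ?b y * ?k y)" using iY unfolding set_integrable_def bk .
    fix x y :: real
    show "0 \<le> (?b x * ?a y - ?b y * ?a x) * (?k x - ?k y)"
    proof (cases "x > 0 \<and> y > 0 \<and> c x > 0 \<and> c y > 0")
      case True
      have e: "z ^ p = z ^ (p - 2) * z\<^sup>2" for z :: real using p_ge by (intro power_split) simp
      have "?b x * ?a y - ?b y * ?a x = (c x ^ (p - 2) * c y ^ (p - 2)) * ((c x)\<^sup>2 - (c y)\<^sup>2)"
        unfolding e using True by (simp add: algebra_simps)
      hence mult: "(?b x * ?a y - ?b y * ?a x) * (?k x - ?k y) = (c x ^ (p - 2) * c y ^ (p - 2)) * (((c x)\<^sup>2 - (c y)\<^sup>2) * (?k x - ?k y))"
        by (simp only: mult.assoc)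
      have "0 \<le> c x ^ (p - 2) * c y ^ (p - 2)" using True by simp
      have km: "?k x \<le> ?k y" if "c x \<le> c y" "c x > 0" for x y
        using S_power_mono[of "c x" "c y"] that by (simp add: field_simps)
      have "0 \<le> ((c x)\<^sup>2 - (c y)\<^sup>2) * (?k x - ?k y)"
      proof (cases "c x \<le> c y")
        case le: True
        hence "(c x)\<^sup>2 \<le> (c y)\<^sup>2" using True by (intro power_mono) auto
        thus ?thesis using km[OF le] True by (intro mult_nonpos_nonpos) auto
      next
        case False
        hence "(c y)\<^sup>2 \<le> (c x)\<^sup>2" using True by (intro power_mono) auto
        thus ?thesis using km[of y x] False True by (intro mult_nonneg_nonneg) auto
      qed
      thus ?thesis unfolding mult using \<open>0 \<le> c x ^ (p - 2) * c y ^ (p - 2)\<close> by (rule mult_nonneg_nonneg[rotated])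
    next
      case False
      hence "x \<le> 0 \<or> y \<le> 0 \<or> c x = 0 \<or> c y = 0" using c_nonneg[of x] c_nonneg[of y] by linarith
      hence "(?b x = 0 \<and> ?a x = 0) \<or> (?b y = 0 \<and> ?a y = 0)"
        using p_ge by (elim disjE) (simp_all add: indicator_def)
      thus ?thesis
        by (elim disjE conjE) (simp_all only: mult_zero_left mult_zero_right diff_0_right order_refl)
    qed
  qed
  hence A1: "real p * I * Hh \<le> ?Y * ((real p - 2) * Im2)"
    unfolding ak bk using cp(2) cm(2) Sc(2) by (simp add: set_lebesgue_integral_def)
  \<comment> \<open>For t < c monotonicity of S / t^p gives S t \<ge> S(c) (t / c)^p, so t S t
    integrates over (0, c) to at least c^2 S(c) / (p + 2).\<close>
  have A2: "?Y \<le> (real p + 2) * HF"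
  proof -
    have "ennreal (?Y / (real p + 2)) = (\<integral>\<^sup>+y. ennreal (indicator {0<..} y *\<^sub>R ((c y)\<^sup>2 * S (c y)) / (real p + 2)) \<partial>lborel)"
      unfolding set_lebesgue_integral_def integral_divide_zero[symmetric] using S_nonneg
      by (intro nn_integral_eq_integral[symmetric] integrable_divide iY[unfolded set_integrable_def]) (auto simp: indicator_def)
    also have "\<dots> \<le> (\<integral>\<^sup>+y\<in>{0<..}. (\<integral>\<^sup>+t\<in>{0<..<c y}. ennreal (t * S t) \<partial>lborel) \<partial>lborel)"
    proof (rule nn_integral_mono)
      fix y
      show "ennreal (indicator {0<..} y *\<^sub>R ((c y)\<^sup>2 * S (c y)) / (real p + 2)) \<le> (\<integral>\<^sup>+t\<in>{0<..<c y}. ennreal (t * S t) \<partial>lborel) * indicator {0<..} y"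
      proof (cases "y > 0 \<and> c y > 0")
        case True
        define b where "b = c y"
        have b: "b > 0" using True by (simp add: b_def)
        have "(\<integral>\<^sup>+ s. ennreal (S b / (b ^ p * real (p + 2)) * real (p + 2) * s ^ (p + 2 - 1)) * indicator {0..b} s \<partial>lborel) = ennreal (S b / (b ^ p * real (p + 2)) * b ^ (p + 2))"
          using b S_nonneg by (intro nn_integral_power_Icc) auto
        hence "ennreal (S b / (b ^ p * real (p + 2)) * b ^ (p + 2)) = (\<integral>\<^sup>+ s. ennreal (S b / (b ^ p * real (p + 2)) * real (p + 2) * s ^ (p + 2 - 1)) * indicator {0..b} s \<partial>lborel)" ..
        also have "\<dots> \<le> (\<integral>\<^sup>+t\<in>{0<..<b}. ennreal (t * S t) \<partial>lborel)"
        proof (rule nn_integral_mono_AE)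
          show "AE s in lborel. ennreal (S b / (b ^ p * real (p + 2)) * real (p + 2) * s ^ (p + 2 - 1)) * indicator {0..b} s \<le> ennreal (s * S s) * indicator {0<..<b} s"
            using AE_lborel_singleton[of "0::real"] AE_lborel_singleton[of b]
          proof eventually_elim
            case (elim s)
            show ?case
            proof (cases "s \<in> {0<..<b}")
              case True
              have "S b * s ^ p \<le> S s * b ^ p" using S_power_antimono[of s b] True by simp
              hence "S b / b ^ p * s ^ p \<le> S s" using b by (simp add: field_simps)
              hence "s * (S b / b ^ p * s ^ p) \<le> s * S s" using True by (intro mult_left_mono) auto
              moreover have "S b / (b ^ p * real (p + 2)) * real (p + 2) * s ^ (p + 2 - 1) = s * (S b / b ^ p * s ^ p)"
                by simp
              ultimately show ?thesis using True by (simp only: indicator_simps) (auto intro: ennreal_leI)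
            qed (use elim in auto)
          qed
        qed
        also have "S b / (b ^ p * real (p + 2)) * b ^ (p + 2) = b\<^sup>2 * S b / (real p + 2)" using b by (simp add: power_add power2_eq_square add.commute mult.commute)
        finally show ?thesis using True by (simp add: b_def)
      next
        case False
        hence "y \<le> 0 \<or> c y = 0" using c_nonneg[of y] by linarith
        thus ?thesis by (auto simp: indicator_def)
      qed
    qed
    also have "\<dots> = (\<integral>\<^sup>+t\<in>{0<..}. ennreal (t * S t) * ennreal (f t) \<partial>lborel)"
      by (rule layer_cake[symmetric]) simp
    also have "\<dots> = (\<integral>\<^sup>+t. ennreal (indicator {0<..} t *\<^sub>R (t * f t * S t)) \<partial>lborel)"
    proof (intro nn_integral_cong)
      fix t :: real
      show "ennreal (t * S t) * ennreal (f t) * indicator {0<..} t = ennreal (indicator {0<..} t *\<^sub>R (t * f t * S t))"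
        using f_nonneg[of t] S_nonneg[of t] by (cases "t > 0") (simp_all add: mult_ac flip: ennreal_mult)
    qed
    also have "\<dots> = ennreal HF"
      unfolding HF_def set_lebesgue_integral_def using f_nonneg S_nonneg
      by (intro nn_integral_eq_integral HF_int[unfolded set_integrable_def]) (auto simp: indicator_def)
    finally have "?Y / (real p + 2) \<le> HF" using HF_nonneg by (simp add: ennreal_le_iff)
    thus ?thesis by (simp add: field_simps)
  qed
  have "real p * I * Hh \<le> ((real p + 2) * HF) * ((real p - 2) * Im2)"
    by (rule order_trans[OF A1 mult_right_mono[OF A2]]) (use Im2_nonneg p_ge in simp)
  hence "I2 * (real p * I * Hh) \<le> I2 * (((real p + 2) * HF) * ((real p - 2) * Im2))"
    using I2_nonneg by (rule mult_left_mono)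
  also have "\<dots> = ((real p)\<^sup>2 - 4) * (I2 * Im2) * HF" by (simp add: power2_eq_square algebra_simps)
  also have "\<dots> \<le> 2 * (real p)\<^sup>2 * I\<^sup>2 * HF" using m HF_nonneg by (rule mult_right_mono)
  finally have "(real p * I) * (I2 * Hh) \<le> (real p * I) * (2 * real p * I * HF)"
    by (simp add: power2_eq_square mult_ac)
  thus ?thesis using I_pos p_ge by simp
qed

end
end

section \<open>The Bayes estimator\<close>

lemma AE_unif_ball_nonzero: "AE z in unif_ball. (z::'a::euclidean_space) \<noteq> 0"
  using AE_lborel_singleton[of "0::'a"] unfolding unif_ball_def
  by (intro AE_uniform_measureI) auto

text \<open>A unit vector with cosine -1 to \<open>e\<close> is \<open>- e\<close>, so the
  exceptional set lies on a line. This provides \<open>u_ne\<close>.\<close>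

lemma sgn_eq_minus_negligible:
  fixes e :: "'a::euclidean_space"
  assumes e: "norm e = 1" and dim: "DIM('a) \<ge> 2"
  shows "AE z in lborel. sgn z \<bullet> e \<noteq> -1"
proof -
  let ?S = "{z::'a. sgn z \<bullet> e = -1}"
  have "?S \<subseteq> span {e}"
  proof
    fix z assume z: "z \<in> ?S"
    hence z0: "z \<noteq> 0" by auto
    have "(norm (sgn z + e))\<^sup>2 = (norm (sgn z))\<^sup>2 + 2 * (sgn z \<bullet> e) + (norm e)\<^sup>2"
      by (simp add: power2_norm_eq_inner inner_add_left inner_add_right inner_commute)
    also have "\<dots> = 0" using z z0 e by (simp add: norm_sgn)
    finally have "sgn z = - e" by (simp add: eq_neg_iff_add_eq_0)
    moreover have "z = norm z *\<^sub>R sgn z" using z0 by (simp add: sgn_div_norm)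
    ultimately have "z = - norm z *\<^sub>R e" by simp
    thus "z \<in> span {e}" by (metis span_base span_mul singletonI)
  qed
  moreover have "negligible (span {e})"
  proof (rule negligible_lowdim)
    have "dim (span {e}) \<le> card {e}" unfolding dim_span by (rule dim_le_card') simp
    thus "dim (span {e}) < DIM('a)" using dim by simp
  qed
  ultimately have "negligible ?S" by (rule negligible_subset[rotated])
  hence "?S \<in> null_sets lebesgue" by (simp add: negligible_iff_null_sets)
  moreover have "?S \<in> sets borel" by measurable
  ultimately have "?S \<in> null_sets lborel" using null_sets_completion_iff[of ?S lborel] by simp
  thus ?thesis by (rule AE_I'[where P="\<lambda>z. sgn z \<bullet> e \<noteq> -1"]) auto
qed

lemma sphere_coord_unif_ball:
  fixes e :: "'a::euclidean_space"
  assumes e: "norm e = 1" and dim: "DIM('a) \<ge> 4"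
  shows "sphere_coord unif_ball (\<lambda>z. sgn z \<bullet> e) DIM('a)"
proof -
  interpret U: prob_space "unif_ball :: 'a measure" by (rule prob_space_unif_ball)
  show ?thesis
  proof
    show "(\<lambda>z. sgn z \<bullet> e) \<in> borel_measurable unif_ball" by measurable
    show "sgn z \<bullet> e \<in> {-1..1}" for z using abs_sgn_inner_le_1[OF e, of z] by auto
    show "DIM('a) \<ge> 4" by fact
    show "AE z in unif_ball. sgn z \<bullet> e \<noteq> -1"
      using sgn_eq_minus_negligible[OF e] dim unfolding unif_ball_def
      by (intro AE_uniform_measureI) (auto elim: eventually_mono)
    fix g g' :: "real \<Rightarrow> real"
    assume "\<And>v. v \<in> {-1..1} \<Longrightarrow> (g has_real_derivative g' v) (at v within {-1..1})" "continuous_on {-1..1} g'"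
    thus "(\<integral>z. (1 - (sgn z \<bullet> e)\<^sup>2) * g' (sgn z \<bullet> e) \<partial>unif_ball) = (real DIM('a) - 1) * (\<integral>z. (sgn z \<bullet> e) * g (sgn z \<bullet> e) \<partial>unif_ball)"
      using dim by (intro sphere_integration_by_parts e) auto
  qed
qed

lemma norm_add_sgn:
  fixes e z :: "'a::euclidean_space"
  assumes "norm e = 1" "z \<noteq> 0"
  shows "norm (a *\<^sub>R e + t *\<^sub>R sgn z) = rad a t (sgn z \<bullet> e)"
proof -
  have "(norm (a *\<^sub>R e + t *\<^sub>R sgn z))\<^sup>2 = a\<^sup>2 * (norm e)\<^sup>2 + t\<^sup>2 * (norm (sgn z))\<^sup>2 + 2 * a * t * (sgn z \<bullet> e)"
    unfolding power2_norm_eq_inner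
    by (simp add: inner_add_left inner_add_right inner_commute power2_eq_square algebra_simps)
  hence "(norm (a *\<^sub>R e + t *\<^sub>R sgn z))\<^sup>2 = a\<^sup>2 + t\<^sup>2 + 2 * a * t * (sgn z \<bullet> e)"
    using assms by (simp add: norm_sgn)
  thus ?thesis unfolding rad_def by (metis norm_ge_zero real_sqrt_abs abs_of_nonneg)
qed

section \<open>Invariance of Lebesgue measure under translations and involutive isometries\<close>

lemma nn_integral_lborel_shift:
  fixes G :: "'a::euclidean_space \<Rightarrow> ennreal"
  assumes [measurable]: "G \<in> borel_measurable borel"
  shows "(\<integral>\<^sup>+x. G x \<partial>lborel) = (\<integral>\<^sup>+z. G (a + z) \<partial>lborel)"
proof -
  have "(\<integral>\<^sup>+x. G x \<partial>lborel) = (\<integral>\<^sup>+x. G x \<partial>distr lborel borel ((+) a))" by (simp only: lborel_distr_plus)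
  also have "\<dots> = (\<integral>\<^sup>+z. G (a + z) \<partial>lborel)" by (subst nn_integral_distr) auto
  finally show ?thesis .
qed

lemma integral_lborel_shift:
  fixes G :: "'a::euclidean_space \<Rightarrow> 'b::{banach, second_countable_topology}"
  assumes [measurable]: "G \<in> borel_measurable borel"
  shows "(\<integral>x. G x \<partial>lborel) = (\<integral>z. G (a + z) \<partial>lborel)"
proof -
  have "(\<integral>x. G x \<partial>lborel) = (\<integral>x. G x \<partial>distr lborel borel ((+) a))" by (simp only: lborel_distr_plus)
  also have "\<dots> = (\<integral>z. G (a + z) \<partial>lborel)" by (subst integral_distr) auto
  finally show ?thesis .
qed

text \<open>
  The uniqueness argument for Haar measure: convolving the indicators of the unit ball and of \<open>A\<close>
  in two ways compares the two measures.
\<close>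
lemma lborel_distr_involutive_isometry:
  fixes T :: "'a::euclidean_space \<Rightarrow> 'a"
  assumes lin: "linear T" and inv: "\<And>x. T (T x) = x" and iso: "\<And>x. norm (T x) = norm x"
  shows "distr lborel borel T = lborel"
proof (rule measure_eqI)
  fix A assume "A \<in> sets (distr lborel borel T)"
  hence A [measurable]: "A \<in> sets borel" by simp
  have [measurable]: "T \<in> borel_measurable borel"
    using linear_continuous_on[OF lin[unfolded linear_conv_bounded_linear]] by (rule borel_measurable_continuous_onI)
  have [measurable]: "ball (0::'a) 1 \<in> sets borel" by simp
  let ?c = "emeasure lborel (ball (0::'a) 1)"
  have c: "?c \<noteq> 0" "?c \<noteq> \<infinity>"
  proof -
    have "?c = ennreal (measure lborel (ball (0::'a) 1))"
      using emeasure_lborel_ball_finite[of "0::'a" 1] by (intro emeasure_eq_ennreal_measure) auto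
    thus "?c \<noteq> 0" "?c \<noteq> \<infinity>" using content_ball_gt_0_iff[of "0::'a" 1] by auto
  qed
  \<comment> \<open>As \<open>T\<close> is a linear involution,
    \<open>x + T y = T (T x + y)\<close>, and translation invariance removes
    \<open>T x\<close>.\<close>
  have T1: "(\<integral>\<^sup>+y. indicator A (x + T y) \<partial>lborel) = emeasure (distr lborel borel T) A" for x
  proof -
    have "(\<integral>\<^sup>+y. indicator A (x + T y) \<partial>lborel) = (\<integral>\<^sup>+y. indicator A (T (T x + y)) \<partial>lborel)"
      by (simp add: linear_add[OF lin] inv)
    also have "\<dots> = (\<integral>\<^sup>+y. indicator A (T y) \<partial>lborel)"
      by (rule nn_integral_lborel_shift[symmetric]) measurable
    also have "\<dots> = (\<integral>\<^sup>+y. indicator A y \<partial>distr lborel borel T)"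
      by (subst nn_integral_distr) auto
    finally show ?thesis by simp
  qed
  have T2: "(\<integral>\<^sup>+y. indicator (ball 0 1) (x - T y) \<partial>lborel) = ?c" for x
  proof -
    have "norm (x - T y) = norm (- T x + y)" for y
      using iso[of "T x - y"] by (simp add: linear_diff[OF lin] inv norm_minus_commute)
    hence "(\<integral>\<^sup>+y. indicator (ball 0 1) (x - T y) \<partial>lborel) = (\<integral>\<^sup>+y. indicator (ball 0 1) (- T x + y) \<partial>lborel)"
      by (intro nn_integral_cong) (simp add: indicator_def)
    also have "\<dots> = (\<integral>\<^sup>+y. indicator (ball (0::'a) 1) y \<partial>lborel)"
      by (rule nn_integral_lborel_shift[symmetric]) measurable
    finally show ?thesis by simp
  qed
  have "?c * emeasure (distr lborel borel T) A = (\<integral>\<^sup>+x. indicator (ball 0 1) x * (\<integral>\<^sup>+y. indicator A (x + T y) \<partial>lborel) \<partial>lborel)"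
    unfolding T1 by (subst nn_integral_multc) auto
  also have "\<dots> = (\<integral>\<^sup>+x. (\<integral>\<^sup>+y. indicator (ball 0 1) x * indicator A (x + T y) \<partial>lborel) \<partial>lborel)"
    by (subst nn_integral_cmult) auto
  also have "\<dots> = (\<integral>\<^sup>+y. (\<integral>\<^sup>+x. indicator (ball 0 1) x * indicator A (x + T y) \<partial>lborel) \<partial>lborel)"
    by (intro lborel_pair.Fubini') measurable
  also have "\<dots> = (\<integral>\<^sup>+y. (\<integral>\<^sup>+x. indicator (ball 0 1) (x - T y) * indicator A x \<partial>lborel) \<partial>lborel)"
  proof (rule nn_integral_cong)
    fix y
    show "(\<integral>\<^sup>+x. indicator (ball 0 1) x * indicator A (x + T y) \<partial>lborel) = (\<integral>\<^sup>+x. indicator (ball 0 1) (x - T y) * indicator A x \<partial>lborel)"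
      by (subst nn_integral_lborel_shift[where a="T y"]) (simp_all add: add.commute)
  qed
  also have "\<dots> = (\<integral>\<^sup>+x. (\<integral>\<^sup>+y. indicator (ball 0 1) (x - T y) * indicator A x \<partial>lborel) \<partial>lborel)"
    by (intro lborel_pair.Fubini') measurable
  also have "\<dots> = (\<integral>\<^sup>+x. ?c * indicator A x \<partial>lborel)"
    by (simp add: nn_integral_multc T2)
  also have "\<dots> = ?c * emeasure lborel A"
    by (subst nn_integral_cmult_indicator) auto
  finally show "emeasure (distr lborel borel T) A = emeasure lborel A"
    using c by (simp add: ennreal_mult_cancel_left)
qed simp

text \<open>The map fixes \<open>e\<close> and negates its orthogonal complement; it will show that
  the posterior mean is parallel to the observation.\<close>

lemma lborel_distr_axial_reflection:
  fixes e :: "'a::euclidean_space"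
  assumes e: "norm e = 1"
  shows "distr lborel borel (\<lambda>z. (2 * (z \<bullet> e)) *\<^sub>R e - z) = lborel"
proof (rule lborel_distr_involutive_isometry)
  have ee: "e \<bullet> e = 1" using e by (simp add: norm_eq_1)
  show "linear (\<lambda>z. (2 * (z \<bullet> e)) *\<^sub>R e - z)" by (intro linearI) (auto simp: inner_add_left algebra_simps)
  show "(2 * (((2 * (x \<bullet> e)) *\<^sub>R e - x) \<bullet> e)) *\<^sub>R e - ((2 * (x \<bullet> e)) *\<^sub>R e - x) = x" for x
    by (simp add: inner_diff_left ee algebra_simps)
  show "norm ((2 * (x \<bullet> e)) *\<^sub>R e - x) = norm x" for x
    unfolding norm_eq_sqrt_inner by (simp add: inner_diff_left inner_diff_right ee algebra_simps inner_commute)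
qed

text \<open>Divide by R^k and let R grow: balls of radii R - K and R have asymptotically equal
  volumes.\<close>

lemma le_of_power_ratio_le:
  fixes m c K :: real
  assumes "\<And>R. R > K \<Longrightarrow> m * (R - K) ^ k \<le> c * R ^ k" and K: "K \<ge> 0"
  shows "m \<le> c"
proof -
  have "((\<lambda>R. m * (1 - K / R) ^ k) \<longlongrightarrow> m * (1 - 0) ^ k) at_top"
    by (intro tendsto_intros tendsto_divide_0[OF tendsto_const] filterlim_at_top_imp_at_infinity filterlim_ident)
  moreover have "eventually (\<lambda>R. m * (1 - K / R) ^ k \<le> c) at_top"
    using eventually_gt_at_top[of K]
  proof eventually_elim
    case (elim R)
    hence "m * (R - K) ^ k / R ^ k \<le> c" using assms(1)[OF elim] K by (simp add: divide_le_eq)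
    moreover have "(1 - K / R) ^ k = (R - K) ^ k / R ^ k" using elim K by (simp add: field_simps flip: power_divide)
    ultimately show ?case by simp
  qed
  ultimately have "m * (1 - 0) ^ k \<le> c" by (intro tendsto_upperbound[of _ _ at_top]) auto
  thus ?thesis by simp
qed

text \<open>In \<open>ennreal\<close> 0 times infinity is 0, so a finite product makes both factors
  finite only when neither is 0.\<close>

lemma finite_of_ennreal_mult_le:
  assumes "x * y \<le> ennreal r" "x \<noteq> 0" "y \<noteq> (0 :: ennreal)"
  shows "x < \<infinity>" "y < \<infinity>"
  using assms by (auto simp: less_top[symmetric] ennreal_top_mult ennreal_mult_top top_unique)

lemma powi_minus_2: "t powi (-2) = inverse ((t::real)\<^sup>2)"
  by (simp add: power_int_def nat_numeral power_inverse)

locale spherical =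
  fixes f :: "real \<Rightarrow> real" and dummy :: "'n::finite itself" and n :: nat and \<sigma> :: real
  assumes dens: "radial_density TYPE('n) f" and dim: "n \<ge> 4"
    and n: "n = CARD('n)" and \<sigma>_def: "\<sigma> = polar_const TYPE(real^'n)"
begin

lemma sigma_pos: "\<sigma> > 0" unfolding \<sigma>_def by (rule polar_const_pos)

lemma f_meas [measurable]: "f \<in> borel_measurable borel" and f_nonneg: "t \<ge> 0 \<Longrightarrow> f t \<ge> 0"
  and f_mass: "(\<integral>\<^sup>+ x. ennreal (f (norm x)) \<partial>(lborel :: (real^'n) measure)) = 1"
  using dens by (auto simp: radial_density_def)

lemma nn_integral_radial:
  assumes [measurable]: "g \<in> borel_measurable borel"
  shows "(\<integral>\<^sup>+ x. g (norm x) \<partial>(lborel :: (real^'n) measure)) = (\<integral>\<^sup>+t\<in>{0<..}. ennreal (\<sigma> * t ^ (n - 1)) * g t \<partial>lborel)"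
proof -
  interpret U: prob_space "unif_ball :: (real^'n) measure" by (rule prob_space_unif_ball)
  have "(\<integral>\<^sup>+ z. g (norm (t *\<^sub>R sgn z :: real^'n)) \<partial>unif_ball) = g t" if "t > 0" for t
  proof -
    have "(\<integral>\<^sup>+ z. g (norm (t *\<^sub>R sgn z :: real^'n)) \<partial>unif_ball) = (\<integral>\<^sup>+ (z :: real^'n). g t \<partial>unif_ball)"
    proof (rule nn_integral_cong_AE)
      show "AE z in unif_ball. g (norm (t *\<^sub>R sgn z :: real^'n)) = g t"
        using AE_unif_ball_nonzero by eventually_elim (use that in \<open>simp add: norm_sgn\<close>)
    qed
    also have "\<dots> = g t" using U.emeasure_space_1 by simp
    finally show ?thesis .
  qed
  thus ?thesis
    by (subst nn_integral_polar) (auto simp: \<sigma>_def n indicator_def intro!: nn_integral_cong)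
qed

lemma expect_0_radial:
  assumes [measurable]: "g \<in> borel_measurable borel" and g: "\<And>t. t > 0 \<Longrightarrow> g t \<ge> 0"
  shows "expect f (0 :: real^'n) (\<lambda>x. g (norm x)) = (\<integral>\<^sup>+t. ennreal (\<sigma> * (indicator {0<..} t *\<^sub>R (t ^ (n - 1) * f t * g t))) \<partial>lborel)"
proof -
  have "expect f (0 :: real^'n) (\<lambda>x. g (norm x)) = (\<integral>\<^sup>+x. ennreal (f (norm x)) * ennreal (g (norm x)) \<partial>(lborel :: (real^'n) measure))"
    unfolding expect_def sph_dist_def by (subst nn_integral_density) auto
  also have "\<dots> = (\<integral>\<^sup>+t\<in>{0<..}. ennreal (\<sigma> * t ^ (n - 1)) * (ennreal (f t) * ennreal (g t)) \<partial>lborel)"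
    by (rule nn_integral_radial) simp
  also have "\<dots> = (\<integral>\<^sup>+t. ennreal (\<sigma> * (indicator {0<..} t *\<^sub>R (t ^ (n - 1) * f t * g t))) \<partial>lborel)"
  proof (intro nn_integral_cong)
    fix t :: real
    show "ennreal (\<sigma> * t ^ (n - 1)) * (ennreal (f t) * ennreal (g t)) * indicator {0<..} t = ennreal (\<sigma> * (indicator {0<..} t *\<^sub>R (t ^ (n - 1) * f t * g t)))"
    proof (cases "t > 0")
      case True
      thus ?thesis using f_nonneg[of t] g[of t] sigma_pos by (simp add: mult_ac flip: ennreal_mult)
    qed simp
  qed
  finally show ?thesis .
qed

lemma radial_moment:
  assumes [measurable]: "g \<in> borel_measurable borel" and g: "\<And>t. t > 0 \<Longrightarrow> g t \<ge> 0"
    and fin: "expect f (0 :: real^'n) (\<lambda>x. g (norm x)) < \<infinity>"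
  shows "set_integrable lborel {0<..} (\<lambda>t. t ^ (n - 1) * f t * g t)"
    "expect f (0 :: real^'n) (\<lambda>x. g (norm x)) = ennreal (\<sigma> * (LINT t:{0<..}|lborel. t ^ (n - 1) * f t * g t))"
proof -
  have eq: "expect f (0 :: real^'n) (\<lambda>x. g (norm x)) = (\<integral>\<^sup>+t. ennreal (\<sigma> * (indicator {0<..} t *\<^sub>R (t ^ (n - 1) * f t * g t))) \<partial>lborel)"
    by (rule expect_0_radial) (use g in auto)
  have "integrable lborel (\<lambda>t. \<sigma> * (indicator {0<..} t *\<^sub>R (t ^ (n - 1) * f t * g t)))"
  proof (rule integrableI_nonneg)
    show "AE t in lborel. 0 \<le> \<sigma> * (indicator {0<..} t *\<^sub>R (t ^ (n - 1) * f t * g t))"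
      using g f_nonneg sigma_pos by (intro AE_I2) (auto simp: indicator_def)
    show "(\<integral>\<^sup>+t. ennreal (\<sigma> * (indicator {0<..} t *\<^sub>R (t ^ (n - 1) * f t * g t))) \<partial>lborel) < \<infinity>"
      using fin unfolding eq .
  qed measurable
  thus i: "set_integrable lborel {0<..} (\<lambda>t. t ^ (n - 1) * f t * g t)"
    using sigma_pos unfolding set_integrable_def by simp
  have "(\<integral>\<^sup>+t. ennreal (\<sigma> * (indicator {0<..} t *\<^sub>R (t ^ (n - 1) * f t * g t))) \<partial>lborel) = ennreal (\<integral>t. \<sigma> * (indicator {0<..} t *\<^sub>R (t ^ (n - 1) * f t * g t)) \<partial>lborel)"
    using i g f_nonneg sigma_pos unfolding set_integrable_def
    by (intro nn_integral_eq_integral integrable_mult_right) (auto simp: indicator_def)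
  thus "expect f (0 :: real^'n) (\<lambda>x. g (norm x)) = ennreal (\<sigma> * (LINT t:{0<..}|lborel. t ^ (n - 1) * f t * g t))"
    unfolding eq set_lebesgue_integral_def by simp
qed

lemma mass:
  "set_integrable lborel {0<..} (\<lambda>t. t ^ (n - 1) * f t)"
  "\<sigma> * (LINT t:{0<..}|lborel. t ^ (n - 1) * f t) = 1"
proof -
  have e: "expect f (0 :: real^'n) (\<lambda>x. 1) = 1"
    unfolding expect_def sph_dist_def using f_mass by (subst nn_integral_density) auto
  show "set_integrable lborel {0<..} (\<lambda>t. t ^ (n - 1) * f t)"
    using radial_moment(1)[of "\<lambda>_. 1"] e by simp
  have "1 = ennreal (\<sigma> * (LINT t:{0<..}|lborel. t ^ (n - 1) * f t))"
    using radial_moment(2)[of "\<lambda>_. 1"] e by simp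
  thus "\<sigma> * (LINT t:{0<..}|lborel. t ^ (n - 1) * f t) = 1"
    by (metis ennreal_eq_1)
qed

sublocale radial_profile f n
proof
  show "0 < (LINT t:{0<..}|lborel. t ^ (n - 1) * f t)"
    using mass(2) sigma_pos by (metis zero_less_mult_pos zero_less_one)
qed (use f_nonneg dim mass in auto)

lemma kernel_eq: "norm x powi (2 - int n) = inverse (norm (x :: real^'n) ^ (n - 2))"
proof -
  have "2 - int n = - int (n - 2)" using dim by simp
  thus ?thesis by (simp only: power_int_minus power_int_of_nat)
qed

lemma nn_integral_direction:
  fixes G :: "real \<Rightarrow> real \<Rightarrow> ennreal" and e :: "real^'n"
  assumes [measurable]: "case_prod G \<in> borel_measurable (borel \<Otimes>\<^sub>M borel)" and e: "norm e = 1"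
  shows "(\<integral>\<^sup>+z. G (norm z) (sgn z \<bullet> e) \<partial>lborel) =
    (\<integral>\<^sup>+t\<in>{0<..}. ennreal (\<sigma> * t ^ (n - 1)) * (\<integral>\<^sup>+z. G t (sgn z \<bullet> e) \<partial>unif_ball) \<partial>lborel)"
proof -
  have [measurable]: "(\<lambda>z::real^'n. G (norm z) (sgn z \<bullet> e)) \<in> borel_measurable borel"
    using measurable_compose[of "\<lambda>z::real^'n. (norm z, sgn z \<bullet> e)" borel "borel \<Otimes>\<^sub>M borel" "case_prod G" borel] by simp
  have "(\<integral>\<^sup>+z. G (norm (t *\<^sub>R sgn z)) (sgn (t *\<^sub>R sgn z) \<bullet> e) \<partial>unif_ball) = (\<integral>\<^sup>+z. G t (sgn z \<bullet> e) \<partial>unif_ball)" if t: "t > 0" for t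
  proof (rule nn_integral_cong_AE)
    show "AE z in unif_ball. G (norm (t *\<^sub>R sgn z)) (sgn (t *\<^sub>R sgn z) \<bullet> e) = G t (sgn z \<bullet> e)"
      using AE_unif_ball_nonzero
    proof eventually_elim
      case (elim z)
      hence "sgn (sgn z) = sgn z" "norm (sgn z) = 1" by (auto simp: sgn_div_norm norm_sgn)
      thus ?case using t by (simp add: sgn_scaleR)
    qed
  qed
  thus ?thesis
    by (subst nn_integral_polar) (auto simp: \<sigma>_def n indicator_def intro!: nn_integral_cong)
qed

lemma integral_direction:
  fixes G :: "real \<Rightarrow> real \<Rightarrow> real" and e :: "real^'n"
  assumes [measurable]: "case_prod G \<in> borel_measurable (borel \<Otimes>\<^sub>M borel)" and e: "norm e = 1"
    and int: "integrable lborel (\<lambda>z. G (norm z) (sgn z \<bullet> e))"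
  shows "(\<integral>z. G (norm z) (sgn z \<bullet> e) \<partial>lborel) =
    (LINT t:{0<..}|lborel. \<sigma> * t ^ (n - 1) * (\<integral>z. G t (sgn z \<bullet> e) \<partial>unif_ball))"
proof -
  have m1: "(\<lambda>z::real^'n. G t (sgn z \<bullet> e)) \<in> borel_measurable borel" for t
    using measurable_compose[of "\<lambda>z::real^'n. (t, sgn z \<bullet> e)" borel "borel \<Otimes>\<^sub>M borel" "case_prod G" borel] by simp
  have m2: "(\<lambda>z::real^'n. G (norm (t *\<^sub>R sgn z)) (sgn (t *\<^sub>R sgn z) \<bullet> e)) \<in> borel_measurable borel" for t
    using measurable_compose[of "\<lambda>z::real^'n. (norm (t *\<^sub>R sgn z), sgn (t *\<^sub>R sgn z) \<bullet> e)" borel "borel \<Otimes>\<^sub>M borel" "case_prod G" borel] by simp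
  have "(\<integral>z. G (norm (t *\<^sub>R sgn z)) (sgn (t *\<^sub>R sgn z) \<bullet> e) \<partial>unif_ball) = (\<integral>z. G t (sgn z \<bullet> e) \<partial>unif_ball)" if t: "t > 0" for t
  proof (rule integral_cong_AE)
    show "AE z in unif_ball. G (norm (t *\<^sub>R sgn z)) (sgn (t *\<^sub>R sgn z) \<bullet> e) = G t (sgn z \<bullet> e)"
      using AE_unif_ball_nonzero
    proof eventually_elim
      case (elim z)
      hence "sgn (sgn z) = sgn z" "norm (sgn z) = 1" by (auto simp: sgn_div_norm norm_sgn)
      thus ?case using t by (simp add: sgn_scaleR)
    qed
  qed (use m1 m2 in \<open>simp_all cong: measurable_cong_sets\<close>)
  thus ?thesis
    by (subst integral_polar[OF int])
       (auto simp: \<sigma>_def n set_lebesgue_integral_def indicator_def intro!: Bochner_Integration.integral_cong)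
qed

section \<open>Posterior moments in the error variable\<close>

lemma norm_shift:
  fixes e z :: "real^'n"
  assumes "norm e = 1" "z \<noteq> 0"
  shows "norm (a *\<^sub>R e + z) = rad a (norm z) (sgn z \<bullet> e)"
proof -
  have "z = norm z *\<^sub>R sgn z" using assms by (simp add: sgn_div_norm)
  thus ?thesis using norm_add_sgn[OF assms, of a "norm z"] by simp
qed

text \<open>The unnormalised posterior density after substituting \<theta> = x + z: the likelihood
  becomes radial in z, and averaging over directions acts only on the harmonic prior.\<close>

definition bden :: "real^'n \<Rightarrow> real^'n \<Rightarrow> real" where
  "bden x z = f (norm z) * inverse (norm (x + z) ^ (n - 2))"

lemma bden_measurable [measurable]: "bden x \<in> borel_measurable borel"
  unfolding bden_def[abs_def] by measurable

lemma bden_nonneg: "bden x z \<ge> 0"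
  using f_nonneg by (simp add: bden_def)

lemma max_min_power:
  fixes a t :: real
  assumes "a > 0" "t > 0"
  shows "t ^ k * inverse (max a t ^ k) = inverse (a ^ k) * min t a ^ k"
proof -
  have "t * a = min t a * max a t" by (auto simp: min_def max_def)
  hence "t ^ k * a ^ k = min t a ^ k * max a t ^ k" by (metis power_mult_distrib)
  moreover have "max a t > 0" using assms by simp
  ultimately show ?thesis using assms by (simp add: field_simps)
qed

context
  fixes x :: "real^'n"
  assumes x: "x \<noteq> 0"
begin

lemma x_eq: "x = norm x *\<^sub>R sgn x" "norm (sgn x) = 1" and nx: "norm x > 0"
  using x by (simp_all add: sgn_div_norm norm_sgn)

interpretation U: sphere_coord unif_ball "\<lambda>z. sgn z \<bullet> sgn x" n
  using sphere_coord_unif_ball[OF x_eq(2)] dim n by simp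

text \<open>On each sphere \<open>newton\<close> evaluates the mean of the prior, and
  \<open>max_min_power\<close> turns its maximum into the minimum that defines \<open>W\<close>. The
  case \<open>j = 0\<close> gives the normalising integral, \<open>j = 1\<close> the integrability
  of the first moment.\<close>

lemma bden_polar_moment:
  assumes j: "j \<le> 1"
  shows "(\<integral>\<^sup>+z. ennreal (bden x z * norm z ^ j) \<partial>lborel) =
    (\<integral>\<^sup>+t. ennreal (\<sigma> * inverse (norm x ^ (n - 2)) * (indicator {0<..} t *\<^sub>R (t ^ j * (t * f t * min t (norm x) ^ (n - 2))))) \<partial>lborel)"
proof -
  let ?a = "norm x"
  let ?G = "\<lambda>t v. ennreal (f t * inverse (rad ?a t v ^ (n - 2)) * t ^ j)"
  have "(\<integral>\<^sup>+z. ennreal (bden x z * norm z ^ j) \<partial>lborel) = (\<integral>\<^sup>+z. ?G (norm z) (sgn z \<bullet> sgn x) \<partial>lborel)"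
  proof (rule nn_integral_cong_AE)
    show "AE z in lborel. ennreal (bden x z * norm z ^ j) = ?G (norm z) (sgn z \<bullet> sgn x)"
      using AE_lborel_singleton[of "0::real^'n"]
    proof eventually_elim
      case (elim z)
      have "norm (x + z) = rad ?a (norm z) (sgn z \<bullet> sgn x)"
        using norm_shift[OF x_eq(2) elim, of ?a] x_eq(1) by simp
      thus ?case by (simp add: bden_def)
    qed
  qed
  also have "\<dots> = (\<integral>\<^sup>+t\<in>{0<..}. ennreal (\<sigma> * t ^ (n - 1)) * (\<integral>\<^sup>+z. ?G t (sgn z \<bullet> sgn x) \<partial>unif_ball) \<partial>lborel)"
    by (rule nn_integral_direction[OF _ x_eq(2)]) measurable
  also have "\<dots> = (\<integral>\<^sup>+t. ennreal (\<sigma> * inverse (?a ^ (n - 2)) * (indicator {0<..} t *\<^sub>R (t ^ j * (t * f t * min t ?a ^ (n - 2))))) \<partial>lborel)"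
  proof (rule nn_integral_cong_AE)
    show "AE t in lborel. ennreal (\<sigma> * t ^ (n - 1)) * (\<integral>\<^sup>+z. ?G t (sgn z \<bullet> sgn x) \<partial>unif_ball) * indicator {0<..} t =
       ennreal (\<sigma> * inverse (?a ^ (n - 2)) * (indicator {0<..} t *\<^sub>R (t ^ j * (t * f t * min t ?a ^ (n - 2)))))"
      using AE_lborel_singleton[of ?a]
    proof eventually_elim
      case (elim t)
      show ?case
      proof (cases "t > 0")
        case True
        have rp: "rad ?a t v > 0" if "v \<in> {-1..1}" for v using rad_pos[of ?a t v] True elim that by auto
        have "continuous_on {-1..1} (\<lambda>v. inverse (rad ?a t v ^ (n - 2)))"
        proof (rule continuous_on_inverse)
          show "\<forall>v\<in>{-1..1}. rad ?a t v ^ (n - 2) \<noteq> 0" using rp by (metis less_irrefl power_not_zero)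
        qed (intro continuous_intros)
        from U.integrable_cont[OF this] have i: "integrable unif_ball (\<lambda>z. inverse (rad ?a t (sgn z \<bullet> sgn x) ^ (n - 2)))" .
        have "(\<integral>\<^sup>+z. ?G t (sgn z \<bullet> sgn x) \<partial>unif_ball) = (\<integral>\<^sup>+z. ennreal (f t * t ^ j * inverse (rad ?a t (sgn z \<bullet> sgn x) ^ (n - 2))) \<partial>unif_ball)"
          by (simp add: mult_ac)
        also have "\<dots> = ennreal (\<integral>z. f t * t ^ j * inverse (rad ?a t (sgn z \<bullet> sgn x) ^ (n - 2)) \<partial>unif_ball)"
          using f_nonneg[of t] True rp U.u_range i
          by (intro nn_integral_eq_integral integrable_mult_right AE_I2) (auto intro!: mult_nonneg_nonneg simp: less_imp_le)
        also have "\<dots> = ennreal (f t * t ^ j * inverse (max ?a t ^ (n - 2)))"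
          using U.newton[OF True nx elim] by simp
        finally have "ennreal (\<sigma> * t ^ (n - 1)) * (\<integral>\<^sup>+z. ?G t (sgn z \<bullet> sgn x) \<partial>unif_ball) =
           ennreal (\<sigma> * t ^ (n - 1)) * ennreal (f t * t ^ j * inverse (max ?a t ^ (n - 2)))" by simp
        also have "\<dots> = ennreal (\<sigma> * t ^ (n - 1) * (f t * t ^ j * inverse (max ?a t ^ (n - 2))))"
          using sigma_pos f_nonneg[of t] True by (intro ennreal_mult[symmetric]) auto
        also have "\<sigma> * t ^ (n - 1) * (f t * t ^ j * inverse (max ?a t ^ (n - 2))) = \<sigma> * inverse (?a ^ (n - 2)) * (t ^ j * (t * f t * min t ?a ^ (n - 2)))"
        proof -
          have "t ^ (n - 1) = t ^ 1 * t ^ (n - 2)" using dim by (intro power_split) simp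
          hence "\<sigma> * t ^ (n - 1) * (f t * t ^ j * inverse (max ?a t ^ (n - 2))) = \<sigma> * (t ^ j * (t * f t)) * (t ^ (n - 2) * inverse (max ?a t ^ (n - 2)))"
            by simp
          thus ?thesis unfolding max_min_power[OF nx True] by (simp only: mult_ac)
        qed
        finally show ?thesis using True by simp
      qed simp
    qed
  qed
  finally show ?thesis .
qed

lemma bden_moment_int:
  "integrable lborel (bden x)" "(\<integral>z. bden x z \<partial>lborel) = \<sigma> * inverse (norm x ^ (n - 2)) * W (n - 2) (norm x)"
  "integrable lborel (\<lambda>z. bden x z *\<^sub>R z)"
proof -
  let ?a = "norm x"
  let ?w = "\<lambda>j t. \<sigma> * inverse (?a ^ (n - 2)) * (indicator {0<..} t *\<^sub>R (t ^ j * (t * f t * min t ?a ^ (n - 2))))"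
  have i0: "integrable lborel (?w 0)" using W_int[of "n - 2" ?a] unfolding set_integrable_def by (simp add: integrable_mult_right)
  \<comment> \<open>The decay of the prior pays for the additional factor t, so the posterior mean
    exists whether or not f has a first moment.\<close>
  have "set_integrable lborel {0<..} (\<lambda>t. t ^ 1 * (t * f t * min t ?a ^ (n - 2)))"
  proof (rule set_integrable_bounded_by_mass[where c="?a"])
    fix t :: real assume "t \<in> {0<..}"
    hence t: "t > 0" by simp
    have "min t ?a ^ (n - 2) = min t ?a ^ 1 * min t ?a ^ (n - 3)" using dim by (intro power_split) simp
    also have "\<dots> \<le> ?a ^ 1 * t ^ (n - 3)" using t by (intro mult_mono power_mono) auto
    finally have "(t * t * f t) * min t ?a ^ (n - 2) \<le> (t * t * f t) * (?a ^ 1 * t ^ (n - 3))"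
      using t f_nonneg[of t] by (intro mult_left_mono) auto
    moreover have "t ^ (n - 1) = t ^ 2 * t ^ (n - 3)" using dim by (intro power_split) simp
    ultimately have "t ^ 1 * (t * f t * min t ?a ^ (n - 2)) \<le> ?a * (t ^ (n - 1) * f t)" by (simp add: power2_eq_square mult_ac)
    thus "\<bar>t ^ 1 * (t * f t * min t ?a ^ (n - 2))\<bar> \<le> ?a * (t ^ (n - 1) * f t)"
      using t f_nonneg[of t] by simp
  qed auto
  hence i1: "integrable lborel (?w 1)" unfolding set_integrable_def by (rule integrable_mult_right)
  have fin: "integrable lborel (\<lambda>z. bden x z * norm z ^ j)" "(\<integral>z. bden x z * norm z ^ j \<partial>lborel) = (\<integral>t. ?w j t \<partial>lborel)" if j: "j \<le> 1" for j
  proof -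
    have ij: "integrable lborel (?w j)" using i0 i1 j by (cases j) (auto simp: le_Suc_eq)
    have w0: "?w j t \<ge> 0" for t using sigma_pos f_nonneg[of t] nx by (auto simp: indicator_def intro!: mult_nonneg_nonneg)
    have eq: "(\<integral>\<^sup>+z. ennreal (bden x z * norm z ^ j) \<partial>lborel) = ennreal (\<integral>t. ?w j t \<partial>lborel)"
      unfolding bden_polar_moment[OF j] by (rule nn_integral_eq_integral[OF ij]) (intro AE_I2 w0)
    have "has_bochner_integral lborel (\<lambda>z. bden x z * norm z ^ j) (\<integral>t. ?w j t \<partial>lborel)"
    proof (rule has_bochner_integral_nn_integral[OF _ _ _ eq])
      show "0 \<le> (\<integral>t. ?w j t \<partial>lborel)" by (rule Bochner_Integration.integral_nonneg[OF w0])
      show "AE z in lborel. 0 \<le> bden x z * norm z ^ j" using bden_nonneg by (intro AE_I2 mult_nonneg_nonneg) auto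
    qed measurable
    thus "integrable lborel (\<lambda>z. bden x z * norm z ^ j)" "(\<integral>z. bden x z * norm z ^ j \<partial>lborel) = (\<integral>t. ?w j t \<partial>lborel)"
      by (simp_all only: has_bochner_integral_iff)
  qed
  show "integrable lborel (bden x)" using fin(1)[of 0] by simp
  show "(\<integral>z. bden x z \<partial>lborel) = \<sigma> * inverse (?a ^ (n - 2)) * W (n - 2) ?a"
    using fin(2)[of 0] by (simp add: W_def set_lebesgue_integral_def)
  show "integrable lborel (\<lambda>z. bden x z *\<^sub>R z)"
    by (rule Bochner_Integration.integrable_bound[OF fin(1)[of 1]]) (use bden_nonneg in \<open>auto simp: abs_of_nonneg\<close>)
qed

text \<open>The half-turn about the axis of x preserves the density, so only the component along x
  survives; \<open>newton_first\<close> evaluates it sphere by sphere.\<close>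

lemma bden_first_moment:
  "(\<integral>z. bden x z *\<^sub>R z \<partial>lborel) = (- (\<sigma> * inverse (norm x ^ (n - 1)) * ((real n - 2) / real n * W n (norm x)))) *\<^sub>R sgn x"
proof -
  let ?a = "norm x" and ?e = "sgn x"
  let ?T = "\<lambda>z. (2 * (z \<bullet> ?e)) *\<^sub>R ?e - z"
  have ee: "?e \<bullet> ?e = 1" using x_eq(2) by (simp add: norm_eq_1)
  have nT: "norm (?T z) = norm z" for z
    unfolding norm_eq_sqrt_inner by (simp add: inner_diff_left inner_diff_right ee algebra_simps inner_commute)
  have Tx: "?T x = x"
  proof -
    have "x \<bullet> ?e = ?a * (?e \<bullet> ?e)" by (subst x_eq(1)) simp
    hence "?T x = (2 * ?a) *\<^sub>R ?e - ?a *\<^sub>R ?e" using ee x_eq(1) by simp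
    also have "\<dots> = ?a *\<^sub>R ?e" by (simp add: algebra_simps flip: scaleR_diff_left)
    finally show ?thesis using x_eq(1) by simp
  qed
  have bT: "bden x (?T z) = bden x z" for z
  proof -
    have "x + ?T z = ?T (x + z)" using Tx by (simp add: inner_add_left algebra_simps)
    hence "norm (x + ?T z) = norm (x + z)" using nT by metis
    thus ?thesis by (simp add: bden_def nT)
  qed
  let ?V = "\<integral>z. bden x z *\<^sub>R z \<partial>lborel"
  have Tm [measurable]: "?T \<in> borel_measurable borel" by measurable
  have "integrable (distr lborel borel ?T) (\<lambda>z. bden x z *\<^sub>R z)"
    using bden_moment_int(3) unfolding lborel_distr_axial_reflection[OF x_eq(2)] .
  hence iT: "integrable lborel (\<lambda>z. bden x z *\<^sub>R ?T z)"
    by (subst (asm) integrable_distr_eq) (simp_all add: bT)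
  have VT: "?V = (\<integral>z. bden x z *\<^sub>R ?T z \<partial>lborel)"
  proof -
    have "?V = (\<integral>z. bden x z *\<^sub>R z \<partial>distr lborel borel ?T)" by (simp only: lborel_distr_axial_reflection[OF x_eq(2)])
    also have "\<dots> = (\<integral>z. bden x z *\<^sub>R ?T z \<partial>lborel)" by (subst integral_distr) (simp_all add: bT)
    finally show ?thesis .
  qed
  have ii: "integrable lborel (\<lambda>z. bden x z * (z \<bullet> ?e))"
    using integrable_inner_left[OF bden_moment_int(3), of ?e] by simp
  have "?V + ?V = (\<integral>z. bden x z *\<^sub>R z + bden x z *\<^sub>R ?T z \<partial>lborel)"
    using VT bden_moment_int(3) iT by (simp add: Bochner_Integration.integral_add)
  also have "\<dots> = (\<integral>z. (2 * (bden x z * (z \<bullet> ?e))) *\<^sub>R ?e \<partial>lborel)"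
    by (simp add: algebra_simps flip: scaleR_add_right)
  also have "\<dots> = (2 * (\<integral>z. bden x z * (z \<bullet> ?e) \<partial>lborel)) *\<^sub>R ?e"
    using ii by simp
  finally have "(2::real) *\<^sub>R ?V = 2 *\<^sub>R ((\<integral>z. bden x z * (z \<bullet> ?e) \<partial>lborel) *\<^sub>R ?e)" by (simp add: scaleR_2)
  hence V: "?V = (\<integral>z. bden x z * (z \<bullet> ?e) \<partial>lborel) *\<^sub>R ?e" by (rule scaleR_left_imp_eq[rotated]) (rule zero_neq_numeral[symmetric])
  let ?G = "\<lambda>t v. f t * inverse (rad ?a t v ^ (n - 2)) * (t * v)"
  have ae: "AE z in lborel. bden x z * (z \<bullet> ?e) = ?G (norm z) (sgn z \<bullet> ?e)"
    using AE_lborel_singleton[of "0::real^'n"]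
  proof eventually_elim
    case (elim z)
    have "norm (x + z) = rad ?a (norm z) (sgn z \<bullet> ?e)"
      using norm_shift[OF x_eq(2) elim, of ?a] x_eq(1) by simp
    moreover have "z \<bullet> ?e = norm z * (sgn z \<bullet> ?e)" using elim by (simp add: sgn_div_norm[of z])
    ultimately show ?case by (simp add: bden_def)
  qed
  have [measurable]: "(\<lambda>z. ?G (norm z) (sgn z \<bullet> ?e)) \<in> borel_measurable borel" by measurable
  have iG: "integrable lborel (\<lambda>z. ?G (norm z) (sgn z \<bullet> ?e))"
    by (rule integrable_cong_AE_imp[OF ii]) (use ae in \<open>auto elim: eventually_mono\<close>)
  have "(\<integral>z. bden x z * (z \<bullet> ?e) \<partial>lborel) = (\<integral>z. ?G (norm z) (sgn z \<bullet> ?e) \<partial>lborel)"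
    by (rule integral_cong_AE) (use ae in auto)
  also have "\<dots> = (LINT t:{0<..}|lborel. \<sigma> * t ^ (n - 1) * (\<integral>z. ?G t (sgn z \<bullet> ?e) \<partial>unif_ball))"
    by (rule integral_direction[OF _ x_eq(2) iG]) measurable
  also have "\<dots> = (\<integral>t. - (\<sigma> * inverse (?a ^ (n - 1)) * ((real n - 2) / real n)) * (indicator {0<..} t *\<^sub>R (t * f t * min t ?a ^ n)) \<partial>lborel)"
    unfolding set_lebesgue_integral_def
  proof (rule integral_cong_AE)
    show "AE t in lborel. indicator {0<..} t *\<^sub>R (\<sigma> * t ^ (n - 1) * (\<integral>z. ?G t (sgn z \<bullet> ?e) \<partial>unif_ball)) =
      - (\<sigma> * inverse (?a ^ (n - 1)) * ((real n - 2) / real n)) * (indicator {0<..} t *\<^sub>R (t * f t * min t ?a ^ n))"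
      using AE_lborel_singleton[of ?a]
    proof eventually_elim
      case (elim t)
      show ?case
      proof (cases "t > 0")
        case True
        have "(\<integral>z. ?G t (sgn z \<bullet> ?e) \<partial>unif_ball) = (\<integral>z. (f t * t) * ((sgn z \<bullet> ?e) * inverse (rad ?a t (sgn z \<bullet> ?e) ^ (n - 2))) \<partial>unif_ball)"
          by (simp add: mult_ac)
        also have "\<dots> = (f t * t) * (- (real n - 2) / real n * (min ?a t / max ?a t ^ (n - 1)))"
          using U.newton_first[OF True nx elim] by simp
        finally have g: "(\<integral>z. ?G t (sgn z \<bullet> ?e) \<partial>unif_ball) = (f t * t) * (- (real n - 2) / real n * (min ?a t / max ?a t ^ (n - 1)))" .
        have "\<sigma> * T * ((f t * t) * (- q / m * (w / M))) = - (\<sigma> * (q / m)) * (t * f t * w) * (T * inverse M)" for T q m w M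
          by (simp add: divide_inverse)
        hence "\<sigma> * t ^ (n - 1) * (\<integral>z. ?G t (sgn z \<bullet> ?e) \<partial>unif_ball) =
           - (\<sigma> * ((real n - 2) / real n)) * (t * f t * min t ?a) * (t ^ (n - 1) * inverse (max ?a t ^ (n - 1)))"
          unfolding g min.commute[of t] by blast
        also have "\<dots> = - (\<sigma> * inverse (?a ^ (n - 1)) * ((real n - 2) / real n)) * (t * f t * (min t ?a ^ 1 * min t ?a ^ (n - 1)))"
          unfolding max_min_power[OF nx True] by simp
        also have "min t ?a ^ 1 * min t ?a ^ (n - 1) = min t ?a ^ n" using dim by (intro power_split[symmetric]) simp
        finally show ?thesis using True by simp
      qed simp
    qed
    have [measurable]: "(\<lambda>t. \<integral>z. ?G t (sgn z \<bullet> ?e) \<partial>unif_ball) \<in> borel_measurable borel"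
      by (rule U.borel_measurable_lebesgue_integral) measurable
    show "(\<lambda>t. indicator {0<..} t *\<^sub>R (\<sigma> * t ^ (n - 1) * (\<integral>z. ?G t (sgn z \<bullet> ?e) \<partial>unif_ball))) \<in> borel_measurable lborel"
      by measurable
    show "(\<lambda>t. - (\<sigma> * inverse (?a ^ (n - 1)) * ((real n - 2) / real n)) * (indicator {0<..} t *\<^sub>R (t * f t * min t ?a ^ n))) \<in> borel_measurable lborel"
      by measurable
  qed
  also have "\<dots> = - (\<sigma> * inverse (?a ^ (n - 1)) * ((real n - 2) / real n * W n ?a))"
    by (simp add: W_def set_lebesgue_integral_def)
  finally show ?thesis unfolding V by simp
qed

lemma harmonic_bayes_eq: "harmonic_bayes f x = x - \<psi> (norm x) *\<^sub>R x"
proof -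
  let ?a = "norm x"
  have e: "norm (x - (x + z)) = norm z" for z by simp
  have num: "(\<integral>\<theta>. (f (norm (x - \<theta>)) * norm \<theta> powi (2 - int CARD('n))) *\<^sub>R \<theta> \<partial>lborel) = (\<integral>z. bden x z *\<^sub>R (x + z) \<partial>lborel)"
    unfolding n[symmetric] kernel_eq
    by (subst integral_lborel_shift[where a=x]) (simp_all add: bden_def)
  have den: "(\<integral>\<theta>. f (norm (x - \<theta>)) * norm \<theta> powi (2 - int CARD('n)) \<partial>lborel) = (\<integral>z. bden x z \<partial>lborel)"
    unfolding n[symmetric] kernel_eq
    by (subst integral_lborel_shift[where a=x]) (simp_all add: bden_def[abs_def])
  define D where "D = (\<integral>z. bden x z \<partial>lborel)"
  have W: "W (n - 2) ?a > 0" by (rule W_pos[OF nx]) simp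
  have D: "D = \<sigma> * inverse (?a ^ (n - 2)) * W (n - 2) ?a" unfolding D_def by (rule bden_moment_int(2))
  have D0: "D > 0" unfolding D using sigma_pos nx W by simp
  have "(\<integral>z. bden x z *\<^sub>R (x + z) \<partial>lborel) = D *\<^sub>R x + (\<integral>z. bden x z *\<^sub>R z \<partial>lborel)"
    unfolding D_def scaleR_add_right using bden_moment_int by simp
  hence "harmonic_bayes f x = inverse D *\<^sub>R (D *\<^sub>R x + (\<integral>z. bden x z *\<^sub>R z \<partial>lborel))"
    unfolding harmonic_bayes_def num den D_def by simp
  also have "\<dots> = x + (inverse D * - (\<sigma> * inverse (?a ^ (n - 1)) * ((real n - 2) / real n * W n ?a))) *\<^sub>R sgn x"
  proof -
    have "inverse D *\<^sub>R (D *\<^sub>R x + c *\<^sub>R sgn x) = x + (inverse D * c) *\<^sub>R sgn x" for c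
      using D0 by (simp add: scaleR_add_right)
    thus ?thesis unfolding bden_first_moment .
  qed
  also have "inverse D * - (\<sigma> * inverse (?a ^ (n - 1)) * ((real n - 2) / real n * W n ?a)) = - (\<psi> ?a * ?a)"
  proof -
    have "?a ^ (n - 1) = ?a ^ 1 * ?a ^ (n - 2)" using dim by (intro power_split) simp
    thus ?thesis unfolding D \<psi>_def \<phi>_def A_def B_def using sigma_pos nx W dim
      by (simp add: field_simps power2_eq_square)
  qed
  also have "- (\<psi> ?a * ?a) *\<^sub>R sgn x = - (\<psi> ?a *\<^sub>R x)" using x_eq(1) by (metis scaleR_minus_left scaleR_scaleR)
  finally show ?thesis by simp
qed

end

lemma harmonic_bayes_measurable: "(harmonic_bayes f :: real^'n \<Rightarrow> real^'n) \<in> borel_measurable borel"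
proof -
  have [measurable]: "(\<lambda>x::real^'n. \<integral>\<theta>. (f (norm (x - \<theta>)) * inverse (norm \<theta> ^ (n - 2))) *\<^sub>R \<theta> \<partial>(lborel :: (real^'n) measure)) \<in> borel_measurable borel"
    by (rule lborel.borel_measurable_lebesgue_integral) measurable
  have [measurable]: "(\<lambda>x::real^'n. \<integral>\<theta>. f (norm (x - \<theta>)) * inverse (norm \<theta> ^ (n - 2)) \<partial>(lborel :: (real^'n) measure)) \<in> borel_measurable borel"
    by (rule lborel.borel_measurable_lebesgue_integral) measurable
  show ?thesis unfolding harmonic_bayes_def[abs_def] n[symmetric] kernel_eq by measurable
qed

section \<open>The risk of the Bayes estimator\<close>

text \<open>Extending \<psi> by 0 makes it measurable and bounded on the whole line, also at
  \<open>rad = 0\<close>, where \<psi> is not controlled.\<close>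

definition Psi :: "real \<Rightarrow> real" where "Psi r = (if r > 0 then \<psi> r else 0)"

lemma Psi_measurable [measurable]: "Psi \<in> borel_measurable borel"
proof -
  have "continuous_on {0<..} \<psi>"
    by (rule DERIV_continuous_on[where D="\<psi>'"]) (rule has_field_derivative_at_within, rule has_real_derivative_psi, simp)
  hence "(\<lambda>r. indicator {0<..} r *\<^sub>R \<psi> r) \<in> borel_measurable borel"
    by (intro borel_measurable_continuous_on_indicator) auto
  moreover have "(\<lambda>r. indicator {0<..} r *\<^sub>R \<psi> r) = Psi" by (auto simp: Psi_def)
  ultimately show ?thesis by simp
qed

lemma Psi_nonneg: "Psi r \<ge> 0" and Psi_le: "Psi r \<le> 1" and Psi_bound: "\<bar>Psi r\<bar> \<le> 1"
  using psi_pos[of r] psi_le[of r] by (auto simp: Psi_def)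

lemma has_real_derivative_Psi: "r > 0 \<Longrightarrow> (Psi has_real_derivative \<psi>' r) (at r)"
  by (rule has_field_derivative_transform_within_open[OF has_real_derivative_psi, of _ "{0<..}"]) (auto simp: Psi_def)

lemma square_Psi: "r > 0 \<Longrightarrow> r\<^sup>2 * Psi r = \<phi> r"
  using square_psi by (simp add: Psi_def)

definition hm :: "real \<Rightarrow> real^'n \<Rightarrow> real \<Rightarrow> real" where
  "hm a e t = (\<integral>z. Psi (rad a t (sgn z \<bullet> e)) \<partial>unif_ball)"

context
  fixes e :: "real^'n" and a :: real
  assumes e: "norm e = 1" and a: "a \<ge> 0"
begin

interpretation U: sphere_coord unif_ball "\<lambda>z. sgn z \<bullet> e" n
  using sphere_coord_unif_ball[OF e] dim n by simp

lemma radial_mean_hm: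
  assumes int2: "set_integrable lborel {0<..} (\<lambda>t. t ^ (n + 1) * f t)"
  shows "radial_mean f n (hm a e)"
proof
  show "hm a e \<in> borel_measurable borel"
    unfolding hm_def[abs_def] by (rule U.measurable_mean) simp
  show "0 \<le> hm a e t" for t unfolding hm_def by (intro Bochner_Integration.integral_nonneg Psi_nonneg)
  show "hm a e t \<le> 1" for t unfolding hm_def
    by (intro U.integral_le_const U.integrable_mean[OF _ Psi_bound] AE_I2 Psi_le) simp
qed (fact int2)

lemma flux_Psi:
  assumes int2: "set_integrable lborel {0<..} (\<lambda>t. t ^ (n + 1) * f t)" and t: "t > 0"
  shows "(real n - 2) * radial_mean.S n (hm a e) t \<le> t ^ (n - 1) * (\<integral>z. Psi (rad a t (sgn z \<bullet> e)) * (t + a * (sgn z \<bullet> e)) \<partial>unif_ball)"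
proof -
  interpret RM: radial_mean f n "hm a e" by (rule radial_mean_hm[OF int2])
  have i: "set_integrable lborel {0..t} (\<lambda>s. s ^ (n - 1) * hm a e s)"
    unfolding hm_def by (rule U.power_mean_integrable[OF _ Psi_bound]) simp
  have "RM.S t = (LINT s:{0..t}|lborel. s ^ (n - 1) * hm a e s)"
    unfolding RM.S_def set_lebesgue_integral_def
  proof (rule integral_cong_AE)
    show "AE s in lborel. indicator {0<..<t} s *\<^sub>R (s ^ (n - 1) * hm a e s) = indicator {0..t} s *\<^sub>R (s ^ (n - 1) * hm a e s)"
      using AE_lborel_singleton[of "0::real"] AE_lborel_singleton[of t] by eventually_elim (auto simp: indicator_def)
  qed measurable
  also have "\<dots> = integral {0..t} (\<lambda>s. s ^ (n - 1) * hm a e s)"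
    by (rule set_borel_integral_eq_integral(2)[OF i])
  finally have S: "RM.S t = integral {0..t} (\<lambda>s. s ^ (n - 1) * hm a e s)" .
  show ?thesis unfolding S unfolding hm_def
    by (rule U.flux_lower_bound[OF has_real_derivative_Psi continuous_on_psi' Psi_measurable Psi_bound _ t a])
       (use psi_flux_ineq in \<open>auto simp: Psi_def\<close>)
qed

text \<open>An error of length t and cosine v costs \<open>K t v\<close>. Averaged over a sphere,
  its cross term is bounded by \<open>flux_Psi\<close> and its quadratic term by
  \<open>phi_le_limit\<close>; \<open>star\<close> is what makes the corrections to the second
  moment add up to at most 0.\<close>

lemma risk_le_radial:
  assumes int2: "set_integrable lborel {0<..} (\<lambda>t. t ^ (n + 1) * f t)"
    and star: "radial_mean.I2 f n * radial_mean.Hh f n (hm a e) \<le> 2 * real n * radial_mean.I f n * radial_mean.HF f n (hm a e)"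
  shows "risk f (harmonic_bayes f) (a *\<^sub>R e) \<le> ennreal (\<sigma> * (LINT t:{0<..}|lborel. t ^ (n + 1) * f t))"
proof -
  interpret RM: radial_mean f n "hm a e" by (rule radial_mean_hm[OF int2])
  let ?\<theta> = "a *\<^sub>R e" and ?\<delta> = "harmonic_bayes f :: real^'n \<Rightarrow> real^'n"
  define L where "L = (real n - 2) / real n * (RM.I2 / RM.I)"
  define K where "K = (\<lambda>t v. t\<^sup>2 - 2 * t * (Psi (rad a t v) * (t + a * v)) + (Psi (rad a t v))\<^sup>2 * (rad a t v)\<^sup>2)"
  note [measurable] = harmonic_bayes_measurable
  have Km [measurable]: "case_prod K \<in> borel_measurable (borel \<Otimes>\<^sub>M borel)" unfolding K_def case_prod_beta by measurable
  \<comment> \<open>Cauchy-Schwarz gives \<open>K t v\<close> \<ge> (t - \<open>Psi\<close> *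
    \<open>rad\<close>)^2. Nonnegativity is what permits the passage from \<open>ennreal\<close> to
    Bochner integrals.\<close>
  have K0: "K t v \<ge> 0" if "t > 0" "v \<in> {-1..1}" for t v
  proof -
    have le: "Psi (rad a t v) * (t + a * v) \<le> Psi (rad a t v) * rad a t v"
      using abs_radial_le_rad[of a t v] a that Psi_nonneg by (intro mult_left_mono) auto
    hence "2 * t * (Psi (rad a t v) * (t + a * v)) \<le> 2 * t * (Psi (rad a t v) * rad a t v)"
      using that by (intro mult_left_mono[OF le]) auto
    hence "(t - Psi (rad a t v) * rad a t v)\<^sup>2 \<le> K t v"
      unfolding K_def by (simp add: power2_eq_square algebra_simps)
    thus ?thesis by (meson order_trans zero_le_power2)
  qed
  define G where "G = (\<lambda>t. t ^ (n + 1) * f t + L * (t ^ (n - 1) * f t * hm a e t) - 2 * (real n - 2) * (t * f t * RM.S t))"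
  have bound: "0 \<le> G t" "ennreal (\<sigma> * t ^ (n - 1)) * (\<integral>\<^sup>+z. ennreal (f t * K t (sgn z \<bullet> e)) \<partial>unif_ball) \<le> ennreal (\<sigma> * G t)" if True: "t > 0" for t
  proof -
    have r: "0 \<le> rad a t (sgn z \<bullet> e)" "rad a t (sgn z \<bullet> e) \<le> a + t" "\<bar>t + a * (sgn z \<bullet> e)\<bar> \<le> a + t" for z
      using rad_bounds[of a t "sgn z \<bullet> e"] rad_nonneg[of a t "sgn z \<bullet> e"] abs_radial_le_rad[of a t "sgn z \<bullet> e"] a True U.u_range[of z] by auto
    have i1: "integrable unif_ball (\<lambda>z. Psi (rad a t (sgn z \<bullet> e)) * (t + a * (sgn z \<bullet> e)))"
    proof (intro U.integrable_const_bound[of _ "1 * (a + t)"] AE_I2)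
      fix z
      show "norm (Psi (rad a t (sgn z \<bullet> e)) * (t + a * (sgn z \<bullet> e))) \<le> 1 * (a + t)"
        unfolding real_norm_def abs_mult by (intro mult_mono Psi_bound r(3)) auto
    qed measurable
    have i2: "integrable unif_ball (\<lambda>z. (Psi (rad a t (sgn z \<bullet> e)))\<^sup>2 * (rad a t (sgn z \<bullet> e))\<^sup>2)"
    proof (intro U.integrable_const_bound[of _ "1\<^sup>2 * (a + t)\<^sup>2"] AE_I2)
      fix z
      show "norm ((Psi (rad a t (sgn z \<bullet> e)))\<^sup>2 * (rad a t (sgn z \<bullet> e))\<^sup>2) \<le> 1\<^sup>2 * (a + t)\<^sup>2"
        unfolding real_norm_def abs_mult abs_power2 using r(1,2)[of z] Psi_nonneg Psi_le
        by (intro mult_mono power_mono) auto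
    qed measurable
    have i3: "integrable unif_ball (\<lambda>z. Psi (rad a t (sgn z \<bullet> e)))"
      by (rule U.integrable_mean[OF _ Psi_bound]) simp
    have iK: "integrable unif_ball (\<lambda>z. K t (sgn z \<bullet> e))" unfolding K_def using i1 i2 by simp
    have EK: "(\<integral>z. K t (sgn z \<bullet> e) \<partial>unif_ball) = t\<^sup>2 - 2 * t * (\<integral>z. Psi (rad a t (sgn z \<bullet> e)) * (t + a * (sgn z \<bullet> e)) \<partial>unif_ball) +
       (\<integral>z. (Psi (rad a t (sgn z \<bullet> e)))\<^sup>2 * (rad a t (sgn z \<bullet> e))\<^sup>2 \<partial>unif_ball)"
      unfolding K_def using i1 i2 by (simp add: U.prob_space[unfolded space_unif_ball])
    have "(\<integral>z. (Psi (rad a t (sgn z \<bullet> e)))\<^sup>2 * (rad a t (sgn z \<bullet> e))\<^sup>2 \<partial>unif_ball) \<le> (\<integral>z. L * Psi (rad a t (sgn z \<bullet> e)) \<partial>unif_ball)"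
    proof (rule integral_mono[OF i2])
      show "integrable unif_ball (\<lambda>z. L * Psi (rad a t (sgn z \<bullet> e)))" using i3 by simp
      fix z
      let ?r = "rad a t (sgn z \<bullet> e)"
      show "(Psi ?r)\<^sup>2 * ?r\<^sup>2 \<le> L * Psi ?r"
      proof (cases "?r > 0")
        case True
        have "(Psi ?r)\<^sup>2 * ?r\<^sup>2 = \<phi> ?r * Psi ?r" using square_Psi[OF True] by (simp add: power2_eq_square mult_ac)
        also have "\<dots> \<le> L * Psi ?r"
          using phi_le_limit[OF int2 True] Psi_nonneg unfolding L_def RM.I2_def RM.I_def by (intro mult_right_mono)
        finally show ?thesis .
      qed (simp add: Psi_def)
    qed
    hence E2: "(\<integral>z. (Psi (rad a t (sgn z \<bullet> e)))\<^sup>2 * (rad a t (sgn z \<bullet> e))\<^sup>2 \<partial>unif_ball) \<le> L * hm a e t"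
      by (simp add: hm_def)
    define Q where "Q = (\<integral>z. Psi (rad a t (sgn z \<bullet> e)) * (t + a * (sgn z \<bullet> e)) \<partial>unif_ball)"
    have "(real n - 2) * RM.S t \<le> t ^ (n - 1) * Q" using flux_Psi[OF int2 True] unfolding Q_def .
    hence "2 * (t * f t) * ((real n - 2) * RM.S t) \<le> 2 * (t * f t) * (t ^ (n - 1) * Q)"
      using True f_nonneg[of t] by (intro mult_left_mono) auto
    moreover have "t ^ (n - 1) * f t * (\<integral>z. (Psi (rad a t (sgn z \<bullet> e)))\<^sup>2 * (rad a t (sgn z \<bullet> e))\<^sup>2 \<partial>unif_ball) \<le> t ^ (n - 1) * f t * (L * hm a e t)"
      using E2 True f_nonneg[of t] by (intro mult_left_mono) auto
    moreover have "t ^ (n + 1) = t ^ (n - 1) * t\<^sup>2" using dim by (intro power_split) simp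
    ultimately have main: "t ^ (n - 1) * f t * (\<integral>z. K t (sgn z \<bullet> e) \<partial>unif_ball) \<le> t ^ (n + 1) * f t + L * (t ^ (n - 1) * f t * hm a e t) - 2 * (real n - 2) * (t * f t * RM.S t)"
      unfolding EK Q_def[symmetric] by (simp add: algebra_simps)
    have "0 \<le> (\<integral>z. K t (sgn z \<bullet> e) \<partial>unif_ball)"
      using K0[OF True] U.u_range by (intro Bochner_Integration.integral_nonneg) auto
    hence "0 \<le> t ^ (n - 1) * f t * (\<integral>z. K t (sgn z \<bullet> e) \<partial>unif_ball)"
      using True f_nonneg[of t] by (intro mult_nonneg_nonneg) auto
    thus "0 \<le> G t" using main unfolding G_def by linarith
    have "(\<integral>\<^sup>+z. ennreal (f t * K t (sgn z \<bullet> e)) \<partial>unif_ball) = ennreal (\<integral>z. f t * K t (sgn z \<bullet> e) \<partial>unif_ball)"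
      using f_nonneg[of t] True K0 U.u_range iK by (intro nn_integral_eq_integral AE_I2 mult_nonneg_nonneg integrable_mult_right) auto
    also have "\<dots> = ennreal (f t * (\<integral>z. K t (sgn z \<bullet> e) \<partial>unif_ball))" by simp
    finally have "ennreal (\<sigma> * t ^ (n - 1)) * (\<integral>\<^sup>+z. ennreal (f t * K t (sgn z \<bullet> e)) \<partial>unif_ball) =
        ennreal (\<sigma> * (t ^ (n - 1) * f t * (\<integral>z. K t (sgn z \<bullet> e) \<partial>unif_ball)))"
      using sigma_pos True f_nonneg[of t] by (simp add: ennreal_mult' [symmetric] mult_ac)
    also have "\<dots> \<le> ennreal (\<sigma> * G t)"
      unfolding G_def using main sigma_pos by (intro ennreal_leI mult_left_mono) auto
    finally show "ennreal (\<sigma> * t ^ (n - 1)) * (\<integral>\<^sup>+z. ennreal (f t * K t (sgn z \<bullet> e)) \<partial>unif_ball) \<le> ennreal (\<sigma> * G t)" .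
  qed
  have "risk f ?\<delta> ?\<theta> = (\<integral>\<^sup>+x. ennreal (f (norm (x - ?\<theta>))) * ennreal ((norm (?\<delta> x - ?\<theta>))\<^sup>2) \<partial>lborel)"
    unfolding risk_def expect_def sph_dist_def by (subst nn_integral_density) auto
  also have "\<dots> = (\<integral>\<^sup>+z. ennreal (f (norm z)) * ennreal ((norm (?\<delta> (?\<theta> + z) - ?\<theta>))\<^sup>2) \<partial>lborel)"
    by (subst nn_integral_lborel_shift[where a="?\<theta>"]) simp_all
  also have "\<dots> = (\<integral>\<^sup>+z. ennreal (f (norm z) * K (norm z) (sgn z \<bullet> e)) \<partial>lborel)"
  proof (rule nn_integral_cong_AE)
    show "AE z in lborel. ennreal (f (norm z)) * ennreal ((norm (?\<delta> (?\<theta> + z) - ?\<theta>))\<^sup>2) = ennreal (f (norm z) * K (norm z) (sgn z \<bullet> e))"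
      using AE_lborel_singleton[of "0::real^'n"] AE_lborel_singleton[of "- ?\<theta>"]
    proof eventually_elim
      case (elim z)
      let ?x = "?\<theta> + z" and ?t = "norm z" and ?u = "sgn z \<bullet> e"
      have x0: "?x \<noteq> 0" using elim by (metis add.commute add_eq_0_iff)
      have nx: "norm ?x = rad a ?t ?u" by (rule norm_shift[OF e elim(1)])
      have px: "Psi (rad a ?t ?u) = \<psi> (norm ?x)" using x0 nx by (simp add: Psi_def flip: nx)
      have d: "?\<delta> ?x - ?\<theta> = z - \<psi> (norm ?x) *\<^sub>R ?x" by (simp add: harmonic_bayes_eq[OF x0])
      have zx: "z \<bullet> ?x = ?t * (?t + a * ?u)"
      proof -
        have "z \<bullet> e = ?t * ?u" using elim(1) by (simp add: sgn_div_norm[of z])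
        thus ?thesis by (simp add: inner_add_right power2_norm_eq_inner[symmetric] power2_eq_square algebra_simps)
      qed
      have "(norm (z - \<psi> (norm ?x) *\<^sub>R ?x))\<^sup>2 = ?t\<^sup>2 - 2 * (\<psi> (norm ?x) * (z \<bullet> ?x)) + (\<psi> (norm ?x))\<^sup>2 * (norm ?x)\<^sup>2"
        unfolding power2_norm_eq_inner by (simp add: inner_diff_left inner_diff_right inner_commute[of ?x z] inner_commute[of e z] power2_eq_square algebra_simps)
      also have "\<dots> = K ?t ?u" unfolding K_def px zx nx by (simp add: mult_ac)
      finally show ?case unfolding d using f_nonneg[of ?t] by (simp add: ennreal_mult')
    qed
  qed
  also have "\<dots> = (\<integral>\<^sup>+t\<in>{0<..}. ennreal (\<sigma> * t ^ (n - 1)) * (\<integral>\<^sup>+z. ennreal (f t * K t (sgn z \<bullet> e)) \<partial>unif_ball) \<partial>lborel)"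
    by (rule nn_integral_direction[OF _ e]) measurable
  also have "\<dots> \<le> (\<integral>\<^sup>+t. ennreal (\<sigma> * (indicator {0<..} t *\<^sub>R G t)) \<partial>lborel)"
  proof (rule nn_integral_mono)
    fix t :: real
    show "ennreal (\<sigma> * t ^ (n - 1)) * (\<integral>\<^sup>+z. ennreal (f t * K t (sgn z \<bullet> e)) \<partial>unif_ball) * indicator {0<..} t \<le> ennreal (\<sigma> * (indicator {0<..} t *\<^sub>R G t))"
      using bound(2)[of t] by (cases "t > 0") simp_all
  qed
  also have "\<dots> \<le> ennreal (\<sigma> * RM.I2)"
  proof -
    have i: "set_integrable lborel {0<..} (\<lambda>t. t ^ (n + 1) * f t)"
      "set_integrable lborel {0<..} (\<lambda>t. L * (t ^ (n - 1) * f t * hm a e t))"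
      "set_integrable lborel {0<..} (\<lambda>t. 2 * (real n - 2) * (t * f t * RM.S t))"
      using int2 RM.Hh_int RM.HF_int by (auto intro: set_integrable_mult_right)
    have iG: "set_integrable lborel {0<..} G" unfolding G_def
      by (intro set_integral_diff(1) set_integral_add(1) i)
    have "(LINT t:{0<..}|lborel. G t) = RM.I2 + L * RM.Hh - 2 * (real n - 2) * RM.HF"
      unfolding RM.I2_def RM.Hh_def RM.HF_def G_def using i
      by (simp add: set_integral_diff(2) set_integral_add)
    also have "\<dots> \<le> RM.I2"
    proof -
      have "RM.I2 * RM.Hh / RM.I \<le> 2 * real n * RM.HF" using star RM.I_pos by (simp add: divide_le_eq mult_ac)
      hence "(real n - 2) / real n * (RM.I2 * RM.Hh / RM.I) \<le> (real n - 2) / real n * (2 * real n * RM.HF)"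
        using dim by (intro mult_left_mono) auto
      also have "\<dots> = 2 * (real n - 2) * RM.HF" using dim by simp
      finally have "L * RM.Hh \<le> 2 * (real n - 2) * RM.HF" by (simp add: L_def)
      thus ?thesis by simp
    qed
    finally have le: "\<sigma> * (LINT t:{0<..}|lborel. G t) \<le> \<sigma> * RM.I2" using sigma_pos by (intro mult_left_mono) auto
    have "(\<integral>\<^sup>+t. ennreal (\<sigma> * (indicator {0<..} t *\<^sub>R G t)) \<partial>lborel) = ennreal (\<integral>t. \<sigma> * (indicator {0<..} t *\<^sub>R G t) \<partial>lborel)"
      using bound(1) sigma_pos
      by (intro nn_integral_eq_integral integrable_mult_right iG[unfolded set_integrable_def]) (auto simp: indicator_def)
    also have "\<dots> = ennreal (\<sigma> * (LINT t:{0<..}|lborel. G t))" by (simp add: set_lebesgue_integral_def)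
    also have "\<dots> \<le> ennreal (\<sigma> * RM.I2)" using le by (rule ennreal_leI)
    finally show ?thesis .
  qed
  finally show ?thesis unfolding RM.I2_def .
qed

lemma radial_mean_monotone_hm:
  assumes int2: "set_integrable lborel {0<..} (\<lambda>t. t ^ (n + 1) * f t)"
    and intm2: "set_integrable lborel {0<..} (\<lambda>t. t ^ (n - 3) * f t)"
    and ratio: "radial_profile_ratio f n"
  shows "radial_mean_monotone f n (hm a e)"
proof -
  interpret RM: radial_mean f n "hm a e" by (rule radial_mean_hm[OF int2])
  interpret R: radial_profile_ratio f n by fact
  have d: "(Psi has_real_derivative - \<kappa> r * inverse (r ^ (n - 1))) (at r)" if "r > 0" for r
    using has_real_derivative_Psi[OF that] psi'_eq_kappa[OF that] by simp
  show ?thesis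
  proof
    fix s t :: real assume st: "0 < s" "s \<le> t"
    show "hm a e t \<le> hm a e s" unfolding hm_def
      by (rule U.mean_antimono[OF d continuous_on_kappa R.kappa_mono R.kappa_nonneg _ Psi_bound st a]) simp_all
    show "s\<^sup>2 * hm a e s \<le> t\<^sup>2 * hm a e t"
    \<comment> \<open>\<open>square_mean_mono\<close> rescales the centre and needs
      \<open>a > 0\<close>; for \<open>a = 0\<close> the mean is \<psi> itself and the claim is
      monotonicity of \<phi>.\<close>
    proof (cases "a = 0")
      case True
      have "rad a t v = t" if "t > 0" for t v using that True by (simp add: rad_def)
      hence "hm a e s = Psi s" "hm a e t = Psi t" using st U.prob_space[unfolded space_unif_ball] by (simp_all add: hm_def)
      thus ?thesis using square_Psi phi_mono[OF st] st by simp
    next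
      case False
      have sq: "r\<^sup>2 * Psi r \<le> q\<^sup>2 * Psi q" if "0 < r" "r \<le> q" for r q
        using square_Psi[of r] square_Psi[of q] phi_mono[OF that] that by simp
      show ?thesis unfolding hm_def
        by (rule U.square_mean_mono[OF d continuous_on_kappa R.kappa_mono R.kappa_nonneg _ Psi_bound sq st]) (use False a in simp_all)
    qed
  qed (fact intm2)
qed

end

section \<open>The minimax lower bound\<close>

lemma polar_form:
  fixes \<theta> :: "real^'n"
  obtains a e where "norm (e :: real^'n) = 1" "a \<ge> 0" "\<theta> = a *\<^sub>R e"
proof (cases "\<theta> = 0")
  case True
  obtain b :: "real^'n" where "b \<in> Basis" by (metis ex_in_conv nonempty_Basis)
  thus ?thesis using that[of b 0] True by simp
next
  case False
  thus ?thesis using that[of "sgn \<theta>" "norm \<theta>"] by (simp add: norm_sgn sgn_div_norm)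
qed

text \<open>
  Average the risk over a large ball of parameters and symmetrise in the error \<open>z\<close>.
\<close>
lemma truncated_moment_le_risk:
  fixes \<delta> :: "real^'n \<Rightarrow> real^'n"
  assumes [measurable]: "\<delta> \<in> borel_measurable borel" and R: "K \<le> R"
  shows "(\<integral>\<^sup>+z\<in>cball (0::real^'n) K. ennreal (f (norm z) * (norm z)\<^sup>2) \<partial>lborel) * emeasure lborel (cball (0::real^'n) (R - K))
      \<le> (SUP \<theta>. risk f \<delta> \<theta>) * emeasure lborel (cball (0::real^'n) R)"
proof -
  let ?mK = "\<integral>\<^sup>+z\<in>cball (0::real^'n) K. ennreal (f (norm z) * (norm z)\<^sup>2) \<partial>lborel"
  define J where "J d = (\<integral>\<^sup>+z\<in>cball 0 K. ennreal (f (norm z) * (norm (z - d))\<^sup>2) \<partial>lborel)" for d :: "real^'n"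
  have [measurable]: "cball (0::real^'n) r \<in> sets borel" for r by simp
  have Jm: "J d = J (- d)" for d
  proof -
    have D: "distr lborel borel uminus = (lborel :: (real^'n) measure)"
      by (rule lborel_distr_involutive_isometry) (auto intro: linearI)
    have "J d = (\<integral>\<^sup>+z\<in>cball 0 K. ennreal (f (norm z) * (norm (z - d))\<^sup>2) \<partial>distr lborel borel uminus)"
      unfolding D J_def ..
    also have "\<dots> = (\<integral>\<^sup>+z. ennreal (f (norm (- z)) * (norm (- z - d))\<^sup>2) * indicator (cball 0 K) (- z) \<partial>lborel)"
      by (subst nn_integral_distr) auto
    also have "\<dots> = J (- d)"
      unfolding J_def by (intro nn_integral_cong) (simp add: indicator_def norm_minus_commute[of "- _" d] add.commute)
    finally show ?thesis .
  qed
  \<comment> \<open>Parallelogram law: the shifts d and - d together cost at least 2 |z|^2, and they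
    cost the same because the error law is symmetric.\<close>
  have J: "?mK \<le> J d" for d
  proof -
    have "2 * ?mK = (\<integral>\<^sup>+z. ennreal (2 * (f (norm z) * (norm z)\<^sup>2)) * indicator (cball (0::real^'n) K) z \<partial>lborel)"
      by (subst nn_integral_cmult[symmetric]) (auto simp: ennreal_mult' mult.assoc)
    also have "\<dots> \<le> (\<integral>\<^sup>+z. ennreal (f (norm z) * (norm (z - d))\<^sup>2) * indicator (cball 0 K) z + ennreal (f (norm z) * (norm (z - - d))\<^sup>2) * indicator (cball 0 K) z \<partial>lborel)"
    proof (rule nn_integral_mono)
      fix z :: "real^'n"
      have "(norm (z - d))\<^sup>2 + (norm (z - - d))\<^sup>2 = 2 * (norm z)\<^sup>2 + 2 * (norm d)\<^sup>2"
        unfolding power2_norm_eq_inner by (simp add: inner_diff_left inner_diff_right inner_add_left inner_add_right inner_commute)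
      hence "f (norm z) * (2 * (norm z)\<^sup>2) \<le> f (norm z) * ((norm (z - d))\<^sup>2 + (norm (z - - d))\<^sup>2)"
        using f_nonneg[of "norm z"] by (intro mult_left_mono) auto
      hence "ennreal (2 * (f (norm z) * (norm z)\<^sup>2)) \<le> ennreal (f (norm z) * (norm (z - d))\<^sup>2 + f (norm z) * (norm (z - - d))\<^sup>2)"
        by (intro ennreal_leI) (simp add: algebra_simps)
      also have "\<dots> = ennreal (f (norm z) * (norm (z - d))\<^sup>2) + ennreal (f (norm z) * (norm (z - - d))\<^sup>2)"
        using f_nonneg[of "norm z"] by (intro ennreal_plus) auto
      finally have "ennreal (2 * (f (norm z) * (norm z)\<^sup>2)) \<le> ennreal (f (norm z) * (norm (z - d))\<^sup>2) + ennreal (f (norm z) * (norm (z - - d))\<^sup>2)" .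
      thus "ennreal (2 * (f (norm z) * (norm z)\<^sup>2)) * indicator (cball 0 K) z \<le> ennreal (f (norm z) * (norm (z - d))\<^sup>2) * indicator (cball 0 K) z + ennreal (f (norm z) * (norm (z - - d))\<^sup>2) * indicator (cball 0 K) z"
        by (auto simp: indicator_def)
    qed
    also have "\<dots> = J d + J (- d)" unfolding J_def by (subst nn_integral_add) auto
    also have "\<dots> = 2 * J d" using Jm[of d] by (simp add: mult_2)
    finally show ?thesis by (subst (asm) ennreal_mult_le_mult_iff) auto
  qed
  have rk: "risk f \<delta> \<theta> = (\<integral>\<^sup>+z. ennreal (f (norm z) * (norm (\<delta> (\<theta> + z) - \<theta>))\<^sup>2) \<partial>lborel)" for \<theta>
  proof -
    have "risk f \<delta> \<theta> = (\<integral>\<^sup>+x. ennreal (f (norm (x - \<theta>))) * ennreal ((norm (\<delta> x - \<theta>))\<^sup>2) \<partial>lborel)"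
      unfolding risk_def expect_def sph_dist_def by (subst nn_integral_density) auto
    also have "\<dots> = (\<integral>\<^sup>+z. ennreal (f (norm z)) * ennreal ((norm (\<delta> (\<theta> + z) - \<theta>))\<^sup>2) \<partial>lborel)"
      by (subst nn_integral_lborel_shift[where a="\<theta>"]) simp_all
    finally show ?thesis using f_nonneg by (simp add: ennreal_mult)
  qed
  have "?mK * emeasure lborel (cball (0::real^'n) (R - K)) = (\<integral>\<^sup>+x. ?mK * indicator (cball (0::real^'n) (R - K)) x \<partial>lborel)"
    by (subst nn_integral_cmult_indicator) auto
  \<comment> \<open>For fixed x the decision acts as a single shift, d = x - \<delta> x. If |x|
    \<le> R - K, every error in the truncation ball comes from a parameter x - z in the ball of
    radius R.\<close>
  also have "\<dots> \<le> (\<integral>\<^sup>+x. (\<integral>\<^sup>+z. ennreal (f (norm z) * (norm (\<delta> x - (x - z)))\<^sup>2) * indicator (cball 0 R) (x - z) \<partial>lborel) \<partial>lborel)"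
  proof (rule nn_integral_mono)
    fix x :: "real^'n"
    show "?mK * indicator (cball 0 (R - K)) x \<le> (\<integral>\<^sup>+z. ennreal (f (norm z) * (norm (\<delta> x - (x - z)))\<^sup>2) * indicator (cball 0 R) (x - z) \<partial>lborel)"
    proof (cases "norm x \<le> R - K")
      case True
      have "?mK \<le> J (x - \<delta> x)" by (rule J)
      also have "\<dots> \<le> (\<integral>\<^sup>+z. ennreal (f (norm z) * (norm (\<delta> x - (x - z)))\<^sup>2) * indicator (cball 0 R) (x - z) \<partial>lborel)"
        unfolding J_def
      proof (rule nn_integral_mono)
        fix z :: "real^'n"
        have e: "z - (x - \<delta> x) = \<delta> x - (x - z)" by simp
        have "indicator (cball 0 K) z \<le> (indicator (cball 0 R) (x - z) :: ennreal)"
          using norm_triangle_ineq4[of x z] True by (auto simp: indicator_def)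
        thus "ennreal (f (norm z) * (norm (z - (x - \<delta> x)))\<^sup>2) * indicator (cball 0 K) z \<le> ennreal (f (norm z) * (norm (\<delta> x - (x - z)))\<^sup>2) * indicator (cball 0 R) (x - z)"
          unfolding e by (rule mult_left_mono) simp
      qed
      finally show ?thesis using True by simp
    qed simp
  qed
  also have "\<dots> = (\<integral>\<^sup>+z. (\<integral>\<^sup>+x. ennreal (f (norm z) * (norm (\<delta> x - (x - z)))\<^sup>2) * indicator (cball 0 R) (x - z) \<partial>lborel) \<partial>lborel)"
    by (intro lborel_pair.Fubini') measurable
  also have "\<dots> = (\<integral>\<^sup>+z. (\<integral>\<^sup>+\<theta>. ennreal (f (norm z) * (norm (\<delta> (\<theta> + z) - \<theta>))\<^sup>2) * indicator (cball 0 R) \<theta> \<partial>lborel) \<partial>lborel)"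
  proof (rule nn_integral_cong)
    fix z
    show "(\<integral>\<^sup>+x. ennreal (f (norm z) * (norm (\<delta> x - (x - z)))\<^sup>2) * indicator (cball 0 R) (x - z) \<partial>lborel) = (\<integral>\<^sup>+\<theta>. ennreal (f (norm z) * (norm (\<delta> (\<theta> + z) - \<theta>))\<^sup>2) * indicator (cball 0 R) \<theta> \<partial>lborel)"
      by (subst nn_integral_lborel_shift[where a=z]) (simp_all add: add.commute)
  qed
  also have "\<dots> = (\<integral>\<^sup>+\<theta>. (\<integral>\<^sup>+z. ennreal (f (norm z) * (norm (\<delta> (\<theta> + z) - \<theta>))\<^sup>2) * indicator (cball 0 R) \<theta> \<partial>lborel) \<partial>lborel)"
    by (intro lborel_pair.Fubini') measurable
  also have "\<dots> = (\<integral>\<^sup>+\<theta>. risk f \<delta> \<theta> * indicator (cball 0 R) \<theta> \<partial>lborel)"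
    unfolding rk by (intro nn_integral_cong nn_integral_multc) measurable
  also have "\<dots> \<le> (\<integral>\<^sup>+\<theta>. (SUP \<theta>. risk f \<delta> \<theta>) * indicator (cball (0::real^'n) R) \<theta> \<partial>lborel)"
    by (intro nn_integral_mono mult_right_mono SUP_upper) auto
  also have "\<dots> = (SUP \<theta>. risk f \<delta> \<theta>) * emeasure lborel (cball (0::real^'n) R)"
    by (subst nn_integral_cmult_indicator) auto
  finally show ?thesis .
qed

text \<open>Truncating errors at radius j makes the moment finite, so the volume ratio can be sent
  to 1 in real numbers; monotone convergence in j then covers an infinite second moment as
  well.\<close>

lemma moment_le_sup_risk:
  fixes \<delta> :: "real^'n \<Rightarrow> real^'n"
  assumes meas: "\<delta> \<in> borel_measurable borel"
  shows "expect f (0 :: real^'n) (\<lambda>x. (norm x)\<^sup>2) \<le> (SUP \<theta>. risk f \<delta> \<theta>)"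
proof (cases "(SUP \<theta>. risk f \<delta> \<theta>) = \<infinity>")
  case False
  then obtain c where c: "(SUP \<theta>. risk f \<delta> \<theta>) = ennreal c" "c \<ge> 0" by (cases "SUP \<theta>. risk f \<delta> \<theta>") auto
  have [measurable]: "cball (0::real^'n) r \<in> sets borel" for r by simp
  define mK where "mK j = (\<integral>\<^sup>+z. ennreal (f (norm z) * (norm z)\<^sup>2) * indicator (cball (0::real^'n) (real j)) z \<partial>lborel)" for j :: nat
  define v where "v = measure lborel (cball (0::real^'n) 1)"
  have v: "v > 0" by (simp add: v_def)
  have vol: "emeasure lborel (cball (0::real^'n) r) = ennreal (r ^ n * v)" if "r > 0" for r
    using that n by (simp add: v_def emeasure_cball content_cball ennreal_mult[symmetric] mult_ac)
  have mK: "mK j \<le> ennreal c" for j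
  proof -
    have "mK j \<le> (\<integral>\<^sup>+z. ennreal (f (norm z)) * ennreal ((real j)\<^sup>2) \<partial>(lborel :: (real^'n) measure))"
      unfolding mK_def
    proof (rule nn_integral_mono)
      fix z :: "real^'n"
      show "ennreal (f (norm z) * (norm z)\<^sup>2) * indicator (cball 0 (real j)) z \<le> ennreal (f (norm z)) * ennreal ((real j)\<^sup>2)"
      proof (cases "norm z \<le> real j")
        case True
        have "f (norm z) * (norm z)\<^sup>2 \<le> f (norm z) * (real j)\<^sup>2"
          using True f_nonneg[of "norm z"] by (intro mult_left_mono power_mono) auto
        thus ?thesis using True f_nonneg[of "norm z"] by (simp add: ennreal_mult[symmetric] ennreal_leI)
      qed simp
    qed
    also have "\<dots> = ennreal ((real j)\<^sup>2)" by (subst nn_integral_multc) (auto simp: f_mass)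
    finally have "mK j < \<infinity>" by (rule order_le_less_trans) simp
    then obtain m where m: "mK j = ennreal m" "m \<ge> 0" by (cases "mK j") auto
    have "m \<le> c"
    proof (rule le_of_power_ratio_le[where K="real j" and k=n])
      fix R assume R: "R > real j"
      have "ennreal m * ennreal ((R - real j) ^ n * v) \<le> ennreal c * ennreal (R ^ n * v)"
        using truncated_moment_le_risk[OF meas, of "real j" R] R vol[of R] vol[of "R - real j"]
        unfolding c(1) mK_def[symmetric] m(1) by simp
      hence "ennreal (m * ((R - real j) ^ n * v)) \<le> ennreal (c * (R ^ n * v))"
        using m(2) c(2) v R by (simp add: ennreal_mult)
      hence "m * ((R - real j) ^ n * v) \<le> c * (R ^ n * v)"
        using c(2) v R by (subst (asm) ennreal_le_iff) auto
      thus "m * (R - real j) ^ n \<le> c * R ^ n" using v by simp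
    qed simp
    thus ?thesis unfolding m(1) by (rule ennreal_leI)
  qed
  have "expect f (0 :: real^'n) (\<lambda>x. (norm x)\<^sup>2) = (\<integral>\<^sup>+z. ennreal (f (norm z) * (norm z)\<^sup>2) \<partial>(lborel :: (real^'n) measure))"
    unfolding expect_def sph_dist_def using f_nonneg by (subst nn_integral_density) (auto simp: ennreal_mult)
  also have "\<dots> = (\<integral>\<^sup>+z. (SUP j. ennreal (f (norm z) * (norm z)\<^sup>2) * indicator (cball (0::real^'n) (real j)) z) \<partial>lborel)"
  proof (rule nn_integral_cong)
    fix z :: "real^'n"
    obtain j where "norm z \<le> real j" using real_arch_simple by blast
    hence "ennreal (f (norm z) * (norm z)\<^sup>2) \<le> ennreal (f (norm z) * (norm z)\<^sup>2) * indicator (cball (0::real^'n) (real j)) z" by simp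
    also have "\<dots> \<le> (SUP j. ennreal (f (norm z) * (norm z)\<^sup>2) * indicator (cball (0::real^'n) (real j)) z)"
      by (rule SUP_upper) simp
    finally show "ennreal (f (norm z) * (norm z)\<^sup>2) = (SUP j. ennreal (f (norm z) * (norm z)\<^sup>2) * indicator (cball (0::real^'n) (real j)) z)"
      by (intro antisym SUP_least) (auto simp: indicator_def)
  qed
  also have "\<dots> = (SUP j. mK j)"
    unfolding mK_def
  proof (rule nn_integral_monotone_convergence_SUP)
    show "incseq (\<lambda>j z. ennreal (f (norm z) * (norm z)\<^sup>2) * indicator (cball (0::real^'n) (real j)) z)"
      by (intro incseq_SucI le_funI mult_left_mono) (auto simp: indicator_def)
  qed measurable
  also have "\<dots> \<le> ennreal c" by (intro SUP_least mK)
  finally show ?thesis unfolding c(1) .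
next
  case True
  thus ?thesis by (metis infinity_ennreal_def top_greatest)
qed

text \<open>Needed for \<open>finite_of_ennreal_mult_le\<close>: the criteria of part 1 bound a
  product of moments, and both must be shown finite.\<close>

lemma moment_nonzero:
  assumes [measurable]: "g \<in> borel_measurable borel" and g: "\<And>t. t > 0 \<Longrightarrow> g t > 0"
  shows "expect f (0 :: real^'n) (\<lambda>x. g (norm x)) \<noteq> 0"
proof
  assume "expect f (0 :: real^'n) (\<lambda>x. g (norm x)) = 0"
  hence "AE t in lborel. ennreal (\<sigma> * (indicator {0<..} t *\<^sub>R (t ^ (n - 1) * f t * g t))) = 0"
    using g by (subst (asm) expect_0_radial) (auto simp: nn_integral_0_iff_AE less_imp_le)
  hence "AE t in lborel. indicator {0<..} t *\<^sub>R (t ^ (n - 1) * f t) = 0"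
  proof eventually_elim
    case (elim t)
    show ?case
    proof (cases "t > 0")
      case True
      hence "\<sigma> * (t ^ (n - 1) * f t * g t) \<le> 0" using elim by (simp add: ennreal_eq_0_iff)
      moreover have "0 < \<sigma> * t ^ (n - 1) * g t" using True g[OF True] sigma_pos by simp
      ultimately have "(\<sigma> * t ^ (n - 1) * g t) * f t \<le> (\<sigma> * t ^ (n - 1) * g t) * 0" by (simp add: mult_ac)
      hence "f t \<le> 0" using \<open>0 < \<sigma> * t ^ (n - 1) * g t\<close> by (simp only: mult_le_cancel_left_pos)
      thus ?thesis using f_nonneg[of t] True by simp
    qed simp
  qed
  hence "(LINT t:{0<..}|lborel. t ^ (n - 1) * f t) = 0"
    unfolding set_lebesgue_integral_def by (subst integral_cong_AE[where g="\<lambda>_. 0"]) auto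
  thus False using mass_pos by simp
qed

lemma second_moment:
  assumes "expect f (0 :: real^'n) (\<lambda>x. (norm x)\<^sup>2) < \<infinity>"
  shows "set_integrable lborel {0<..} (\<lambda>t. t ^ (n + 1) * f t)"
    "expect f (0 :: real^'n) (\<lambda>x. (norm x)\<^sup>2) = ennreal (\<sigma> * (LINT t:{0<..}|lborel. t ^ (n + 1) * f t))"
proof -
  have e: "t ^ (n - 1) * f t * t\<^sup>2 = t ^ (n + 1) * f t" for t
  proof -
    have "t ^ (n + 1) = t ^ (n - 1) * t\<^sup>2" using dim by (intro power_split) simp
    thus ?thesis by simp
  qed
  show "set_integrable lborel {0<..} (\<lambda>t. t ^ (n + 1) * f t)"
    "expect f (0 :: real^'n) (\<lambda>x. (norm x)\<^sup>2) = ennreal (\<sigma> * (LINT t:{0<..}|lborel. t ^ (n + 1) * f t))"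
    using radial_moment[of "\<lambda>t. t\<^sup>2"] assms unfolding e by simp_all
qed

lemma inverse_second_moment:
  assumes "expect f (0 :: real^'n) (\<lambda>x. norm x powi (-2)) < \<infinity>"
  shows "set_integrable lborel {0<..} (\<lambda>t. t ^ (n - 3) * f t)"
    "expect f (0 :: real^'n) (\<lambda>x. norm x powi (-2)) = ennreal (\<sigma> * (LINT t:{0<..}|lborel. t ^ (n - 3) * f t))"
proof -
  have e: "t ^ (n - 1) * f t * inverse (t\<^sup>2) = t ^ (n - 3) * f t" if "t > 0" for t
  proof -
    have "t ^ (n - 1) = t ^ (n - 3) * t\<^sup>2" using dim by (intro power_split) simp
    thus ?thesis using that by simp
  qed
  have fin: "expect f (0 :: real^'n) (\<lambda>x. inverse ((norm x)\<^sup>2)) < \<infinity>" using assms unfolding powi_minus_2 .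
  have i: "set_integrable lborel {0<..} (\<lambda>t. t ^ (n - 1) * f t * inverse (t\<^sup>2))"
    and v: "expect f (0 :: real^'n) (\<lambda>x. inverse ((norm x)\<^sup>2)) = ennreal (\<sigma> * (LINT t:{0<..}|lborel. t ^ (n - 1) * f t * inverse (t\<^sup>2)))"
    using radial_moment[of "\<lambda>t. inverse (t\<^sup>2)"] fin by simp_all
  show "set_integrable lborel {0<..} (\<lambda>t. t ^ (n - 3) * f t)"
    using i by (rule set_integrable_cong[THEN iffD1, rotated -1]) (use e in auto)
  have "(LINT t:{0<..}|lborel. t ^ (n - 1) * f t * inverse (t\<^sup>2)) = (LINT t:{0<..}|lborel. t ^ (n - 3) * f t)"
    by (intro set_lebesgue_integral_cong) (use e in auto)
  thus "expect f (0 :: real^'n) (\<lambda>x. norm x powi (-2)) = ennreal (\<sigma> * (LINT t:{0<..}|lborel. t ^ (n - 3) * f t))"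
    unfolding powi_minus_2 v by simp
qed

lemma minimax_of_star:
  assumes m2: "expect f (0 :: real^'n) (\<lambda>x. (norm x)\<^sup>2) < \<infinity>"
    and star: "\<And>a (e :: real^'n). a \<ge> 0 \<Longrightarrow> norm e = 1 \<Longrightarrow>
      radial_mean.I2 f n * radial_mean.Hh f n (hm a e) \<le> 2 * real n * radial_mean.I f n * radial_mean.HF f n (hm a e)"
  shows "minimax f (harmonic_bayes f :: real^'n \<Rightarrow> real^'n)"
  unfolding minimax_def
proof (intro conjI allI impI)
  show "(harmonic_bayes f :: real^'n \<Rightarrow> real^'n) \<in> borel_measurable borel" by (rule harmonic_bayes_measurable)
  fix \<delta>' :: "real^'n \<Rightarrow> real^'n" assume "\<delta>' \<in> borel_measurable borel"
  hence lower: "expect f (0 :: real^'n) (\<lambda>x. (norm x)\<^sup>2) \<le> (SUP \<theta>. risk f \<delta>' \<theta>)" by (rule moment_le_sup_risk)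
  have "risk f (harmonic_bayes f) \<theta> \<le> expect f (0 :: real^'n) (\<lambda>x. (norm x)\<^sup>2)" for \<theta> :: "real^'n"
  proof -
    obtain a and e :: "real^'n" where ae: "norm e = 1" "a \<ge> 0" "\<theta> = a *\<^sub>R e" by (rule polar_form)
    show ?thesis unfolding ae(3) second_moment(2)[OF m2]
      by (rule risk_le_radial[OF ae(1,2) second_moment(1)[OF m2] star[OF ae(2,1)]])
  qed
  hence "(SUP \<theta>. risk f (harmonic_bayes f) (\<theta> :: real^'n)) \<le> expect f (0 :: real^'n) (\<lambda>x. (norm x)\<^sup>2)" by (rule SUP_least)
  thus "(SUP \<theta>. risk f (harmonic_bayes f) (\<theta> :: real^'n)) \<le> (SUP \<theta>. risk f \<delta>' \<theta>)" using lower by (rule order_trans)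
qed

section \<open>From monotone ratios in \<open>ennreal\<close> to inequalities without
  denominators\<close>

lemma tail_dom_iff: "t \<in> tail_dom f \<longleftrightarrow> t > 0 \<and> F t > 0"
  by (auto simp: tail_dom_def tail_int_eq)

lemma tail_ratio_pos: "t > 0 \<Longrightarrow> f t > 0 \<Longrightarrow> tail_ratio f t = ennreal (F t / f t)"
  using F_nonneg by (simp add: tail_ratio_def tail_int_eq divide_ennreal)

lemma tail_ratio_zero: "t > 0 \<Longrightarrow> F t > 0 \<Longrightarrow> f t = 0 \<Longrightarrow> tail_ratio f t = \<infinity>"
  by (simp add: tail_ratio_def tail_int_eq ennreal_divide_zero)

text \<open>Off the domain the cross-multiplied inequality is trivial, since F t = 0. On it, f s > 0
  and f t = 0 would make the ratio jump to infinity, against monotonicity.\<close>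

lemma radial_profile_ratioI:
  assumes anti: "antimono_on (tail_dom f) (\<lambda>t. ennreal (t powi (-2)) * tail_ratio f t)"
  shows "radial_profile_ratio f n"
proof
  fix s t :: real assume st: "0 < s" "s < t"
  show "s\<^sup>2 * f s * F t \<le> t\<^sup>2 * f t * F s"
  proof (cases "F t = 0 \<or> f s = 0")
    case True
    thus ?thesis using F_nonneg[of s] f_nonneg[of t] st by auto
  next
    case False
    hence Ft: "F t > 0" and fs: "f s > 0" using F_nonneg[of t] f_nonneg[of s] st by auto
    have Fs: "F s > 0" using F_antimono[of s t] Ft st by simp
    have "ennreal (t powi (-2)) * tail_ratio f t \<le> ennreal (s powi (-2)) * tail_ratio f s"
      using anti st Ft Fs by (intro monotone_onD[OF anti]) (auto simp: tail_dom_iff)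
    hence le: "ennreal (inverse (t\<^sup>2)) * tail_ratio f t \<le> ennreal (inverse (s\<^sup>2) * (F s / f s))"
      unfolding powi_minus_2 tail_ratio_pos[OF st(1) fs] using Fs fs by (subst ennreal_mult) auto
    have ft: "f t > 0"
    proof (rule ccontr)
      assume "\<not> f t > 0"
      hence "f t = 0" using f_nonneg[of t] st by simp
      hence "ennreal (inverse (t\<^sup>2)) * tail_ratio f t = \<infinity>" using tail_ratio_zero[of t] Ft st by (simp add: ennreal_mult_top)
      thus False using le by (simp add: top_unique)
    qed
    have "ennreal (inverse (t\<^sup>2) * (F t / f t)) \<le> ennreal (inverse (s\<^sup>2) * (F s / f s))"
      using le ft Ft st tail_ratio_pos[of t] by (subst ennreal_mult) auto
    hence "inverse (t\<^sup>2) * (F t / f t) \<le> inverse (s\<^sup>2) * (F s / f s)"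
      using Fs fs by (subst (asm) ennreal_le_iff) auto
    thus ?thesis using st ft fs by (simp add: field_simps)
  qed
qed

lemma ratio_monoD:
  assumes mono: "mono_on (tail_dom f) (tail_ratio f)" and st: "0 < s" "s < t" and Ft: "F t > 0"
  shows "F s * f t \<le> F t * f s"
proof (cases "f t = 0")
  case True
  thus ?thesis using Ft f_nonneg[of s] st by simp
next
  case False
  hence ft: "f t > 0" using f_nonneg[of t] st by simp
  have Fs: "F s > 0" using F_antimono[of s t] Ft st by simp
  have le: "tail_ratio f s \<le> ennreal (F t / f t)"
    using monotone_onD[OF mono, of s t] tail_ratio_pos[of t] st Ft Fs ft by (simp add: tail_dom_iff)
  have fs: "f s > 0"
  proof (rule ccontr)
    assume "\<not> f s > 0"
    hence "tail_ratio f s = \<infinity>" using f_nonneg[of s] tail_ratio_zero[of s] Fs st by simp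
    thus False using le by (simp add: top_unique)
  qed
  have "F s / f s \<le> F t / f t" using le tail_ratio_pos[of s] st fs Ft ft by (simp add: ennreal_le_iff)
  thus ?thesis using fs ft by (simp add: field_simps)
qed

end

theorem theorem4p2:
  fixes f :: "real \<Rightarrow> real" and p :: nat
    and \<delta> :: "real^'n::finite \<Rightarrow> real^'n"
    and m2 m2inv :: ennreal
    and U :: "real set"
  assumes "p = CARD('n)" and "p \<ge> 4"
    and "radial_density TYPE('n) f"
  defines "\<delta> \<equiv> harmonic_bayes f"
    and "m2 \<equiv> expect f 0 (\<lambda>x::real^'n. (norm x)\<^sup>2)"
    and "m2inv \<equiv> expect f 0 (\<lambda>x::real^'n. norm x powi (-2))"
    and "U \<equiv> {t. t \<ge> 0 \<and> f t > 0}"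
  shows
    "(antimono_on (tail_dom f) (\<lambda>t. ennreal (t powi (-2)) * tail_ratio f t) \<longrightarrow>
        (m2 * m2inv \<le> 2 \<longrightarrow> minimax f \<delta>) \<and>
        (antimono_on {0<..} f \<longrightarrow>
           ennreal ((real p)\<^sup>2 - 4) * m2 * m2inv \<le> ennreal (2 * (real p)\<^sup>2) \<longrightarrow> minimax f \<delta>) \<and>
        (mono_on (tail_dom f) (tail_ratio f) \<longrightarrow>
           ennreal (real p - 2) * m2 * m2inv \<le> ennreal (2 * real p) \<longrightarrow> minimax f \<delta>)) \<and>
     (0 < (INF s\<in>U. tail_ratio f s) \<and> (INF s\<in>U. tail_ratio f s) < \<infinity> \<longrightarrow>
        m2 \<le> ennreal (2 * real p) * (INF s\<in>U. tail_ratio f s) \<longrightarrow> minimax f \<delta>)"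
proof -
  define \<sigma> where "\<sigma> = polar_const TYPE(real^'n)"
  interpret spherical f "TYPE('n)" p \<sigma>
    using assms(1-3) by unfold_locales (simp_all add: \<sigma>_def)
  define I where "I = (LINT t:{0<..}|lborel. t ^ (p - 1) * f t)"
  define I2 where "I2 = (LINT t:{0<..}|lborel. t ^ (p + 1) * f t)"
  define Im2 where "Im2 = (LINT t:{0<..}|lborel. t ^ (p - 3) * f t)"
  have sI: "\<sigma> * I = 1" unfolding I_def by (rule mass(2))
  have m2_pos: "m2 \<noteq> 0" using moment_nonzero[of "\<lambda>t. t\<^sup>2"] by (simp add: m2_def)
  have m2inv_pos: "m2inv \<noteq> 0" unfolding m2inv_def powi_minus_2 by (rule moment_nonzero) auto
  \<comment> \<open>The common form of the criteria of part 1, with (C, D) equal to (1, 2), (p^2 -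
    4, 2 p^2) and (p - 2, 2 p). Finiteness of both moments is a consequence of the
    criterion.\<close>
  have key: "minimax f \<delta>"
    if C: "C > 0" and D: "D \<ge> 0" and le: "ennreal C * m2 * m2inv \<le> ennreal D"
      and ratio: "radial_profile_ratio f p"
      and star: "\<And>h. radial_mean_monotone f p h \<Longrightarrow> C * (I2 * Im2) \<le> D * I\<^sup>2 \<Longrightarrow>
        I2 * radial_mean.Hh f p h \<le> 2 * real p * I * radial_mean.HF f p h" for C D
  proof -
    have "ennreal C * m2 \<noteq> 0" using C m2_pos by simp
    from finite_of_ennreal_mult_le[OF le this m2inv_pos] have f1: "ennreal C * m2 < \<infinity>" and fi: "m2inv < \<infinity>" by auto
    have fm: "m2 < \<infinity>" using f1 C by (auto simp: less_top[symmetric] ennreal_mult_eq_top_iff)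
    note s = second_moment[OF fm[unfolded m2_def], folded m2_def I2_def]
    note i = inverse_second_moment[OF fi[unfolded m2inv_def], folded m2inv_def Im2_def]
    have I20: "I2 \<ge> 0" unfolding I2_def by (rule set_integral_f_nonneg) auto
    have Im20: "Im2 \<ge> 0" unfolding Im2_def by (rule set_integral_f_nonneg) auto
    have "ennreal C * m2 * m2inv = ennreal (C * (\<sigma> * I2) * (\<sigma> * Im2))"
      unfolding s(2) i(2) using C sigma_pos I20 Im20 by (simp add: ennreal_mult)
    hence "C * (\<sigma> * I2) * (\<sigma> * Im2) \<le> D" using le D by (simp add: ennreal_le_iff)
    hence "C * (\<sigma> * I2) * (\<sigma> * Im2) * I\<^sup>2 \<le> D * I\<^sup>2" by (intro mult_right_mono) auto
    \<comment> \<open>Since \<sigma> I = 1, multiplying by I^2 removes the sphere area from the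
      product of the two moments.\<close>
    moreover have "C * (\<sigma> * I2) * (\<sigma> * Im2) * I\<^sup>2 = C * (I2 * Im2) * (\<sigma> * I)\<^sup>2" by (simp add: power2_eq_square mult_ac)
    ultimately have main: "C * (I2 * Im2) \<le> D * I\<^sup>2" using sI by simp
    show ?thesis unfolding \<delta>_def
    proof (rule minimax_of_star[OF fm[unfolded m2_def]])
      fix a :: real and e :: "real^'n" assume ae: "a \<ge> 0" "norm e = 1"
      interpret RM: radial_mean_monotone f p "hm a e" by (rule radial_mean_monotone_hm[OF ae(2,1) s(1) i(1) ratio])
      show "RM.I2 * RM.Hh \<le> 2 * real p * RM.I * RM.HF"
        using star[OF RM.radial_mean_monotone_axioms main] unfolding I2_def I_def RM.I2_def RM.I_def .
    qed
  qed
  show ?thesis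
  proof (intro conjI impI)
    assume anti: "antimono_on (tail_dom f) (\<lambda>t. ennreal (t powi (-2)) * tail_ratio f t)"
    note ratio = radial_profile_ratioI[OF anti]
    assume le: "m2 * m2inv \<le> 2"
    show "minimax f \<delta>"
    proof (rule key[of 1 2, OF _ _ _ ratio])
      fix h assume h: "radial_mean_monotone f p h" and le: "1 * (I2 * Im2) \<le> 2 * I\<^sup>2"
      interpret RM: radial_mean_monotone f p h by fact
      show "I2 * RM.Hh \<le> 2 * real p * I * RM.HF"
        using RM.star_general le unfolding I2_def I_def Im2_def RM.I2_def RM.I_def RM.Im2_def by simp
    qed (use le in simp_all)
  next
    assume anti: "antimono_on (tail_dom f) (\<lambda>t. ennreal (t powi (-2)) * tail_ratio f t)"
    note ratio = radial_profile_ratioI[OF anti]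
    assume le: "ennreal ((real p)\<^sup>2 - 4) * m2 * m2inv \<le> ennreal (2 * (real p)\<^sup>2)" and fa: "antimono_on {0<..} f"
    have p4: "(real p)\<^sup>2 - 4 > 0"
      using power_mono[of 4 "real p" 2] assms(2) by simp
    show "minimax f \<delta>"
    proof (rule key[OF p4 _ le ratio])
      fix h assume h: "radial_mean_monotone f p h" and le: "((real p)\<^sup>2 - 4) * (I2 * Im2) \<le> 2 * (real p)\<^sup>2 * I\<^sup>2"
      interpret RM: radial_mean_monotone f p h by fact
      have "f t \<le> f s" if "0 < s" "s \<le> t" for s t
        using monotone_onD[OF fa, of s t] that by simp
      from RM.star_antimono[OF this] le show "I2 * RM.Hh \<le> 2 * real p * I * RM.HF"
        unfolding I2_def I_def Im2_def RM.I2_def RM.I_def RM.Im2_def by simp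
    qed simp
  next
    assume anti: "antimono_on (tail_dom f) (\<lambda>t. ennreal (t powi (-2)) * tail_ratio f t)"
    note ratio = radial_profile_ratioI[OF anti]
    assume le: "ennreal (real p - 2) * m2 * m2inv \<le> ennreal (2 * real p)" and mono: "mono_on (tail_dom f) (tail_ratio f)"
    show "minimax f \<delta>"
    proof (rule key[OF _ _ le ratio])
      fix h assume h: "radial_mean_monotone f p h" and le: "(real p - 2) * (I2 * Im2) \<le> 2 * real p * I\<^sup>2"
      interpret RM: radial_mean_monotone f p h by fact
      from RM.star_ratio_mono[OF ratio_monoD[OF mono]] le show "I2 * RM.Hh \<le> 2 * real p * I * RM.HF"
        unfolding I2_def I_def Im2_def RM.I2_def RM.I_def RM.Im2_def by simp
    qed (use assms(2) in simp_all)
  next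
    assume inf: "0 < (INF s\<in>U. tail_ratio f s) \<and> (INF s\<in>U. tail_ratio f s) < \<infinity>"
      and le: "m2 \<le> ennreal (2 * real p) * (INF s\<in>U. tail_ratio f s)"
    obtain c where c: "(INF s\<in>U. tail_ratio f s) = ennreal c" "c \<ge> 0"
      using inf by (cases "INF s\<in>U. tail_ratio f s") auto
    have le': "m2 \<le> ennreal (2 * real p * c)" using le c by (simp add: ennreal_mult)
    hence fm: "m2 < \<infinity>" by (rule order_le_less_trans) simp
    note s = second_moment[OF fm[unfolded m2_def], folded m2_def I2_def]
    have "\<sigma> * I2 \<le> 2 * real p * c" using le' c(2) unfolding s(2) by (subst (asm) ennreal_le_iff) auto
    hence "\<sigma> * I2 * I \<le> 2 * real p * c * I" using mass_pos unfolding I_def by (intro mult_right_mono) auto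
    moreover have "\<sigma> * I2 * I = I2 * (\<sigma> * I)" by simp
    ultimately have main: "I2 \<le> 2 * real p * c * I" using sI by simp
    \<comment> \<open>Off \<open>U\<close> the density vanishes and only F \<ge> 0 is used; on
      \<open>U\<close> the infimum bounds F / f from below.\<close>
    have cf: "c * f t \<le> F t" if t: "t > 0" for t
    proof (cases "f t = 0")
      case True
      thus ?thesis using F_nonneg[OF t] by simp
    next
      case False
      hence ft: "f t > 0" using f_nonneg[of t] t by simp
      hence "ennreal c \<le> tail_ratio f t" unfolding c(1)[symmetric] using t by (intro INF_lower) (simp add: U_def)
      hence "c \<le> F t / f t" using tail_ratio_pos[OF t ft] F_nonneg[OF t] ft by (simp add: ennreal_le_iff)
      thus ?thesis using ft by (simp add: le_divide_eq)
    qed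
    show "minimax f \<delta>" unfolding \<delta>_def
    proof (rule minimax_of_star[OF fm[unfolded m2_def]])
      fix a :: real and e :: "real^'n" assume ae: "a \<ge> 0" "norm e = 1"
      interpret RM: radial_mean f p "hm a e" by (rule radial_mean_hm[OF ae(2,1) s(1)])
      show "RM.I2 * RM.Hh \<le> 2 * real p * RM.I * RM.HF"
        using RM.star_ratio_bounded_below[OF c(2) cf] main unfolding I2_def I_def RM.I2_def RM.I_def by simp
    qed
  qed
qed

end
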